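(* For every integer $n\ge 1$: $$\overline{N}(0,3,n)>\overline{N}(1,3,n)\quad\text{if } n\equiv 0,1\pmod 3,$$ $$\overline{N}(0,3,n)<\overline{N}(1,3,n)\quad\text{if } n\equiv 2\pmod 3.$$
   Context: An overpartition of a positive integer $n$ is a partition of $n$ (a non-increasing sequence of positive integers with sum $n$) in which the first occurrence of each distinct part may or may not be overlined; thus a partition with $d$ distinct part sizes gives rise to $2^d$ overpartitions. The rank of an overpartition is its largest part minus its number of parts (overlines are ignored). $\overline{N}(a,c,n)$ denotes the number of overpartitions of $n$ whose rank is congruent to $a$ modulo $c$. *)

theory Defs
  imports Complex_Main "HOL-Number_Theory.Cong"
begin

text \<open>
  A part is a pair of its size and a flag telling whether it is overlined.
\<close>

definition overpartition :: "nat \<Rightarrow> (nat \<times> bool) list \<Rightarrow> bool" where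
  "overpartition n ps \<longleftrightarrow>
     sorted_wrt (\<ge>) (map fst ps) \<and>
     (\<forall>p \<in> set ps. fst p > 0) \<and>
     sum_list (map fst ps) = n \<and>
     (\<forall>i j. i < j \<and> j < length ps \<and> fst (ps ! i) = fst (ps ! j) \<longrightarrow> \<not> snd (ps ! j))"

text \<open>The rank is only meaningful for nonempty lists, that is, for \<open>n \<ge> 1\<close>.\<close>

definition overpartition_rank :: "(nat \<times> bool) list \<Rightarrow> int" where
  "overpartition_rank ps = int (Max (fst ` set ps)) - int (length ps)"

definition Nbar :: "int \<Rightarrow> int \<Rightarrow> nat \<Rightarrow> nat" where
  "Nbar a c n = card {ps. overpartition n ps \<and> [overpartition_rank ps = a] (mod c)}"

lemma finite_overpartitions: "finite {ps. overpartition n ps}"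
proof (rule finite_subset)
  show "{ps. overpartition n ps} \<subseteq>
          {ps. set ps \<subseteq> {..n} \<times> UNIV \<and> length ps \<le> n}"
  proof safe
    fix ps a b
    assume ps: "overpartition n ps"
    {
      assume "(a, b) \<in> set ps"
      then have "a \<in> set (map fst ps)" by force
      then show "a \<le> n"
        using ps member_le_sum_list[of a "map fst ps"] by (auto simp: overpartition_def)
    }
  next
    fix ps :: "(nat \<times> bool) list"
    assume ps: "overpartition n ps"
    have "(\<forall>p \<in> set ps. fst p > 0) \<Longrightarrow> length ps \<le> sum_list (map fst ps)"
      by (induction ps) (auto simp: Suc_le_eq)
    with ps show "length ps \<le> n" by (auto simp: overpartition_def)
  qed auto
  show "finite {ps. set ps \<subseteq> {..n} \<times> (UNIV :: bool set) \<and> length ps \<le> n}"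
    by (rule finite_lists_length_le) simp
qed

end

theory Submission imports Defs "HOL-Analysis.Analysis" begin

text \<open>
  Let \<open>T(q)\<close> be the generating function of the difference of the two counts. Removing the largest part, or
  dually one from each part, gives two recurrences for the generating functions of overpartitions by number of
  parts and largest part, symmetric under conjugation. Eliminating between them, the tails \<open>V\<^sub>m\<close> of the rank
  distribution satisfy \<open>V\<^sub>m + q\<^bsup>m+1\<^esup> V\<^sub>m\<^sub>+\<^sub>2 = q\<^bsup>m+1\<^esup> (1 + 2 V\<^sub>0)\<close>, and hence \<open>\<phi>(-q) V\<^sub>m\<close> is an explicit partial
  theta series. This yields \<open>\<phi>(-q) T(q) = 1 + 6 \<Sum>\<^bsub>n\<ge>1\<^esub> (-1)\<^sup>n (q\<^bsup>n*n+n\<^esup> - q\<^bsup>n*n+2*n\<^esup>) / (1 - q\<^bsup>3*n\<^esup>)\<close>.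

  Both \<open>\<phi>(-q)\<close> and the right-hand side are split by residues of exponents modulo 3. With theta series \<open>P\<close> and \<open>J\<close>
  with nonnegative coefficients, the pieces of \<open>T\<close> turn out to be, in the variable \<open>x = q\<^sup>3\<close> and with
  \<open>E(x)\<close> the product of all \<open>1 - x\<^bsup>2*n\<^esup>\<close>,
  \<open>P\<^sup>2 / E\<close>, \<open>P J / E\<close> and \<open>- (J\<^sup>2 / (2 E) + 6 x Y)\<close>, where \<open>Y\<close> is a sum of shifted rank tails \<open>V\<^sub>2\<^sub>j\<close> and so is nonnegative
  as well. The three signs can be read off.
\<close>

section \<open>Generating functions of overpartitions by rank\<close>

text \<open>Splitting the Lambert-type series modulo 3 leaves two sums, over \<open>aterm\<close>
  and \<open>bterm\<close>, neither of which has a visible product form. Two relations replace one.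
  Writing 1/(1-v) as (1+v)/(1-v^2) separates \<open>bterm\<close> into a reciprocal theta series,
  which is a product, and a remainder \<open>yterm\<close>. A double series summed in both orders
  then gives a linear relation between the two sums, with right-hand side -u, where u is the sum of
  k x^(k(3k-1)/2) over all integers k. This theta derivative follows from the product for the sum of
  (6k+1) x^(k(3k+1)/2).

  The remainder is never evaluated: it is carried through the algebra as a free parameter and
  survives in one residue class only. Expanding its denominators geometrically is what turns it back
  into rank tails, so the combinatorics is used a second time, for a sign. It also gives strictness
  at n = 5, where J^2/E contributes nothing.

  The rank part is purely formal, while the theta part concerns complex functions at small nonzero
  q. Agreement near 0 carries the final identity back to coefficients.\<close>

lemma overpartition_Cons:
  "overpartition n (p # ps) \<longleftrightarrow>
     0 < fst p \<and> fst p \<le> n \<and> overpartition (n - fst p) ps \<and>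
     (\<forall>x\<in>set ps. fst x \<le> fst p \<and> (fst x = fst p \<longrightarrow> \<not> snd x))"
  (is "?l \<longleftrightarrow> ?r")
proof
  assume l: ?l
  have flag: "\<not> snd ((p # ps) ! j)" if "i < j" "j < length (p # ps)"
    "fst ((p # ps) ! i) = fst ((p # ps) ! j)" for i j
    using l that unfolding overpartition_def by blast
  have "\<not> snd x" if x: "x \<in> set ps" and e: "fst x = fst p" for x
  proof -
    obtain j where "j < length ps" "x = ps ! j" using x by (metis in_set_conv_nth)
    then show ?thesis using flag[of 0 "Suc j"] e by simp
  qed
  moreover have "\<not> snd (ps ! j)" if "i < j" "j < length ps" "fst (ps ! i) = fst (ps ! j)" for i j
    using flag[of "Suc i" "Suc j"] that by simp
  ultimately show ?r using l unfolding overpartition_def by auto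
next
  assume r: ?r
  have "\<not> snd ((p # ps) ! j)" if ij: "i < j" "j < length (p # ps)"
    "fst ((p # ps) ! i) = fst ((p # ps) ! j)" for i j
  proof (cases i)
    case 0
    then have "(p # ps) ! j \<in> set ps" using ij by (cases j) auto
    then show ?thesis using r ij 0 by auto
  next
    case (Suc i')
    then obtain j' where "j = Suc j'" using ij by (cases j) auto
    then show ?thesis using r ij Suc unfolding overpartition_def by auto
  qed
  then show ?l using r unfolding overpartition_def by auto
qed

lemma overpartition_Nil [simp]: "overpartition n [] \<longleftrightarrow> n = 0"
  by (auto simp: overpartition_def)

text \<open>Overlining the first largest part is a free choice, so it suffices to count the
  overpartitions in which it is not overlined.\<close>

definition plain_head :: "nat \<Rightarrow> nat \<Rightarrow> nat \<Rightarrow> (nat \<times> bool) list set" where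
  "plain_head s l n = {ps. overpartition n ps \<and> length ps = s \<and> ps \<noteq> [] \<and> hd ps = (l, False)}"

lemma finite_plain_head [simp]: "finite (plain_head s l n)"
  by (rule finite_subset[OF _ finite_overpartitions[of n]]) (auto simp: plain_head_def)

lemma plain_head_0 [simp]: "plain_head 0 l n = {}"
  by (auto simp: plain_head_def)

lemma plain_head_zero [simp]: "plain_head s 0 n = {}"
proof -
  have "\<not> (overpartition n ps \<and> length ps = s \<and> ps \<noteq> [] \<and> hd ps = (0, False))" for ps
    by (cases ps) (auto simp: overpartition_Cons)
  then show ?thesis by (auto simp: plain_head_def)
qed

definition head_in :: "nat \<Rightarrow> nat \<Rightarrow> nat \<Rightarrow> bool \<Rightarrow> (nat \<times> bool) list set" where
  "head_in s l n b = {ps. overpartition n ps \<and> length ps = s \<and> ps \<noteq> [] \<and> hd ps = (l, b)}"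

lemma finite_head_in [simp]: "finite (head_in s l n b)"
  by (rule finite_subset[OF _ finite_overpartitions[of n]]) (auto simp: head_in_def)

text \<open>Overwriting the flag of the first entry is a bijection, since the conditions on later
  entries look only at the size of the head.\<close>

lemma card_head_in: "card (head_in s l n b) = card (plain_head s l n)"
proof (rule bij_betw_same_card[of "\<lambda>ps. (l, False) # tl ps"],
       rule bij_betw_byWitness[where f' = "\<lambda>ps. (l, b) # tl ps"])
  show "\<forall>a\<in>head_in s l n b. (l, b) # tl ((l, False) # tl a) = a"
    by (auto simp: head_in_def neq_Nil_conv)
  show "\<forall>a\<in>plain_head s l n. (l, False) # tl ((l, b) # tl a) = a"
    by (auto simp: plain_head_def neq_Nil_conv)
  show "(\<lambda>ps. (l, False) # tl ps) ` head_in s l n b \<subseteq> plain_head s l n"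
    by (auto simp: plain_head_def head_in_def neq_Nil_conv overpartition_Cons)
  show "(\<lambda>ps. (l, b) # tl ps) ` plain_head s l n \<subseteq> head_in s l n b"
    by (auto simp: plain_head_def head_in_def neq_Nil_conv overpartition_Cons)
qed

lemma plain_head_Suc_0:
  "0 < l \<Longrightarrow> plain_head (Suc 0) l n = (if n = l then {[(l, False)]} else {})"
  by (auto simp: plain_head_def length_Suc_conv overpartition_Cons)

text \<open>Once the head \<open>l\<close> is removed, the next part either equals \<open>l\<close>
  and must then be plain, or is smaller and may carry either flag.\<close>

lemma plain_head_Suc_Suc:
  assumes "0 < l"
  shows "plain_head (Suc (Suc s)) l n =
    (if n < l then {} else
      Cons (l, False) ` (plain_head (Suc s) l (n - l) \<union>
        (\<Union>(k, b) \<in> {..<l} \<times> UNIV. head_in (Suc s) k (n - l) b)))"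
    (is "_ = (if _ then _ else ?R)")
proof -
  have "ps \<in> plain_head (Suc (Suc s)) l n \<longleftrightarrow> \<not> n < l \<and> ps \<in> ?R" for ps
  proof
    assume A: "ps \<in> plain_head (Suc (Suc s)) l n"
    then obtain k b rs where ps: "ps = (l, False) # (k, b) # rs"
      by (auto simp: plain_head_def length_Suc_conv)
    from A have "l \<le> n" "k \<le> l" "k = l \<Longrightarrow> \<not> b" "overpartition (n - l) ((k, b) # rs)" "length rs = s"
      by (auto simp: plain_head_def ps overpartition_Cons)
    then show "\<not> n < l \<and> ps \<in> ?R"
      unfolding ps by (cases "k = l") (force simp: plain_head_def head_in_def)+
  next
    assume R: "\<not> n < l \<and> ps \<in> ?R"
    then obtain k b rs where ps: "ps = (l, False) # (k, b) # rs" and k: "k < l \<or> k = l \<and> \<not> b"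
      and o: "overpartition (n - l) ((k, b) # rs)" and len: "length rs = s"
      by (auto simp: plain_head_def head_in_def length_Suc_conv)
    then show "ps \<in> plain_head (Suc (Suc s)) l n"
      using R assms by (auto simp: plain_head_def ps overpartition_Cons)
  qed
  then show ?thesis by auto
qed

lemma card_plain_head_Suc_Suc:
  assumes "0 < l"
  shows "card (plain_head (Suc (Suc s)) l n) =
    (if n < l then 0 else card (plain_head (Suc s) l (n - l)) + 2 * (\<Sum>k<l. card (plain_head (Suc s) k (n - l))))"
proof (cases "n < l")
  case False
  let ?U = "\<Union>(k, b) \<in> {..<l} \<times> UNIV. head_in (Suc s) k (n - l) b"
  have "card ?U = (\<Sum>(k, b) \<in> {..<l} \<times> UNIV. card (head_in (Suc s) k (n - l) b))"
    by (subst card_UN_disjoint) (simp_all add: case_prod_unfold, auto simp: head_in_def)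
  also have "\<dots> = 2 * (\<Sum>k<l. card (plain_head (Suc s) k (n - l)))"
    by (simp add: card_head_in sum.cartesian_product[symmetric] sum_distrib_left UNIV_bool mult_2)
  finally have U: "card ?U = 2 * (\<Sum>k<l. card (plain_head (Suc s) k (n - l)))" .
  have fU: "finite ?U" by auto
  have "card (plain_head (Suc s) l (n - l) \<union> ?U) = card (plain_head (Suc s) l (n - l)) + card ?U"
    using fU by (intro card_Un_disjoint finite_plain_head) (auto simp: plain_head_def head_in_def)
  then show ?thesis
    using False U by (simp add: plain_head_Suc_Suc[OF assms] card_image)
qed (simp add: plain_head_Suc_Suc[OF assms])

definition head_gf :: "nat \<Rightarrow> nat \<Rightarrow> complex fps" where
  "head_gf s l = Abs_fps (\<lambda>n. of_nat (card (plain_head s l n)))"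

lemma head_gf_0 [simp]: "head_gf 0 l = 0" and head_gf_zero [simp]: "head_gf s 0 = 0"
  by (simp_all add: head_gf_def fps_eq_iff)

lemma head_gf_Suc_0: "0 < l \<Longrightarrow> head_gf (Suc 0) l = fps_X ^ l"
  by (simp add: head_gf_def fps_eq_iff plain_head_Suc_0 fps_X_power_nth)

lemma head_gf_Suc_Suc:
  "0 < l \<Longrightarrow> head_gf (Suc (Suc s)) l = fps_X ^ l * (head_gf (Suc s) l + 2 * (\<Sum>k<l. head_gf (Suc s) k))"
  by (simp add: head_gf_def fps_eq_iff card_plain_head_Suc_Suc fps_X_power_mult_nth fps_sum_nth
      numeral_fps_const fps_mult_left_const_nth)

text \<open>Subtracting \<open>fps_X\<close> times the formula for \<open>l\<close> from the one for
  \<open>Suc l\<close> cancels the sum over smaller heads up to one term. The extra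
  \<open>fps_X\<close> stands for the single part 1, which has nothing shorter to reduce to.\<close>

lemma head_gf_rec:
  "head_gf (Suc s) (Suc l) = (if s = 0 \<and> l = 0 then fps_X else 0) + fps_X * head_gf (Suc s) l
     + fps_X ^ Suc l * (head_gf s (Suc l) + head_gf s l)"
proof (cases s)
  case 0
  then show ?thesis by (cases l) (simp_all add: head_gf_Suc_0)
next
  case (Suc r)
  then show ?thesis
    by (cases l) (simp_all add: head_gf_Suc_Suc algebra_simps)
qed

text \<open>This is \<open>head_gf_rec\<close> with \<open>s\<close> and \<open>l\<close> exchanged,
  proved without a conjugation map: unfolding by \<open>head_gf_rec\<close> and rewriting the
  smaller terms by induction gives an expression that can be regrouped along the other
  index.\<close>

lemma head_gf_rec':
  "head_gf (Suc s) (Suc l) = (if s = 0 \<and> l = 0 then fps_X else 0) + fps_X * head_gf s (Suc l)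
     + fps_X ^ Suc s * (head_gf (Suc s) l + head_gf s l)"
proof (induction "s + l" arbitrary: s l rule: less_induct)
  case less
  show ?case
  proof (cases s)
    case s0: 0
    show ?thesis
    proof (cases l)
      case 0
      then show ?thesis using s0 head_gf_rec[of 0 0] by simp
    next
      case (Suc k)
      then show ?thesis using s0 head_gf_Suc_0[of "Suc k"] head_gf_Suc_0[of "Suc (Suc k)"] by simp
    qed
  next
    case s1: (Suc r)
    show ?thesis
    proof (cases l)
      case 0
      then show ?thesis using s1 head_gf_rec[of s 0] by simp
    next
      case (Suc k)
      define X where "X = (fps_X :: complex fps)"
      let ?c = "\<lambda>s l. if s = 0 \<and> l = 0 then X else 0"
      have i1: "head_gf (Suc s) (Suc k) = ?c s k + X * head_gf s (Suc k) + X ^ Suc s * (head_gf (Suc s) k + head_gf s k)"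
        using less.hyps[of s k] Suc by (simp add: X_def)
      have i2: "head_gf (Suc r) (Suc l) = ?c r l + X * head_gf r (Suc l) + X ^ Suc r * (head_gf (Suc r) l + head_gf r l)"
        using less.hyps[of r l] s1 by (simp add: X_def)
      have i3: "head_gf (Suc r) (Suc k) = ?c r k + X * head_gf r (Suc k) + X ^ Suc r * (head_gf (Suc r) k + head_gf r k)"
        using less.hyps[of r k] s1 Suc by (simp add: X_def)
      have r0: "head_gf (Suc s) (Suc l) = X * head_gf (Suc s) l + X ^ Suc l * (head_gf s (Suc l) + head_gf s l)"
        using head_gf_rec[of s l] s1 by (simp add: X_def)
      have r1: "head_gf (Suc r) (Suc l) = ?c r l + X * head_gf (Suc r) l + X ^ Suc l * (head_gf r (Suc l) + head_gf r l)"
        using head_gf_rec[of r l] by (simp add: X_def)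
      have r2: "head_gf (Suc s) (Suc k) = ?c s k + X * head_gf (Suc s) k + X ^ Suc k * (head_gf s (Suc k) + head_gf s k)"
        using head_gf_rec[of s k] by (simp add: X_def)
      have r3: "head_gf (Suc r) (Suc k) = ?c r k + X * head_gf (Suc r) k + X ^ Suc k * (head_gf r (Suc k) + head_gf r k)"
        using head_gf_rec[of r k] by (simp add: X_def)
      have e: "?c s k = 0" "?c r l = 0" using s1 Suc by auto
      have "head_gf (Suc s) (Suc l) = X * head_gf s (Suc l) + X ^ Suc s * (head_gf (Suc s) l + head_gf s l)"
      \<comment> \<open>The inhomogeneous term can only enter through the pair \<open>r\<close>,
        \<open>k\<close>, so this corner is computed directly.\<close>
      proof (cases "r = 0 \<and> k = 0")
        case True
        then show ?thesis
          using i1 i2 i3 r0 r1 r2 r3 e s1 Suc by (simp add: algebra_simps)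
      next
        case False
        then have c: "?c r k = 0" by auto
        have a: "Suc s = Suc (Suc r)" "Suc l = Suc (Suc k)" using s1 Suc by auto
        have "head_gf (Suc s) (Suc l) = X * (X * head_gf s (Suc k) + X ^ Suc s * (head_gf (Suc s) k + head_gf s k))
          + X ^ Suc l * ((X * head_gf r (Suc l) + X ^ Suc r * (head_gf (Suc r) l + head_gf r l))
            + (X * head_gf r (Suc k) + X ^ Suc r * (head_gf (Suc r) k + head_gf r k)))"
          using i1 i2 i3 r0 e c s1 Suc by simp
        also have "\<dots> = X * (X * head_gf (Suc r) l + X ^ Suc l * (head_gf r (Suc l) + head_gf r l))
          + X ^ Suc s * ((X * head_gf (Suc s) k + X ^ Suc k * (head_gf s (Suc k) + head_gf s k))
            + (X * head_gf (Suc r) k + X ^ Suc k * (head_gf r (Suc k) + head_gf r k)))"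
          using s1 Suc by (simp add: algebra_simps)
        also have "\<dots> = X * head_gf s (Suc l) + X ^ Suc s * (head_gf (Suc s) l + head_gf s l)"
          using r1 r2 r3 e c s1 Suc by simp
        finally show ?thesis .
      qed
      then show ?thesis using s1 by (simp add: X_def)
    qed
  qed
qed

text \<open>The two recurrences are mirror images and determine the series, so conjugation symmetry
  follows by induction.\<close>

lemma head_gf_commute: "head_gf s l = head_gf l s"
proof (induction "s + l" arbitrary: s l rule: less_induct)
  case less
  show ?case
  proof (cases "s = 0 \<or> l = 0")
    case False
    then obtain r k where "s = Suc r" "l = Suc k" by (meson not0_implies_Suc)
    then show ?thesis
      using head_gf_rec[of r k] head_gf_rec'[of k r] less[of s k] less[of r l] less[of r k] by auto
  qed auto
qed

lemma plain_head_empty: "n < s \<or> n < l \<Longrightarrow> plain_head s l n = {}"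
proof (rule ccontr)
  assume n: "n < s \<or> n < l" and "plain_head s l n \<noteq> {}"
  then obtain ps where ps: "overpartition n ps" "length ps = s" "ps \<noteq> []" "hd ps = (l, False)"
    by (auto simp: plain_head_def)
  have "(\<forall>p \<in> set ps. fst p > 0) \<Longrightarrow> length ps \<le> sum_list (map fst ps)"
    by (induction ps) (auto simp: Suc_le_eq)
  moreover have "l \<le> n" using ps by (cases ps) (auto simp: overpartition_Cons)
  ultimately show False using n ps by (auto simp: overpartition_def)
qed

lemma head_gf_nth_0: "n < s \<or> n < l \<Longrightarrow> fps_nth (head_gf s l) n = 0"
  by (simp add: head_gf_def plain_head_empty)

section \<open>Infinite sums of formal power series\<close>

text \<open>Cutting coefficient \<open>n\<close> at \<open>s \<le> n\<close> keeps the sum finite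
  and total. For families with \<open>adm\<close>, where member \<open>s\<close> has no coefficient
  below degree \<open>s\<close>, nothing is lost.\<close>

definition fsum :: "(nat \<Rightarrow> 'a::comm_ring_1 fps) \<Rightarrow> 'a fps" where
  "fsum F = Abs_fps (\<lambda>n. \<Sum>s\<le>n. fps_nth (F s) n)"

definition adm :: "(nat \<Rightarrow> 'a::comm_ring_1 fps) \<Rightarrow> bool" where
  "adm F \<longleftrightarrow> (\<forall>s n. n < s \<longrightarrow> fps_nth (F s) n = 0)"

lemma fsum_nth: "adm F \<Longrightarrow> n \<le> k \<Longrightarrow> fps_nth (fsum F) n = (\<Sum>s\<le>k. fps_nth (F s) n)"
  unfolding fsum_def fps_nth_Abs_fps
  by (rule sum.mono_neutral_left) (auto simp: adm_def)

lemma adm_mono: "adm F \<Longrightarrow> (\<And>s. s \<le> f s) \<Longrightarrow> adm (\<lambda>s. F (f s))"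
  unfolding adm_def by (meson less_le_trans)

lemma fsum_add: "fsum (\<lambda>s. F s + G s) = fsum F + fsum G"
  by (simp add: fsum_def fps_eq_iff sum.distrib)

lemma fsum_diff: "fsum (\<lambda>s. F s - G s) = fsum F - fsum G"
  by (simp add: fsum_def fps_eq_iff sum_subtractf)

lemma fsum_cmult:
  assumes "adm F"
  shows "fsum (\<lambda>s. c * F s) = c * fsum F"
proof (rule fps_ext)
  fix n
  have "fps_nth (fsum (\<lambda>s. c * F s)) n = (\<Sum>s\<le>n. \<Sum>i=0..n. fps_nth c i * fps_nth (F s) (n - i))"
    by (simp add: fsum_def fps_mult_nth)
  also have "\<dots> = (\<Sum>i=0..n. fps_nth c i * (\<Sum>s\<le>n. fps_nth (F s) (n - i)))"
    by (subst sum.swap) (simp add: sum_distrib_left)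
  also have "\<dots> = fps_nth (c * fsum F) n"
    by (simp add: fps_mult_nth fsum_nth[OF assms, symmetric])
  finally show "fps_nth (fsum (\<lambda>s. c * F s)) n = fps_nth (c * fsum F) n" .
qed

lemma fsum_Suc:
  assumes "adm F"
  shows "fsum F = F 0 + fsum (\<lambda>s. F (Suc s))"
proof (rule fps_ext)
  fix n
  have "fps_nth (fsum F) n = (\<Sum>s\<le>Suc n. fps_nth (F s) n)"
    by (rule fsum_nth[OF assms]) simp
  also have "\<dots> = fps_nth (F 0 + fsum (\<lambda>s. F (Suc s))) n"
    unfolding sum.atMost_Suc_shift by (simp add: fsum_def)
  finally show "fps_nth (fsum F) n = fps_nth (F 0 + fsum (\<lambda>s. F (Suc s))) n" .
qed

section \<open>Rank generating functions and the elimination of the weighted series\<close>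

text \<open>Only overpartitions with plain head and rank \<open>m \<ge> 0\<close> are counted;
  overlined heads double the count and negative ranks follow from
  \<open>head_gf_commute\<close>.\<close>

definition rank_gf :: "nat \<Rightarrow> complex fps" where
  "rank_gf m = fsum (\<lambda>s. head_gf s (s + m))"

text \<open>The additional exponent is the largest part. Such weights are what the factor
  \<open>fps_X ^ Suc l\<close> of \<open>head_gf_rec\<close> produces, and they have to be
  eliminated.\<close>

definition rank_gf_weighted :: "nat \<Rightarrow> complex fps" where
  "rank_gf_weighted m = fsum (\<lambda>s. fps_X ^ (s + m) * head_gf s (s + m))"

lemma adm_head_gf: "adm (\<lambda>s. head_gf s (s + m))" "adm (\<lambda>s. head_gf s (Suc (s + m)))"
  by (simp_all add: adm_def head_gf_nth_0)

lemma adm_X_head_gf: "adm (\<lambda>s. fps_X ^ (s + m) * head_gf s (s + m))"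
  by (simp add: adm_def fps_X_power_mult_nth head_gf_nth_0)

lemma fsum_const_at_0: "fsum (\<lambda>s. if s = 0 then fps_X else 0) = fps_X"
proof -
  have "adm (\<lambda>s. if s = 0 then fps_X else 0)" by (simp add: adm_def)
  from fsum_Suc[OF this] show ?thesis by (simp add: fsum_def fps_eq_iff)
qed

lemma fsum_cong: "(\<And>s. F s = G s) \<Longrightarrow> fsum F = fsum G"
  by presburger

lemma rank_gf_shift: "rank_gf m = fsum (\<lambda>s. head_gf (Suc s) (Suc (s + m)))"
  unfolding rank_gf_def by (subst fsum_Suc[OF adm_head_gf(1)]) simp

lemma fsum_X_head_gf: "fsum (\<lambda>s. fps_X ^ Suc (s + m) * head_gf s (s + m)) = fps_X * rank_gf_weighted m"
  unfolding rank_gf_weighted_def by (subst fsum_cmult[OF adm_X_head_gf, symmetric]) (simp add: mult.assoc)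

lemma rank_gf_weighted_Suc: "fsum (\<lambda>s. fps_X ^ Suc (s + m) * head_gf s (Suc (s + m))) = rank_gf_weighted (Suc m)"
  unfolding rank_gf_weighted_def by simp

text \<open>On the diagonal the recurrence reaches a term of rank -1, which symmetry turns into rank
  1.\<close>

lemma rank_gf_0: "rank_gf 0 = fps_X + fps_X * rank_gf 1 + rank_gf_weighted 1 + fps_X * rank_gf_weighted 0"
proof -
  have "rank_gf 0 = fsum (\<lambda>s. (if s = 0 then fps_X else 0) + fps_X * head_gf s (Suc (s + 0))
     + (fps_X ^ Suc (s + 0) * head_gf s (Suc (s + 0)) + fps_X ^ Suc (s + 0) * head_gf s (s + 0)))"
    unfolding rank_gf_shift
    by (rule fsum_cong) (subst head_gf_rec, simp add: head_gf_commute[of "Suc _"] algebra_simps)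
  also have "\<dots> = fps_X + fps_X * rank_gf 1 + (rank_gf_weighted 1 + fps_X * rank_gf_weighted 0)"
    unfolding fsum_add fsum_const_at_0 fsum_cmult[OF adm_head_gf(2)] fsum_X_head_gf rank_gf_weighted_Suc by (simp add: rank_gf_def)
  finally show ?thesis by (simp add: algebra_simps)
qed

lemma rank_gf_Suc: "rank_gf (Suc m) = fps_X * rank_gf m + rank_gf_weighted (Suc (Suc m)) + fps_X * rank_gf_weighted (Suc m)"
proof -
  have "rank_gf (Suc m) = fsum (\<lambda>s. fps_X * head_gf (Suc s) (Suc (s + m))
     + (fps_X ^ Suc (s + Suc m) * head_gf s (Suc (s + Suc m)) + fps_X ^ Suc (s + Suc m) * head_gf s (s + Suc m)))"
    unfolding rank_gf_shift by (rule fsum_cong) (subst head_gf_rec, simp add: algebra_simps)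
  also have "\<dots> = fps_X * rank_gf m + (rank_gf_weighted (Suc (Suc m)) + fps_X * rank_gf_weighted (Suc m))"
    unfolding fsum_add fsum_X_head_gf rank_gf_weighted_Suc rank_gf_shift
    by (subst fsum_cmult) (use adm_mono[OF adm_head_gf(1)[of "m"], of Suc] in simp_all)
  finally show ?thesis by (simp add: algebra_simps)
qed

text \<open>This sums the conjugate recurrence. The factor \<open>fps_X ^ Suc m\<close> completes
  its weight, which depends on the number of parts, to the weight by the largest part, so that the
  same weighted series appear as in \<open>rank_gf_Suc\<close>.\<close>

lemma X_rank_gf_Suc:
  "fps_X ^ Suc m * rank_gf (Suc m) = fps_X ^ Suc (Suc m) * rank_gf (Suc (Suc m)) + fps_X * rank_gf_weighted m + fps_X * rank_gf_weighted (Suc m)"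
proof -
  have a: "adm (\<lambda>s. head_gf (Suc s) (Suc (s + Suc m)))"
    using adm_mono[OF adm_head_gf(1)[of "Suc m"], of Suc] by simp
  have "fps_X ^ Suc m * rank_gf (Suc m) = fsum (\<lambda>s. fps_X ^ Suc m * head_gf (Suc s) (Suc (s + Suc m)))"
    unfolding rank_gf_shift fsum_cmult[OF a] ..
  also have "\<dots> = fsum (\<lambda>s. fps_X ^ Suc (Suc m) * head_gf s (s + Suc (Suc m))
     + (fps_X * (fps_X ^ (Suc s + m) * head_gf (Suc s) (Suc s + m)) + fps_X ^ Suc (s + Suc m) * head_gf s (s + Suc m)))"
    by (rule fsum_cong) (subst head_gf_rec', simp add: algebra_simps power_add)
  also have "\<dots> = fps_X ^ Suc (Suc m) * rank_gf (Suc (Suc m))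
      + (fps_X * fsum (\<lambda>s. fps_X ^ (Suc s + m) * head_gf (Suc s) (Suc s + m)) + fps_X * rank_gf_weighted (Suc m))"
    unfolding fsum_add fsum_X_head_gf fsum_cmult[OF adm_head_gf(1)] rank_gf_def
      fsum_cmult[OF adm_mono[OF adm_X_head_gf[of m], of Suc, OF le_SucI[OF order_refl]]] ..
  also have "fsum (\<lambda>s. fps_X ^ (Suc s + m) * head_gf (Suc s) (Suc s + m)) = rank_gf_weighted m"
    unfolding rank_gf_weighted_def using fsum_Suc[OF adm_X_head_gf[of m]] by simp
  finally show ?thesis by (simp add: algebra_simps)
qed

definition rank_pair_gf :: "nat \<Rightarrow> complex fps" where "rank_pair_gf m = rank_gf m + rank_gf (Suc m)"

lemma rank_pair_gf_0: "fps_X * (rank_pair_gf 1 - fps_X * rank_pair_gf 2) = rank_pair_gf 0 - fps_X * rank_pair_gf 0 - fps_X"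
proof -
  define X where "X = (fps_X :: complex fps)"
  have h: "rank_gf 0 = X + X * rank_gf 1 + rank_gf_weighted 1 + X * rank_gf_weighted 0" "rank_gf 1 = X * rank_gf 0 + rank_gf_weighted 2 + X * rank_gf_weighted 1"
    "X * rank_gf 1 = X * X * rank_gf 2 + X * rank_gf_weighted 0 + X * rank_gf_weighted 1"
    "X * X * rank_gf 2 = X * X * X * rank_gf 3 + X * rank_gf_weighted 1 + X * rank_gf_weighted 2"
    using rank_gf_0 rank_gf_Suc[of 0] X_rank_gf_Suc[of 0] X_rank_gf_Suc[of 1] by (simp_all add: X_def eval_nat_numeral)
  have "X * (X * (rank_pair_gf 1 - X * rank_pair_gf 2)) - X * (rank_pair_gf 0 - X * rank_pair_gf 0 - X) =
     (X * X * rank_gf 2 - (X * X * X * rank_gf 3 + X * rank_gf_weighted 1 + X * rank_gf_weighted 2)) + X * (X * rank_gf 1 - (X * X * rank_gf 2 + X * rank_gf_weighted 0 + X * rank_gf_weighted 1))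
     - X * (rank_gf 1 - (X * rank_gf 0 + rank_gf_weighted 2 + X * rank_gf_weighted 1)) - X * (rank_gf 0 - (X + X * rank_gf 1 + rank_gf_weighted 1 + X * rank_gf_weighted 0))"
    by (simp add: rank_pair_gf_def eval_nat_numeral algebra_simps)
  also have "\<dots> = 0" unfolding h[symmetric] by simp
  finally show ?thesis by (simp add: X_def)
qed

text \<open>Adding neighbouring ranks is what removes the weights: \<open>fps_X\<close> times the
  sum of \<open>rank_gf_Suc\<close> for \<open>m\<close> and \<open>Suc m\<close> carries the same
  weighted series as \<open>X_rank_gf_Suc\<close> for \<open>Suc (Suc m)\<close> plus
  \<open>fps_X\<close> times that for \<open>Suc m\<close>.\<close>

lemma rank_pair_gf_Suc: "fps_X ^ Suc (Suc m) * (rank_pair_gf (Suc (Suc m)) - fps_X * rank_pair_gf (Suc (Suc (Suc m)))) = rank_pair_gf (Suc m) - fps_X * rank_pair_gf m"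
proof -
  define X where "X = (fps_X :: complex fps)"
  note h = rank_gf_Suc[of m] rank_gf_Suc[of "Suc m"] X_rank_gf_Suc[of "Suc m"] X_rank_gf_Suc[of "Suc (Suc m)"]
  have "X * (X ^ Suc (Suc m) * (rank_pair_gf (Suc (Suc m)) - X * rank_pair_gf (Suc (Suc (Suc m))))) - X * (rank_pair_gf (Suc m) - X * rank_pair_gf m) =
     (X ^ Suc (Suc (Suc m)) * rank_gf (Suc (Suc (Suc m))) - (X ^ Suc (Suc (Suc (Suc m))) * rank_gf (Suc (Suc (Suc (Suc m)))) + X * rank_gf_weighted (Suc (Suc m)) + X * rank_gf_weighted (Suc (Suc (Suc m)))))
     + X * (X ^ Suc (Suc m) * rank_gf (Suc (Suc m)) - (X ^ Suc (Suc (Suc m)) * rank_gf (Suc (Suc (Suc m))) + X * rank_gf_weighted (Suc m) + X * rank_gf_weighted (Suc (Suc m))))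
     - X * (rank_gf (Suc (Suc m)) - (X * rank_gf (Suc m) + rank_gf_weighted (Suc (Suc (Suc m))) + X * rank_gf_weighted (Suc (Suc m))))
     - X * (rank_gf (Suc m) - (X * rank_gf m + rank_gf_weighted (Suc (Suc m)) + X * rank_gf_weighted (Suc m)))"
    by (simp add: rank_pair_gf_def algebra_simps)
  also have "\<dots> = 0" unfolding X_def h[symmetric] by simp
  finally show ?thesis by (simp add: X_def)
qed

lemma rank_pair_gf_nth_0: "n \<le> m \<Longrightarrow> fps_nth (rank_pair_gf m) n = 0"
proof -
  have *: "fps_nth (head_gf s (s + k)) n = 0" if "n \<le> k" for s k
    using that by (cases "s = 0") (simp_all add: head_gf_nth_0)
  assume "n \<le> m"
  then show ?thesis using *[of m] *[of "Suc m"] by (simp add: rank_pair_gf_def rank_gf_def fsum_def)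
qed

lemma adm_rank_pair_gf: "adm (\<lambda>j. rank_pair_gf (m + j))"
  by (simp add: adm_def rank_pair_gf_nth_0)

text \<open>Telescoped, this is the rank \<open>m\<close> series plus twice all those of larger
  rank. By symmetry \<open>rank_tail 0\<close> counts all plain-headed overpartitions, so
  \<open>1 + 2 * rank_tail 0\<close> is the generating function of all overpartitions.\<close>

definition rank_tail :: "nat \<Rightarrow> complex fps" where "rank_tail m = fsum (\<lambda>j. rank_pair_gf (m + j))"

lemma rank_tail_Suc: "rank_tail m = rank_pair_gf m + rank_tail (Suc m)"
  unfolding rank_tail_def by (subst fsum_Suc[OF adm_rank_pair_gf]) simp

lemma rank_tail_nth_0: "n \<le> m \<Longrightarrow> fps_nth (rank_tail m) n = 0"
  by (simp add: rank_tail_def fsum_def rank_pair_gf_nth_0)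

text \<open>By \<open>rank_pair_gf_Suc\<close> the difference of the two sides does not depend on
  \<open>m\<close>, and its order grows with \<open>m\<close>; hence it is 0.\<close>

lemma X_rank_pair_gf: "fps_X ^ Suc (Suc m) * rank_pair_gf (Suc (Suc m)) = rank_tail (Suc m) - fps_X * rank_tail m"
proof -
  define D where "D m = rank_tail (Suc m) - fps_X * rank_tail m - fps_X ^ Suc (Suc m) * rank_pair_gf (Suc (Suc m))" for m
  have step: "D m = D (Suc m)" for m
    using rank_pair_gf_Suc[of m] rank_tail_Suc[of m] rank_tail_Suc[of "Suc m"] by (simp add: D_def algebra_simps)
  have D_eq: "D m = D (m + k)" for m k
    by (induction k) (simp_all add: step[symmetric])
  have "fps_nth (D m) n = 0" for n
  proof -
    have "fps_nth (D (m + n)) n = 0"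
      by (cases n) (simp_all add: D_def rank_tail_nth_0 fps_X_power_mult_nth rank_pair_gf_nth_0 del: power_Suc)
    then show ?thesis by (simp add: D_eq[of m n, symmetric])
  qed
  then have "D m = 0" by (simp add: fps_eq_iff)
  then show ?thesis by (simp add: D_def algebra_simps)
qed

text \<open>The inhomogeneous right-hand side comes from the boundary relation
  \<open>rank_pair_gf_0\<close> in the base case; each induction step multiplies by
  \<open>fps_X\<close>.\<close>

lemma rank_tail_rec: "rank_tail m + fps_X ^ Suc m * rank_tail (Suc (Suc m)) = fps_X ^ Suc m * (1 + 2 * rank_tail 0)"
proof (induction m)
  case 0
  define X where "X = (fps_X :: complex fps)"
  have h: "X * (rank_pair_gf 1 - X * rank_pair_gf 2) = rank_pair_gf 0 - X * rank_pair_gf 0 - X" "X ^ 2 * rank_pair_gf 2 = rank_tail 1 - X * rank_tail 0"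
    "rank_tail 0 = rank_pair_gf 0 + rank_tail 1" "rank_tail 1 = rank_pair_gf 1 + rank_tail 2"
    using rank_pair_gf_0 X_rank_pair_gf[of 0] rank_tail_Suc[of 0] rank_tail_Suc[of 1] by (simp_all add: X_def eval_nat_numeral)
  have "rank_tail 0 + X * rank_tail 2 - X * (1 + 2 * rank_tail 0) = - (X * (rank_pair_gf 1 - X * rank_pair_gf 2) - (rank_pair_gf 0 - X * rank_pair_gf 0 - X))
    - (X ^ 2 * rank_pair_gf 2 - (rank_tail 1 - X * rank_tail 0)) + (1 - X) * (rank_tail 0 - (rank_pair_gf 0 + rank_tail 1)) - X * (rank_tail 1 - (rank_pair_gf 1 + rank_tail 2))"
    by (simp add: algebra_simps power2_eq_square)
  also have "\<dots> = 0" unfolding h(1,2) h(3)[symmetric] h(4)[symmetric] by simp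
  finally show ?case by (simp add: X_def eval_nat_numeral)
next
  case (Suc m)
  define X where "X = (fps_X :: complex fps)"
  have h: "X ^ Suc (Suc m) * rank_pair_gf (Suc (Suc m)) = rank_tail (Suc m) - X * rank_tail m"
    "rank_tail (Suc (Suc m)) = rank_pair_gf (Suc (Suc m)) + rank_tail (Suc (Suc (Suc m)))"
    "rank_tail m + X ^ Suc m * rank_tail (Suc (Suc m)) = X ^ Suc m * (1 + 2 * rank_tail 0)"
    using X_rank_pair_gf[of m] rank_tail_Suc[of "Suc (Suc m)"] Suc by (simp_all add: X_def)
  have "rank_tail (Suc m) + X ^ Suc (Suc m) * rank_tail (Suc (Suc (Suc m))) - X ^ Suc (Suc m) * (1 + 2 * rank_tail 0) =
    - (X ^ Suc (Suc m) * rank_pair_gf (Suc (Suc m)) - (rank_tail (Suc m) - X * rank_tail m))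
    - X ^ Suc (Suc m) * (rank_tail (Suc (Suc m)) - (rank_pair_gf (Suc (Suc m)) + rank_tail (Suc (Suc (Suc m)))))
    + X * (rank_tail m + X ^ Suc m * rank_tail (Suc (Suc m)) - X ^ Suc m * (1 + 2 * rank_tail 0))"
    by (simp add: algebra_simps)
  also have "\<dots> = 0" unfolding h(1,3) h(2)[symmetric] by simp
  finally show ?case by (simp add: X_def)
qed

text \<open>Iterating \<open>rank_tail_rec\<close> and dividing out
  \<open>1 + 2 * rank_tail 0\<close> produces this partial theta series.\<close>

definition rank_tail_num :: "nat \<Rightarrow> complex fps" where
  "rank_tail_num m = fsum (\<lambda>k. (-1) ^ k * fps_X ^ (Suc k * Suc k + m * Suc k))"

lemma neg_one_power_fps: "(-1) ^ k = (fps_const ((-1) ^ k) :: complex fps)"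
  by (metis fps_const_1_eq_1 fps_const_neg fps_const_power)

lemma adm_rank_tail_num: "adm (\<lambda>k. (-1) ^ k * fps_X ^ (Suc k * Suc k + m * Suc k) :: complex fps)"
proof -
  have "k < Suc k * Suc k + m * Suc k" for k
    by (simp add: less_Suc_eq_le trans_le_add1)
  then have "adm (\<lambda>k. fps_X ^ (Suc k * Suc k + m * Suc k) :: complex fps)"
    unfolding adm_def fps_X_power_nth by (metis less_asym)
  then show ?thesis
    unfolding adm_def neg_one_power_fps fps_mult_left_const_nth by simp
qed

lemma rank_tail_num_rec: "rank_tail_num m + fps_X ^ Suc m * rank_tail_num (Suc (Suc m)) = fps_X ^ Suc m"
proof -
  have "rank_tail_num m = fps_X ^ Suc m + fsum (\<lambda>k. (- (fps_X ^ Suc m)) * ((-1) ^ k * fps_X ^ (Suc k * Suc k + Suc (Suc m) * Suc k)))"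
    unfolding rank_tail_num_def
    by (subst fsum_Suc[OF adm_rank_tail_num], rule arg_cong2[where f = "(+)"], simp, rule fsum_cong)
      (simp add: power_add[symmetric] algebra_simps)
  also have "\<dots> = fps_X ^ Suc m - fps_X ^ Suc m * rank_tail_num (Suc (Suc m))"
    unfolding rank_tail_num_def by (subst fsum_cmult[OF adm_rank_tail_num]) simp
  finally show ?thesis by simp
qed

text \<open>The difference of the two sides satisfies the homogeneous recurrence, which refers each
  coefficient to one of strictly lower degree, so it vanishes.\<close>

lemma rank_tail_eq: "rank_tail m = (1 + 2 * rank_tail 0) * rank_tail_num m"
proof -
  define D where "D m = rank_tail m - (1 + 2 * rank_tail 0) * rank_tail_num m" for m
  have D: "D m = - (fps_X ^ Suc m * D (Suc (Suc m)))" for m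
  proof -
    have "D m + fps_X ^ Suc m * D (Suc (Suc m)) = (rank_tail m + fps_X ^ Suc m * rank_tail (Suc (Suc m)))
        - (1 + 2 * rank_tail 0) * (rank_tail_num m + fps_X ^ Suc m * rank_tail_num (Suc (Suc m)))"
      unfolding D_def by (simp add: algebra_simps)
    also have "\<dots> = 0" unfolding rank_tail_rec rank_tail_num_rec by (simp add: algebra_simps)
    finally show ?thesis by (simp add: eq_neg_iff_add_eq_0)
  qed
  have "fps_nth (D m) n = 0" for n
  proof (induction n arbitrary: m rule: less_induct)
    case (less n)
    then show ?case by (subst D) (simp add: fps_X_power_mult_nth del: power_Suc)
  qed
  then have "D m = 0" by (simp add: fps_eq_iff)
  then show ?thesis by (simp add: D_def)
qed

definition Phi :: "complex fps" where "Phi = 1 - 2 * rank_tail_num 0"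

lemma Phi_overpartition_gf: "Phi * (1 + 2 * rank_tail 0) = 1"
proof -
  have "Phi * (1 + 2 * rank_tail 0) = 1 + 2 * (rank_tail 0 - (1 + 2 * rank_tail 0) * rank_tail_num 0)"
    by (simp add: Phi_def algebra_simps)
  then show ?thesis using rank_tail_eq[of 0] by simp
qed

lemma Phi_rank_tail: "Phi * rank_tail m = rank_tail_num m"
  using Phi_overpartition_gf rank_tail_eq[of m] by (metis mult.assoc mult_1)

section \<open>From ranks to residues modulo 3\<close>

text \<open>By symmetry residues 1 and 2 are equally frequent, so the difference is the total minus
  three times the count of residue 1. The positive ranks not divisible by 3 are those in the pairs
  3i+1, 3i+2; the free overline of the head gives a factor 2, and including negative ranks doubles
  while restricting to residue 1 halves, so 3 * 2 = 6.\<close>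

definition diff_gf :: "complex fps" where
  "diff_gf = 1 + 2 * rank_tail 0 - 6 * fsum (\<lambda>i. rank_pair_gf (3 * i + 1))"

definition diff_num :: "complex fps" where
  "diff_num = 1 - 6 * fsum (\<lambda>i. rank_tail_num (3 * i + 1) - rank_tail_num (3 * i + 2))"

lemma Phi_diff_gf: "Phi * diff_gf = diff_num"
proof -
  have a: "adm (\<lambda>i. rank_pair_gf (3 * i + 1))"
    by (simp add: adm_def rank_pair_gf_nth_0)
  have pair: "rank_pair_gf m = rank_tail m - rank_tail (Suc m)" for m
    using rank_tail_Suc[of m] by simp
  have "Phi * diff_gf = Phi * (1 + 2 * rank_tail 0) - 6 * (Phi * fsum (\<lambda>i. rank_pair_gf (3 * i + 1)))"
    by (simp add: diff_gf_def algebra_simps)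
  also have "\<dots> = diff_num"
    unfolding Phi_overpartition_gf fsum_cmult[OF a, symmetric] diff_num_def
    by (simp add: pair right_diff_distrib Phi_rank_tail)
  finally show ?thesis .
qed

lemma sum_pair_bool:
  fixes f :: "'a \<Rightarrow> 'b \<Rightarrow> bool \<Rightarrow> nat"
  shows "(\<Sum>((s, l), b) \<in> I \<times> UNIV. f s l b) = (\<Sum>(s, l) \<in> I. f s l True + f s l False)"
proof -
  have "(\<Sum>x\<in>I. \<Sum>b\<in>UNIV. f (fst x) (snd x) b) = (\<Sum>(x, b)\<in>I \<times> UNIV. f (fst x) (snd x) b)"
    by (rule sum.cartesian_product)
  moreover have "(\<Sum>b\<in>UNIV. f (fst x) (snd x) b) = f (fst x) (snd x) True + f (fst x) (snd x) False" for x
    by (simp add: UNIV_bool)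
  ultimately show ?thesis by (simp only: case_prod_unfold)
qed

lemma Nbar_card:
  assumes "1 \<le> n"
  shows "Nbar a 3 n = 2 * (\<Sum>(s, l) \<in> {(s, l). s \<le> n \<and> l \<le> n \<and> [int l - int s = a] (mod 3)}. card (plain_head s l n))"
proof -
  let ?I = "{(s, l). s \<le> n \<and> l \<le> n \<and> [int l - int s = a] (mod 3)}"
  have fin: "finite ?I" by (rule finite_subset[of _ "{..n} \<times> {..n}"]) auto
  have rank: "overpartition_rank ps = int (fst (hd ps)) - int (length ps)"
    if "overpartition n ps" "ps \<noteq> []" for ps
  proof -
    have "Max (fst ` set ps) = fst (hd ps)"
      using that by (intro Max_eqI) (cases ps; auto simp: overpartition_Cons)+
    then show ?thesis by (simp add: overpartition_rank_def)
  qed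
  have le: "s \<le> n \<and> l \<le> n" if "ps \<in> head_in s l n b" for ps s l b
  proof (rule ccontr)
    assume "\<not> (s \<le> n \<and> l \<le> n)"
    then have "plain_head s l n = {}" by (intro plain_head_empty) auto
    then have "head_in s l n b = {}" using card_head_in[of s l n b] by simp
    with that show False by simp
  qed
  have "{ps. overpartition n ps \<and> [overpartition_rank ps = a] (mod 3)} =
      (\<Union>((s, l), b) \<in> ?I \<times> UNIV. head_in s l n b)" (is "?L = ?R")
  proof (intro equalityI subsetI)
    fix ps assume ps: "ps \<in> ?L"
    then have ne: "ps \<noteq> []" using assms by auto
    then have "ps \<in> head_in (length ps) (fst (hd ps)) n (snd (hd ps))"
      using ps by (simp add: head_in_def)
    with le[OF this] show "ps \<in> ?R" using ps rank[OF _ ne] by force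
  next
    fix ps assume "ps \<in> ?R"
    then show "ps \<in> ?L" using rank by (auto simp: head_in_def)
  qed
  then have "Nbar a 3 n = card (\<Union>((s, l), b) \<in> ?I \<times> UNIV. head_in s l n b)"
    by (simp add: Nbar_def)
  also have "\<dots> = (\<Sum>((s, l), b) \<in> ?I \<times> UNIV. card (head_in s l n b))"
    using fin by (subst card_UN_disjoint) (simp_all add: case_prod_unfold, auto simp: head_in_def)
  also have "\<dots> = (\<Sum>(s, l) \<in> ?I. card (head_in s l n True) + card (head_in s l n False))"
    by (rule sum_pair_bool)
  also have "\<dots> = (\<Sum>(s, l) \<in> ?I. 2 * card (plain_head s l n))"
    unfolding card_head_in mult_2 ..
  finally show ?thesis unfolding sum_distrib_left case_prod_unfold .
qed

lemma rank_gf_nth: "fps_nth (rank_gf m) n = (\<Sum>s\<le>n. fps_nth (head_gf s (s + m)) n)"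
  by (simp add: rank_gf_def fsum_def)

text \<open>The square of pairs is cut along the diagonal, and symmetry folds the triangle of
  negative ranks onto the other one. The second sum starts at 1 so that rank 0 is counted
  once.\<close>

lemma sum_head_gf_by_rank:
  fixes g :: "int \<Rightarrow> complex"
  shows "(\<Sum>(s, l) \<in> {..n} \<times> {..n}. g (int l - int s) * fps_nth (head_gf s l) n) =
    (\<Sum>m\<le>n. g (int m) * fps_nth (rank_gf m) n) + (\<Sum>m=1..n. g (- int m) * fps_nth (rank_gf m) n)"
proof -
  let ?f = "\<lambda>(s, l). g (int l - int s) * fps_nth (head_gf s l) n"
  have z: "m + s \<le> n" if "fps_nth (head_gf s (s + m)) n \<noteq> 0" for s m
    using that head_gf_nth_0[of n s "s + m"] by (metis add.commute not_le)
  have "(\<Sum>m\<le>n. g (int m) * fps_nth (rank_gf m) n) =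
      (\<Sum>(m, s) \<in> {..n} \<times> {..n}. g (int m) * fps_nth (head_gf s (s + m)) n)"
    by (simp add: rank_gf_nth sum_distrib_left sum.cartesian_product)
  also have "\<dots> = (\<Sum>(m, s) \<in> {(m, s). m + s \<le> n}. g (int m) * fps_nth (head_gf s (s + m)) n)"
    by (rule sum.mono_neutral_right) (auto dest: z)
  also have "\<dots> = sum ?f {(s, l). s \<le> l \<and> l \<le> n}"
    by (rule sum.reindex_bij_witness[where i = "\<lambda>(s, l). (l - s, s)" and j = "\<lambda>(m, s). (s, s + m)"]) auto
  finally have 1: "(\<Sum>m\<le>n. g (int m) * fps_nth (rank_gf m) n) = sum ?f {(s, l). s \<le> l \<and> l \<le> n}" .
  have "(\<Sum>m=1..n. g (- int m) * fps_nth (rank_gf m) n) =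
      (\<Sum>(m, s) \<in> {1..n} \<times> {..n}. g (- int m) * fps_nth (head_gf s (s + m)) n)"
    by (simp add: rank_gf_nth sum_distrib_left sum.cartesian_product)
  also have "\<dots> = (\<Sum>(m, s) \<in> {(m, s). 1 \<le> m \<and> m + s \<le> n}. g (- int m) * fps_nth (head_gf s (s + m)) n)"
    by (rule sum.mono_neutral_right) (auto dest: z)
  also have "\<dots> = sum ?f {(s, l). l < s \<and> s \<le> n}"
    by (rule sum.reindex_bij_witness[where i = "\<lambda>(s, l). (s - l, l)" and j = "\<lambda>(m, l). (l + m, l)"])
      (auto simp: head_gf_commute)
  finally have 2: "(\<Sum>m=1..n. g (- int m) * fps_nth (rank_gf m) n) = sum ?f {(s, l). l < s \<and> s \<le> n}" .
  have "{..n} \<times> {..n} = {(s, l). s \<le> l \<and> l \<le> n} \<union> {(s, l). l < s \<and> s \<le> n}" by auto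
  moreover have "finite {(s, l). s \<le> l \<and> l \<le> n}" "finite {(s, l). l < s \<and> s \<le> n}"
    by (rule finite_subset[of _ "{..n} \<times> {..n}"]; auto)+
  ultimately show ?thesis
    unfolding 1 2 by (subst sum.union_disjoint[symmetric]) auto
qed

lemma diff_gf_nth:
  assumes "1 \<le> n"
  shows "fps_nth diff_gf n = of_nat (Nbar 0 3 n) - of_nat (Nbar 1 3 n)"
proof -
  define a where "a m = fps_nth (rank_gf m) n" for m
  define g where "g c d = (if [d = c] (mod 3) then 1 else 0 :: complex)" for c d :: int
  have Nb: "of_nat (Nbar c 3 n) = 2 * ((\<Sum>m\<le>n. g c (int m) * a m) + (\<Sum>m=1..n. g c (- int m) * a m))" for c
  proof -
    have "of_nat (Nbar c 3 n) = 2 * (\<Sum>(s, l) \<in> {(s, l). s \<le> n \<and> l \<le> n \<and> [int l - int s = c] (mod 3)}.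
        fps_nth (head_gf s l) n)"
      using assms by (simp add: Nbar_card head_gf_def case_prod_unfold)
    also have "(\<Sum>(s, l) \<in> {(s, l). s \<le> n \<and> l \<le> n \<and> [int l - int s = c] (mod 3)}. fps_nth (head_gf s l) n) =
       (\<Sum>(s, l) \<in> {..n} \<times> {..n}. g c (int l - int s) * fps_nth (head_gf s l) n)"
      by (rule sum.mono_neutral_cong_left) (auto simp: g_def split: if_splits)
    finally show ?thesis unfolding sum_head_gf_by_rank a_def .
  qed
  have a0: "a m = 0" if "n < m" for m
    using that by (simp add: a_def rank_gf_nth head_gf_nth_0)
  have split0: "(\<Sum>m\<le>n. f m) = f 0 + (\<Sum>m=1..n. f m)" for f :: "nat \<Rightarrow> complex"
    by (simp add: sum.atLeast1_atMost_eq sum.atMost_shift)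
  have "fps_nth (rank_tail 0) n = (\<Sum>m\<le>n. a m) + (\<Sum>m\<le>n. a (Suc m))"
    by (simp add: rank_tail_def fsum_def rank_pair_gf_def a_def sum.distrib)
  also have "(\<Sum>m\<le>n. a (Suc m)) = (\<Sum>m=1..n. a m)"
  proof -
    have "(\<Sum>m\<le>n. a (Suc m)) = (\<Sum>m<n. a (Suc m))"
      by (rule sum.mono_neutral_right) (auto intro!: a0)
    then show ?thesis by (simp add: sum.atLeast1_atMost_eq)
  qed
  finally have V0: "fps_nth (rank_tail 0) n = a 0 + 2 * (\<Sum>m=1..n. a m)"
    by (simp add: split0)
  define x where "x m = (if m mod 3 = 0 then 0 else 1 :: complex)" for m :: nat
  have "(\<Sum>i\<le>k. a (3 * i + 1) + a (3 * i + 2)) = (\<Sum>m\<le>3 * k + 2. x m * a m)" for k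
  proof (induction k)
    case 0
    have "{..3 * 0 + 2} = {0, 1, 2 :: nat}" by auto
    then show ?case by (simp add: x_def numeral_2_eq_2)
  next
    case (Suc k)
    have "{..3 * Suc k + 2} = insert (3 * Suc k + 2) (insert (3 * Suc k + 1) (insert (3 * Suc k) {..3 * k + 2}))"
      by auto
    moreover have "3 * Suc k mod 3 = 0" "(3 * Suc k + 1) mod 3 = 1" "(3 * Suc k + 2) mod 3 = 2"
      by presburger+
    then have "x (3 * Suc k) = 0" "x (3 * Suc k + 1) = 1" "x (3 * Suc k + 2) = 1"
      by (simp_all only: x_def) simp_all
    ultimately show ?case unfolding sum.atMost_Suc Suc by simp
  qed
  then have "(\<Sum>i\<le>n. a (3 * i + 1) + a (3 * i + 2)) = (\<Sum>m\<le>3 * n + 2. x m * a m)" .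
  also have "\<dots> = (\<Sum>m\<le>n. x m * a m)"
    by (rule sum.mono_neutral_right) (auto simp: a0)
  also have "\<dots> = (\<Sum>m=1..n. x m * a m)"
    by (simp add: split0 x_def)
  finally have W1: "fps_nth (fsum (\<lambda>i. rank_pair_gf (3 * i + 1))) n = (\<Sum>m=1..n. x m * a m)"
    by (simp add: fsum_def rank_pair_gf_def a_def)
  \<comment> \<open>If 3 divides \<open>m\<close>, both \<open>m\<close> and \<open>-m\<close> count
    for residue 0, which gives 2; otherwise exactly one of them is 1 modulo 3, which gives
    -1.\<close>
  have g: "g 0 (int m) + g 0 (- int m) - g 1 (int m) - g 1 (- int m) = 2 - 3 * x m" for m
  proof -
    have "m mod 3 = 0 \<or> m mod 3 = 1 \<or> m mod 3 = 2" by linarith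
    then have "int m mod 3 = 0 \<and> - int m mod 3 = 0 \<and> m mod 3 = 0 \<or> int m mod 3 = 1 \<and> - int m mod 3 = 2 \<and> m mod 3 = 1
       \<or> int m mod 3 = 2 \<and> - int m mod 3 = 1 \<and> m mod 3 = 2"
      using zmod_int[of m 3] by (auto simp: zmod_zminus1_eq_if)
    then show ?thesis by (auto simp: g_def x_def unique_euclidean_semiring_class.cong_def)
  qed
  have "of_nat (Nbar 0 3 n) - of_nat (Nbar 1 3 n) =
     2 * (a 0 + (\<Sum>m=1..n. (g 0 (int m) + g 0 (- int m) - g 1 (int m) - g 1 (- int m)) * a m))"
    unfolding Nb split0 by (simp add: g_def unique_euclidean_semiring_class.cong_def sum.distrib sum_subtractf algebra_simps)
  also have "\<dots> = fps_nth diff_gf n"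
    unfolding g using assms V0 W1
    by (simp add: diff_gf_def numeral_fps_const algebra_simps sum_subtractf sum_distrib_left)
  finally show ?thesis ..
qed

section \<open>The Jacobi triple product and the reciprocal theta function\<close>

text \<open>The infinite q-Pochhammer symbol; \<open>eu\<close> below is Euler's product of all 1 -
  q^n with n \<ge> 1.\<close>

definition qp :: "complex \<Rightarrow> complex \<Rightarrow> complex" where
  "qp z q = (\<Prod>n. 1 - z * q ^ n)"

definition eu :: "complex \<Rightarrow> complex" where
  "eu q = qp q q"

lemma convergent_qp: "norm q < 1 \<Longrightarrow> convergent_prod (\<lambda>n. 1 - z * q ^ n :: complex)"
proof -
  assume q: "norm q < 1"
  have "(\<lambda>n. norm ((1 - z * q ^ n) - 1)) = (\<lambda>n. norm z * norm q ^ n)"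
    by (simp add: norm_mult norm_power)
  then have "summable (\<lambda>n. norm ((1 - z * q ^ n) - 1))"
    using summable_mult[OF summable_geometric[of "norm q"], of "norm z"] q by simp
  then show ?thesis
    by (intro abs_convergent_prod_imp_convergent_prod summable_imp_abs_convergent_prod)
qed

lemma qp_LIMSEQ: "norm q < 1 \<Longrightarrow> (\<lambda>N. \<Prod>n<N. 1 - z * q ^ n) \<longlonglongrightarrow> qp z q"
  unfolding qp_def by (intro has_prod_imp_tendsto' convergent_prod_has_prod convergent_qp)

lemma qp_nonzero:
  assumes "norm q < 1" "\<And>n. z * q ^ n \<noteq> 1"
  shows "qp z q \<noteq> 0"
proof -
  have "1 - z * q ^ n \<noteq> 0" for n using assms(2)[of n] by auto
  then show ?thesis unfolding qp_def by (intro prodinf_nonzero convergent_qp assms(1))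
qed

lemma eu_nonzero: "norm q < 1 \<Longrightarrow> eu q \<noteq> 0"
  unfolding eu_def
proof (rule qp_nonzero)
  fix n assume "norm q < 1"
  then have "norm (q ^ Suc n) < 1"
    unfolding norm_power by (intro power_less_one_iff[THEN iffD2]) auto
  then show "q * q ^ n \<noteq> 1" by auto
qed

lemma qp_rec: "norm q < 1 \<Longrightarrow> qp z q = (1 - z) * qp (z * q) q"
proof (rule LIMSEQ_unique)
  assume q: "norm q < 1"
  have "(\<lambda>N. (1 - z) * (\<Prod>n<N. 1 - (z * q) * q ^ n)) \<longlonglongrightarrow> (1 - z) * qp (z * q) q"
    by (intro tendsto_intros qp_LIMSEQ q)
  moreover have "(1 - z) * (\<Prod>n<N. 1 - (z * q) * q ^ n) = (\<Prod>n<Suc N. 1 - z * q ^ n)" for N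
    by (simp add: prod.lessThan_Suc_shift mult.assoc del: prod.lessThan_Suc)
  ultimately show "(\<lambda>N. \<Prod>n<Suc N. 1 - z * q ^ n) \<longlonglongrightarrow> (1 - z) * qp (z * q) q" by (simp only:)
  show "(\<lambda>N. \<Prod>n<Suc N. 1 - z * q ^ n) \<longlonglongrightarrow> qp z q"
    using qp_LIMSEQ[OF q] by (rule LIMSEQ_Suc)
qed

lemma qp_split2: "norm q < 1 \<Longrightarrow> qp z q = qp z (q\<^sup>2) * qp (z * q) (q\<^sup>2)"
proof (rule LIMSEQ_unique)
  assume q: "norm q < 1"
  then have q2: "norm (q\<^sup>2) < 1" by (simp add: norm_power power_less_one_iff abs_square_less_1)
  have "(\<Prod>n<2 * N. 1 - z * q ^ n) = (\<Prod>n<N. 1 - z * (q\<^sup>2) ^ n) * (\<Prod>n<N. 1 - (z * q) * (q\<^sup>2) ^ n)" for N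
    by (induction N) (simp_all add: power_mult[symmetric] algebra_simps)
  moreover have "(\<lambda>N. (\<Prod>n<N. 1 - z * (q\<^sup>2) ^ n) * (\<Prod>n<N. 1 - (z * q) * (q\<^sup>2) ^ n))
      \<longlonglongrightarrow> qp z (q\<^sup>2) * qp (z * q) (q\<^sup>2)"
    by (intro tendsto_intros qp_LIMSEQ q2)
  ultimately show "(\<lambda>N. \<Prod>n<2 * N. 1 - z * q ^ n) \<longlonglongrightarrow> qp z (q\<^sup>2) * qp (z * q) (q\<^sup>2)" by (simp only:)
  show "(\<lambda>N. \<Prod>n<2 * N. 1 - z * q ^ n) \<longlonglongrightarrow> qp z q"
    using LIMSEQ_subseq_LIMSEQ[OF qp_LIMSEQ[OF q, of z], of "\<lambda>N. 2 * N"]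
    by (simp add: o_def strict_mono_def)
qed

lemma qp_split3: "norm q < 1 \<Longrightarrow> qp z q = qp z (q ^ 3) * qp (z * q) (q ^ 3) * qp (z * q\<^sup>2) (q ^ 3)"
proof (rule LIMSEQ_unique)
  assume q: "norm q < 1"
  then have q2: "norm (q ^ 3) < 1" by (simp add: norm_power power_less_one_iff)
  have "(\<Prod>n<3 * N. 1 - z * q ^ n) = (\<Prod>n<N. 1 - z * (q ^ 3) ^ n) * (\<Prod>n<N. 1 - (z * q) * (q ^ 3) ^ n)
      * (\<Prod>n<N. 1 - (z * q\<^sup>2) * (q ^ 3) ^ n)" for N
  proof (induction N)
    case (Suc N)
    have "3 * Suc N = Suc (Suc (Suc (3 * N)))" by simp
    moreover have "z * q * (q ^ 3) ^ N = z * q ^ Suc (3 * N)" "z * q\<^sup>2 * (q ^ 3) ^ N = z * q ^ Suc (Suc (3 * N))"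
      by (simp_all add: power_mult[symmetric] power2_eq_square)
    ultimately show ?case
      unfolding prod.lessThan_Suc Suc by (simp only: prod.lessThan_Suc Suc) (simp add: power_mult)
  qed simp
  moreover have "(\<lambda>N. (\<Prod>n<N. 1 - z * (q ^ 3) ^ n) * (\<Prod>n<N. 1 - (z * q) * (q ^ 3) ^ n) * (\<Prod>n<N. 1 - (z * q\<^sup>2) * (q ^ 3) ^ n))
      \<longlonglongrightarrow> qp z (q ^ 3) * qp (z * q) (q ^ 3) * qp (z * q\<^sup>2) (q ^ 3)"
    by (intro tendsto_intros qp_LIMSEQ q2)
  ultimately show "(\<lambda>N. \<Prod>n<3 * N. 1 - z * q ^ n) \<longlonglongrightarrow> qp z (q ^ 3) * qp (z * q) (q ^ 3) * qp (z * q\<^sup>2) (q ^ 3)" by (simp only:)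
  show "(\<lambda>N. \<Prod>n<3 * N. 1 - z * q ^ n) \<longlonglongrightarrow> qp z q"
    using LIMSEQ_subseq_LIMSEQ[OF qp_LIMSEQ[OF q, of z], of "\<lambda>N. 3 * N"]
    by (simp add: o_def strict_mono_def)
qed

lemma qp_neg: "norm q < 1 \<Longrightarrow> qp z q * qp (- z) q = qp (z\<^sup>2) (q\<^sup>2)"
proof (rule LIMSEQ_unique)
  assume q: "norm q < 1"
  then have q2: "norm (q\<^sup>2) < 1" by (simp add: norm_power power_less_one_iff abs_square_less_1)
  have "(\<lambda>N. (\<Prod>n<N. 1 - z * q ^ n) * (\<Prod>n<N. 1 - (- z) * q ^ n)) \<longlonglongrightarrow> qp z q * qp (- z) q"
    by (intro tendsto_intros qp_LIMSEQ q)
  moreover have "(\<Prod>n<N. 1 - z * q ^ n) * (\<Prod>n<N. 1 - (- z) * q ^ n) = (\<Prod>n<N. 1 - z\<^sup>2 * (q\<^sup>2) ^ n)" for N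
    by (simp add: prod.distrib[symmetric] algebra_simps power_mult[symmetric] power2_eq_square power_add[symmetric] mult_2_right)
  ultimately show "(\<lambda>N. \<Prod>n<N. 1 - z\<^sup>2 * (q\<^sup>2) ^ n) \<longlonglongrightarrow> qp z q * qp (- z) q" by (simp only:)
  show "(\<lambda>N. \<Prod>n<N. 1 - z\<^sup>2 * (q\<^sup>2) ^ n) \<longlonglongrightarrow> qp (z\<^sup>2) (q\<^sup>2)"
    by (intro qp_LIMSEQ q2)
qed

lemma qp_cube:
  assumes q: "norm q < 1" and w: "w ^ 3 = 1" "1 + w + w\<^sup>2 = (0 :: complex)"
  shows "qp z q * qp (w * z) q * qp (w\<^sup>2 * z) q = qp (z ^ 3) (q ^ 3)"
proof (rule LIMSEQ_unique)
  have q2: "norm (q ^ 3) < 1" using q by (simp add: norm_power power_less_one_iff)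
  have "(\<lambda>N. (\<Prod>n<N. 1 - z * q ^ n) * (\<Prod>n<N. 1 - (w * z) * q ^ n) * (\<Prod>n<N. 1 - (w\<^sup>2 * z) * q ^ n))
      \<longlonglongrightarrow> qp z q * qp (w * z) q * qp (w\<^sup>2 * z) q"
    by (intro tendsto_intros qp_LIMSEQ q)
  moreover have "(1 - a) * (1 - w * a) * (1 - w\<^sup>2 * a) = 1 - a ^ 3" for a
  proof -
    have "(1 - a) * (1 - w * a) * (1 - w\<^sup>2 * a) = 1 - (1 + w + w\<^sup>2) * a + w * (1 + w + w\<^sup>2) * a\<^sup>2 - w ^ 3 * a ^ 3"
      by (simp add: algebra_simps power2_eq_square power3_eq_cube)
    then show ?thesis using w by simp
  qed
  then have "(1 - z * q ^ n) * (1 - (w * z) * q ^ n) * (1 - (w\<^sup>2 * z) * q ^ n) = 1 - z ^ 3 * (q ^ 3) ^ n" for n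
    by (metis (no_types, opaque_lifting) mult.assoc power_mult power_mult_distrib mult.commute)
  then have "(\<Prod>n<N. 1 - z * q ^ n) * (\<Prod>n<N. 1 - (w * z) * q ^ n) * (\<Prod>n<N. 1 - (w\<^sup>2 * z) * q ^ n) = (\<Prod>n<N. 1 - z ^ 3 * (q ^ 3) ^ n)" for N
    by (simp add: prod.distrib[symmetric])
  ultimately show "(\<lambda>N. \<Prod>n<N. 1 - z ^ 3 * (q ^ 3) ^ n) \<longlonglongrightarrow> qp z q * qp (w * z) q * qp (w\<^sup>2 * z) q" by (simp only:)
  show "(\<lambda>N. \<Prod>n<N. 1 - z ^ 3 * (q ^ 3) ^ n) \<longlonglongrightarrow> qp (z ^ 3) (q ^ 3)"
    by (intro qp_LIMSEQ q2)
qed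

section \<open>Limits and absolute convergence of series over the integers\<close>

text \<open>Dominated convergence, transported from the naturals by an enumeration of the integers.
  It turns each finite q-identity below into its infinite form.\<close>

lemma tannery_int:
  fixes f :: "nat \<Rightarrow> int \<Rightarrow> complex"
  assumes "\<And>k. (\<lambda>N. f N k) \<longlonglongrightarrow> g k" and "\<And>N k. norm (f N k) \<le> M k"
    and "M summable_on UNIV" and "\<And>N. (f N has_sum s N) UNIV" and "s \<longlonglongrightarrow> L"
  shows "(g has_sum L) UNIV"
proof -
  have bij: "bij_betw int_decode UNIV UNIV" by (rule bij_int_decode)
  have M: "summable (\<lambda>n. M (int_decode n))"
    using assms(3) summable_on_reindex_bij_betw[OF bij, of M] by (auto intro: summable_on_imp_summable)
  have s: "(\<Sum>n. f N (int_decode n)) = s N" for N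
    using assms(4)[of N] has_sum_reindex_bij_betw[OF bij, of "f N" "s N"] has_sum_imp_sums sums_unique by metis
  have "summable (\<lambda>n. norm (g (int_decode n))) \<and> (\<lambda>N. \<Sum>n. f N (int_decode n)) \<longlonglongrightarrow> (\<Sum>n. g (int_decode n))"
    using tannerys_theorem[of "\<lambda>n N. f N (int_decode n)" "\<lambda>n. g (int_decode n)" sequentially "\<lambda>n. M (int_decode n)"]
      assms(1,2) M by (simp add: case_prod_unfold)
  then have "summable (\<lambda>n. norm (g (int_decode n)))" "(\<Sum>n. g (int_decode n)) = L"
    using assms(5) LIMSEQ_unique by (auto simp: s)
  then have "((\<lambda>n. g (int_decode n)) has_sum L) UNIV"
    using norm_summable_imp_has_sum[OF _ summable_sums[OF summable_norm_cancel]] by metis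
  then show ?thesis by (simp add: has_sum_reindex_bij_betw[OF bij])
qed

lemma summable_on_intI:
  fixes f :: "int \<Rightarrow> real"
  assumes "(\<lambda>n. f (int n)) summable_on UNIV" "(\<lambda>n. f (- int n)) summable_on UNIV"
  shows "f summable_on UNIV"
proof -
  have "f summable_on range int" using assms(1) by (subst summable_on_reindex) (auto simp: o_def)
  moreover have "f summable_on range (\<lambda>n. - int n)"
    using assms(2) by (subst summable_on_reindex) (auto simp: o_def inj_on_def)
  ultimately have "f summable_on (range int \<union> range (\<lambda>n. - int n))"
    by (rule summable_on_union)
  moreover have "k \<in> range int \<union> range (\<lambda>n. - int n)" for k
    by (cases k rule: int_cases2) auto
  then have "range int \<union> range (\<lambda>n. - int n) = UNIV" by auto
  ultimately show ?thesis by simp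
qed

text \<open>Consecutive terms have quotient B r^n, which tends to 0 however large \<open>B\<close>
  is.\<close>

lemma summable_gauss_nat:
  assumes "0 < B" "0 < r" "r < (1::real)"
  shows "summable (\<lambda>n. B ^ n * r ^ (n * (n - 1) div 2))"
proof -
  have "(\<lambda>n. B * r ^ n) \<longlonglongrightarrow> B * 0"
    using assms by (intro tendsto_intros) auto
  then have "eventually (\<lambda>n. B * r ^ n < 1/2) sequentially"
    by (rule order_tendstoD) simp
  then obtain N where N: "\<And>n. n \<ge> N \<Longrightarrow> B * r ^ n < 1/2"
    by (auto simp: eventually_sequentially)
  show ?thesis
  proof (rule summable_ratio_test[of "1/2" N])
    fix n assume n: "N \<le> n"
    have e: "Suc n * (Suc n - 1) div 2 = n * (n - 1) div 2 + n"
      by (cases n) (simp_all add: algebra_simps)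
    have "B ^ Suc n * r ^ (Suc n * (Suc n - 1) div 2) = (B * r ^ n) * (B ^ n * r ^ (n * (n - 1) div 2))"
      unfolding e power_add by simp
    also have "\<dots> \<le> 1/2 * (B ^ n * r ^ (n * (n - 1) div 2))"
      using N[OF n] assms by (intro mult_right_mono) auto
    finally show "norm (B ^ Suc n * r ^ (Suc n * (Suc n - 1) div 2)) \<le> 1/2 * norm (B ^ n * r ^ (n * (n - 1) div 2))"
      using assms by simp
  qed simp
qed

definition tri :: "int \<Rightarrow> int" where "tri k = k * (k - 1) div 2"

lemma two_tri: "2 * tri k = k * (k - 1)"
  unfolding tri_def by (simp add: even_mult_iff)

lemma tri_Suc: "tri (k + 1) = tri k + k" and tri_pred: "tri (k - 1) = tri k - (k - 1)"
  using two_tri[of k] two_tri[of "k + 1"] two_tri[of "k - 1"] by (simp_all add: algebra_simps)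

lemma tri_add: "tri (a + b) = tri a + tri b + a * b"
  using two_tri[of "a + b"] two_tri[of a] two_tri[of b] by (simp add: algebra_simps)

lemma tri_minus: "tri (- k) = tri k + k"
  using two_tri[of "- k"] two_tri[of k] by (simp add: algebra_simps)

lemma tri_nonneg: "0 \<le> tri k"
proof -
  have "0 \<le> k * (k - 1)" by (cases "k \<ge> 1") (auto simp: mult_nonpos_nonpos)
  then show ?thesis unfolding tri_def by simp
qed

lemma tri_int: "tri (int n) = int (n * (n - 1) div 2)"
proof (cases n)
  case (Suc m)
  have "int n * (int n - 1) = int (n * (n - 1))" unfolding Suc by (simp add: algebra_simps)
  then show ?thesis unfolding tri_def by (simp only: zdiv_int of_nat_numeral)
qed (simp add: tri_def)

lemma summable_gauss:
  assumes "0 < B" "0 < r" "r < (1::real)"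
  shows "(\<lambda>k. B powi k * r powi tri k) summable_on UNIV"
proof (rule summable_on_intI)
  have "(\<lambda>n. B powi int n * r powi tri (int n)) = (\<lambda>n. B ^ n * r ^ (n * (n - 1) div 2))"
    by (simp only: tri_int power_int_of_nat)
  moreover have "\<dots> summable_on UNIV"
    by (rule norm_summable_imp_summable_on) (use summable_gauss_nat[OF assms] assms in simp)
  ultimately show "(\<lambda>n. B powi int n * r powi tri (int n)) summable_on UNIV" by simp
  have "(\<lambda>n. B powi (- int n) * r powi tri (- int n)) = (\<lambda>n. (r / B) ^ n * r ^ (n * (n - 1) div 2))"
    using assms by (simp only: tri_minus tri_int power_int_of_nat power_int_minus)
      (auto simp: power_int_add field_simps)
  moreover have "\<dots> summable_on UNIV"
    by (rule norm_summable_imp_summable_on) (use summable_gauss_nat[of "r / B" r] assms in simp)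
  ultimately show "(\<lambda>n. B powi (- int n) * r powi tri (- int n)) summable_on UNIV" by simp
qed

lemma abs_summable_gauss:
  fixes z q :: complex
  assumes "z \<noteq> 0" "q \<noteq> 0" "norm q < 1"
  shows "(\<lambda>k. norm (z powi k * q powi tri k)) summable_on UNIV"
proof -
  have "(\<lambda>k. norm (z powi k * q powi tri k)) = (\<lambda>k. norm z powi k * norm q powi tri k)"
    by (simp only: norm_mult norm_power_int)
  then show ?thesis using summable_gauss[of "norm z" "norm q"] assms by simp
qed

section \<open>Finite forms of the theta identities and their limits\<close>

text \<open>The reciprocal of the finite Pochhammer symbol, with value 0 at negative indices. Finite
  sums thereby become sums over all integers, where shifts of the index are free, and
  \<open>rr_pred\<close> holds without a case distinction.\<close>

definition rr :: "complex \<Rightarrow> int \<Rightarrow> complex" where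
  "rr q m = (if m < 0 then 0 else 1 / (\<Prod>i<nat m. 1 - q * q ^ i))"

lemma one_minus_power_nonzero:
  assumes "norm (q :: complex) < 1" "0 < n"
  shows "1 - q ^ n \<noteq> 0"
proof -
  have "norm (q ^ n) < 1" using assms by (simp add: norm_power power_less_one_iff)
  then show ?thesis by auto
qed

lemma qfact_nonzero:
  assumes "norm q < 1"
  shows "(\<Prod>i<n. 1 - q * q ^ i) \<noteq> (0 :: complex)"
proof -
  have "1 - q * q ^ i \<noteq> 0" for i using one_minus_power_nonzero[OF assms, of "Suc i"] by simp
  then show ?thesis by simp
qed

lemma rr_pred:
  assumes "norm q < 1"
  shows "rr q (m - 1) = (1 - q powi m) * rr q m"
proof (cases "m \<le> 0")
  case False
  then obtain n where m: "m = int (Suc n)" by (metis not_le zero_less_imp_eq_int gr0_implies_Suc int_nat_eq)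
  have "rr q (m - 1) = 1 / (\<Prod>i<n. 1 - q * q ^ i)" unfolding m rr_def by simp
  moreover have "rr q m = 1 / ((\<Prod>i<n. 1 - q * q ^ i) * (1 - q ^ Suc n))" unfolding m rr_def by (simp del: of_nat_Suc)
  moreover have "q powi m = q ^ Suc n" unfolding m by (rule power_int_of_nat)
  ultimately show ?thesis using one_minus_power_nonzero[OF assms, of "Suc n"] by (simp del: power_Suc)
qed (auto simp: rr_def)

lemma rr_LIMSEQ:
  assumes "norm q < 1"
  shows "(\<lambda>N. rr q (int N + k)) \<longlonglongrightarrow> 1 / eu q"
proof -
  have "(\<lambda>n. 1 / (\<Prod>i<n. 1 - q * q ^ i)) \<longlonglongrightarrow> 1 / eu q"
    unfolding eu_def using eu_nonzero[OF assms] by (intro tendsto_intros qp_LIMSEQ assms) (simp add: eu_def)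
  moreover have "filterlim (\<lambda>N. nat (int N + k)) at_top sequentially"
    by (rule filterlim_at_top_mono[OF filterlim_minus_const_nat_at_top[of "nat \<bar>k\<bar>"]])
      (auto intro!: always_eventually)
  ultimately have "(\<lambda>N. 1 / (\<Prod>i<nat (int N + k). 1 - q * q ^ i)) \<longlonglongrightarrow> 1 / eu q"
    by (rule filterlim_compose)
  moreover have ev: "eventually (\<lambda>N. rr q (int N + k) = 1 / (\<Prod>i<nat (int N + k). 1 - q * q ^ i)) sequentially"
    using eventually_ge_at_top[of "nat \<bar>k\<bar>"] by eventually_elim (simp add: rr_def)
  ultimately show ?thesis by (simp only: tendsto_cong[OF ev])
qed

lemma rr_bounded:
  assumes "norm q < 1"
  obtains C where "0 < C" "\<And>m. norm (rr q m) \<le> C"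
proof -
  have "Bseq (\<lambda>N. rr q (int N + 0))"
    by (rule convergent_imp_Bseq) (use rr_LIMSEQ[OF assms] in \<open>blast intro: convergentI\<close>)
  then obtain C where C: "0 < C" "\<And>n. norm (rr q (int n)) \<le> C"
    by (auto simp: Bseq_def)
  moreover have "norm (rr q m) \<le> C" for m
  proof (cases "m < 0")
    case True
    then show ?thesis using C(1) by (simp add: rr_def)
  next
    case False
    then show ?thesis using C(2)[of "nat m"] by simp
  qed
  ultimately show ?thesis using that by blast
qed

definition jterm :: "complex \<Rightarrow> complex \<Rightarrow> int \<Rightarrow> complex" where
  "jterm z q k = (- z) powi k * q powi tri k"

lemma jterm_Suc: "z \<noteq> 0 \<Longrightarrow> q \<noteq> 0 \<Longrightarrow> jterm z q (k + 1) = - z * q powi k * jterm z q k"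
  unfolding jterm_def by (simp add: tri_Suc power_int_add)

lemma jterm_pred:
  assumes "z \<noteq> 0" "q \<noteq> 0"
  shows "- z * q powi k * jterm z q (k - 1) = q * jterm z q k"
proof -
  have "q powi k = q * q powi (k - 1)"
    using power_int_add_1[of q "k - 1"] assms by (simp add: mult.commute)
  then show ?thesis using jterm_Suc[OF assms, of "k - 1"] by simp
qed

lemma has_sum_diff:
  fixes f :: "'a \<Rightarrow> complex"
  assumes "(f has_sum a) A" "(g has_sum b) A"
  shows "((\<lambda>x. f x - g x) has_sum (a - b)) A"
  using has_sum_add[OF assms(1) has_sum_uminusI[OF assms(2)]] by simp

lemma has_sum_divide_cancel:
  fixes f :: "'a \<Rightarrow> complex"
  assumes "((\<lambda>x. c * f x) has_sum s) A" "c \<noteq> 0"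
  shows "(f has_sum s / c) A"
  using has_sum_divide_const[OF assms(1), of c] assms(2) by simp

lemma has_sum_shift_int:
  fixes f :: "int \<Rightarrow> complex"
  shows "((\<lambda>k. f (k + a)) has_sum s) UNIV \<longleftrightarrow> (f has_sum s) UNIV"
proof -
  have "bij_betw (\<lambda>k. k + a) UNIV (UNIV :: int set)"
    by (rule bij_betwI[where g = "\<lambda>k. k - a"]) auto
  from has_sum_reindex_bij_betw[OF this, of f s] show ?thesis .
qed

text \<open>With x = q^k and y = q^N this is a rational identity times a common factor. Summed over
  \<open>k\<close> the shifts disappear, and the right-hand coefficient becomes 1 + q y^2 - z y - q
  y/z, that is (1 - z y)(1 - q y/z): the next factor of the product.\<close>

lemma jacobi_triple_step:
  fixes N :: nat and k :: int
  assumes q: "q \<noteq> 0" "norm q < 1" and z: "z \<noteq> 0"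
  defines "F \<equiv> \<lambda>n k. jterm z q k * (rr q (int n - k) * rr q (int n + k))"
  shows "(1 - q * (q ^ N)\<^sup>2) * (1 - q\<^sup>2 * (q ^ N)\<^sup>2) * F (Suc N) k =
      (1 + q * (q ^ N)\<^sup>2) * F N k - z * q ^ N * F N (k + -1) - q * q ^ N / z * F N (k + 1)"
proof -
  define x where "x = q powi k"
  define y where "y = q ^ N"
  have x: "x \<noteq> 0" using q by (simp add: x_def)
  define t where "t = jterm z q k"
  define A where "A = rr q (int N + 1 - k)"
  define B where "B = rr q (int N + 1 + k)"
  have pw: "q powi (int N + 1 - k) = q * y / x" "q powi (int N + 1 + k) = q * y * x"
     "q powi (int N + k) = y * x" "q powi (int N - k) = y / x"
    using q by (simp_all add: power_int_add power_int_diff x_def y_def)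
  have r1: "rr q (int N - k) = (1 - q * y / x) * A"
    using rr_pred[OF q(2), of "int N + 1 - k"] unfolding pw A_def by simp
  have r2: "rr q (int N + k) = (1 - q * y * x) * B"
    using rr_pred[OF q(2), of "int N + 1 + k"] unfolding pw B_def by (simp add: algebra_simps)
  have r3: "rr q (int N + k - 1) = (1 - y * x) * ((1 - q * y * x) * B)"
    using rr_pred[OF q(2), of "int N + k"] unfolding pw r2 .
  have r4: "rr q (int N - k - 1) = (1 - y / x) * ((1 - q * y / x) * A)"
    using rr_pred[OF q(2), of "int N - k"] unfolding pw r1 .
  have F1: "F (Suc N) k = t * (A * B)"
  proof -
    have "int (Suc N) - k = int N + 1 - k" "int (Suc N) + k = int N + 1 + k" by simp_all
    then show ?thesis by (simp only: F_def t_def A_def B_def)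
  qed
  have F2: "F N k = t * ((1 - q * y / x) * A * ((1 - q * y * x) * B))"
    by (simp only: F_def r1 r2 t_def)
  have F3: "z * y * F N (k + -1) = - (q * y / x * t * (A * ((1 - y * x) * ((1 - q * y * x) * B))))"
  proof -
    have "- z * x * jterm z q (k - 1) = q * t" unfolding x_def t_def by (rule jterm_pred[OF z q(1)])
    then have "x * (z * jterm z q (k - 1)) + q * t = 0"
      by (simp only: mult_minus_left) (simp add: algebra_simps flip: \<open>- z * x * jterm z q (k - 1) = q * t\<close>)
    then have "x * (z * jterm z q (k - 1)) = - (q * t)" by (simp only: eq_neg_iff_add_eq_0)
    then have j: "z * jterm z q (k - 1) = - (q / x * t)"
      using x by (metis (no_types, lifting) mult_minus_right nonzero_mult_div_cancel_left times_divide_eq_left mult.commute minus_divide_left)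
    have "int N - (k + -1) = int N + 1 - k" "int N + (k + -1) = int N + k - 1" "k + -1 = k - 1" by simp_all
    then have "F N (k + -1) = jterm z q (k - 1) * (A * rr q (int N + k - 1))"
      by (simp only: F_def A_def)
    then have "z * y * F N (k + -1) = y * (z * jterm z q (k - 1)) * (A * rr q (int N + k - 1))"
      by simp
    then show ?thesis unfolding r3 j by simp
  qed
  have F4: "q * y / z * F N (k + 1) = - (q * y * x * t * (((1 - y / x) * ((1 - q * y / x) * A)) * B))"
  proof -
    have "int N - (k + 1) = int N - k - 1" "int N + (k + 1) = int N + 1 + k" by simp_all
    then have "F N (k + 1) = (- z * x * t) * (rr q (int N - k - 1) * B)"
      by (simp only: F_def x_def t_def B_def jterm_Suc[OF z q(1)])
    then show ?thesis unfolding r4 using z by simp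
  qed
  have "(1 - q * y\<^sup>2) * (1 - q\<^sup>2 * y\<^sup>2) = (1 + q * y\<^sup>2) * ((1 - q * y / x) * (1 - q * y * x))
     + q * y / x * ((1 - y * x) * (1 - q * y * x)) + q * y * x * ((1 - y / x) * (1 - q * y / x))"
    using x by (simp add: field_simps power2_eq_square)
  then have "(1 - q * y\<^sup>2) * (1 - q\<^sup>2 * y\<^sup>2) * (t * (A * B)) = ((1 + q * y\<^sup>2) * ((1 - q * y / x) * (1 - q * y * x))
     + q * y / x * ((1 - y * x) * (1 - q * y * x)) + q * y * x * ((1 - y / x) * (1 - q * y / x))) * (t * (A * B))"
    by (rule arg_cong)
  also have "\<dots> = (1 + q * y\<^sup>2) * F N k - z * y * F N (k + -1) - q * y / z * F N (k + 1)"
  proof -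
    have "(c * (u * v) + a * (w * v) + b * (p * u)) * (t * (A * B)) =
      c * (t * (u * A * (v * B))) - - (a * t * (A * (w * (v * B)))) - - (b * t * (((p * (u * A))) * B))"
      for a b c p u v w :: complex by (simp add: algebra_simps)
    then show ?thesis unfolding F2 F3 F4 .
  qed
  finally show ?thesis unfolding F1 y_def .
qed

lemma finite_jacobi_triple:
  assumes q: "q \<noteq> 0" "norm q < 1" and z: "z \<noteq> 0"
  shows "((\<lambda>k. jterm z q k * (rr q (int N - k) * rr q (int N + k))) has_sum
    (\<Prod>i<N. (1 - z * q ^ i) * (1 - q / z * q ^ i)) / (\<Prod>i<2 * N. 1 - q * q ^ i)) UNIV"
proof (induction N)
  case 0
  have "jterm z q k * (rr q (int 0 - k) * rr q (int 0 + k)) = 0" if "k \<noteq> 0" for k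
    using that by (cases "k < 0") (simp_all add: rr_def)
  then have "((\<lambda>k. jterm z q k * (rr q (int 0 - k) * rr q (int 0 + k))) has_sum
     (\<Sum>k\<in>{0}. jterm z q k * (rr q (int 0 - k) * rr q (int 0 + k)))) UNIV"
    by (intro has_sum_finite_neutralI[of "{0}"]) auto
  then show ?case by (simp add: jterm_def tri_def rr_def)
next
  case (Suc N)
  define F where "F N k = jterm z q k * (rr q (int N - k) * rr q (int N + k))" for N k
  define P where "P = (\<Prod>i<N. (1 - z * q ^ i) * (1 - q / z * q ^ i))"
  define E where "E = (\<Prod>i<2 * N. 1 - q * q ^ i)"
  define y where "y = q ^ N"
  have E: "E \<noteq> 0" unfolding E_def by (rule qfact_nonzero[OF q(2)])
  have y: "y \<noteq> 0" unfolding y_def using q by simp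
  have ih: "(F N has_sum P / E) UNIV" using Suc unfolding F_def[abs_def] P_def E_def .
  have e: "(1 - q * y\<^sup>2) * (1 - q\<^sup>2 * y\<^sup>2) * F (Suc N) k =
      (1 + q * y\<^sup>2) * F N k - z * y * F N (k + -1) - q * y / z * F N (k + 1)" for k
    using jacobi_triple_step[OF q z, of N k] by (simp add: F_def y_def)
  have "((\<lambda>k. (1 + q * y\<^sup>2) * F N k - z * y * F N (k + -1) - q * y / z * F N (k + 1)) has_sum
     ((1 + q * y\<^sup>2) * (P / E) - z * y * (P / E) - q * y / z * (P / E))) UNIV"
    by (intro has_sum_diff has_sum_cmult_right ih iffD2[OF has_sum_shift_int])
  then have hs: "((\<lambda>k. (1 - q * y\<^sup>2) * (1 - q\<^sup>2 * y\<^sup>2) * F (Suc N) k) has_sum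
     ((1 + q * y\<^sup>2) * (P / E) - z * y * (P / E) - q * y / z * (P / E))) UNIV"
    by (simp only: e)
  have y2: "y\<^sup>2 = q ^ (2 * N)" by (simp add: y_def power_mult[symmetric] mult.commute)
  have nz: "1 - q * y\<^sup>2 \<noteq> 0" "1 - q\<^sup>2 * y\<^sup>2 \<noteq> 0"
    using one_minus_power_nonzero[OF q(2), of "Suc (2 * N)"] one_minus_power_nonzero[OF q(2), of "Suc (Suc (2 * N))"]
    by (simp_all add: y2 power2_eq_square[of q] mult.assoc)
  moreover have "(F (Suc N) has_sum ((1 + q * y\<^sup>2) * (P / E) - z * y * (P / E) - q * y / z * (P / E)) /
      ((1 - q * y\<^sup>2) * (1 - q\<^sup>2 * y\<^sup>2))) UNIV"
    by (rule has_sum_divide_cancel[OF hs]) (use nz in simp)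
  moreover have "(\<Prod>i<Suc N. (1 - z * q ^ i) * (1 - q / z * q ^ i)) = P * ((1 - z * y) * (1 - q / z * y))"
    by (simp add: P_def y_def)
  moreover have "(\<Prod>i<2 * Suc N. 1 - q * q ^ i) = E * ((1 - q * y\<^sup>2) * (1 - q\<^sup>2 * y\<^sup>2))"
    by (simp add: E_def y2 power2_eq_square[of q] mult.assoc)
  moreover have "((1 + q * y\<^sup>2) * (P / E) - z * y * (P / E) - q * y / z * (P / E)) / ((1 - q * y\<^sup>2) * (1 - q\<^sup>2 * y\<^sup>2))
      = P * ((1 - z * y) * (1 - q / z * y)) / (E * ((1 - q * y\<^sup>2) * (1 - q\<^sup>2 * y\<^sup>2)))"
  proof -
    have "((1 + q * y\<^sup>2) * (P / E) - z * y * (P / E) - q * y / z * (P / E)) = P * ((1 - z * y) * (1 - q / z * y)) / E"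
      using z E by (simp add: field_simps power2_eq_square)
    then show ?thesis by simp
  qed
  ultimately show ?case unfolding F_def[abs_def] by (simp only:)
qed

lemma abs_summable_jterm:
  assumes "z \<noteq> 0" "q \<noteq> 0" "norm q < 1"
  shows "(\<lambda>k. norm (jterm z q k)) summable_on UNIV"
  unfolding jterm_def by (rule abs_summable_gauss) (use assms in auto)

theorem jacobi_triple:
  assumes q: "q \<noteq> 0" "norm q < 1" and z: "z \<noteq> 0"
  shows "(jterm z q has_sum qp z q * qp (q / z) q * eu q) UNIV"
proof -
  obtain C where C: "0 < C" "\<And>m. norm (rr q m) \<le> C" using rr_bounded[OF q(2)] by blast
  have eu: "eu q \<noteq> 0" by (rule eu_nonzero[OF q(2)])
  have lim: "(\<lambda>N. rr q (int N - k) * rr q (int N + k)) \<longlonglongrightarrow> 1 / eu q * (1 / eu q)" for k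
    using tendsto_mult[OF rr_LIMSEQ[OF q(2), of "- k"] rr_LIMSEQ[OF q(2), of k]] by simp
  have "((\<lambda>k. jterm z q k * (1 / eu q * (1 / eu q))) has_sum qp z q * qp (q / z) q / eu q) UNIV"
  proof (rule tannery_int)
    show "(\<lambda>N. jterm z q k * (rr q (int N - k) * rr q (int N + k))) \<longlonglongrightarrow> jterm z q k * (1 / eu q * (1 / eu q))" for k
      by (intro tendsto_mult_left lim)
    show "norm (jterm z q k * (rr q (int N - k) * rr q (int N + k))) \<le> norm (jterm z q k) * (C * C)" for N k
      unfolding norm_mult by (intro mult_left_mono mult_mono C) (use C in auto)
    show "(\<lambda>k. norm (jterm z q k) * (C * C)) summable_on UNIV"
      by (intro summable_on_cmult_left abs_summable_jterm q z)
    show "((\<lambda>k. jterm z q k * (rr q (int N - k) * rr q (int N + k))) has_sum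
      (\<Prod>i<N. (1 - z * q ^ i) * (1 - q / z * q ^ i)) / (\<Prod>i<2 * N. 1 - q * q ^ i)) UNIV" for N
      by (rule finite_jacobi_triple[OF q z])
    have "(\<lambda>N. \<Prod>i<2 * N. 1 - q * q ^ i) \<longlonglongrightarrow> eu q"
      using LIMSEQ_subseq_LIMSEQ[OF qp_LIMSEQ[OF q(2), of q], of "\<lambda>N. 2 * N"]
      by (simp add: o_def strict_mono_def eu_def)
    then show "(\<lambda>N. (\<Prod>i<N. (1 - z * q ^ i) * (1 - q / z * q ^ i)) / (\<Prod>i<2 * N. 1 - q * q ^ i))
       \<longlonglongrightarrow> qp z q * qp (q / z) q / eu q"
      unfolding prod.distrib by (intro tendsto_intros qp_LIMSEQ q eu)
  qed
  from has_sum_cmult_left[OF this, of "eu q * eu q"] eu show ?thesis by (simp add: mult.assoc)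
qed

lemma jterm_q_minus: "q \<noteq> 0 \<Longrightarrow> jterm q q k * q powi (- k) = jterm 1 q k"
proof -
  assume q: "q \<noteq> 0"
  have "(- q) powi k = (- 1) powi k * q powi k"
    using power_int_mult_distrib[of "- 1" q k] by simp
  then show ?thesis using q by (simp add: jterm_def power_int_minus)
qed

lemma power_int_add_nat: "q \<noteq> 0 \<Longrightarrow> q powi (int n + k) = q ^ n * q powi k" for q :: complex
  by (simp add: power_int_add)

lemma power_int_diff_nat: "q \<noteq> 0 \<Longrightarrow> q powi (int n - k) = q ^ n * q powi (- k)" for q :: complex
  using power_int_add_nat[of q n "- k"] by simp

lemma divide_add_eq: "d = a + b * u \<Longrightarrow> u \<noteq> 0 \<Longrightarrow> d / u = a / u + b" for u :: complex
  by (simp add: add_divide_distrib)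

text \<open>A partial fraction expansion in \<open>z\<close>, by induction on \<open>N\<close>.
  Multiplying by the two new factors leaves the previous case plus multiples of finite triple
  product sums that vanish.\<close>

lemma finite_reciprocal_theta:
  assumes q: "q \<noteq> 0" "norm q < 1" and z: "z \<noteq> 0" "\<And>k. z * q powi k \<noteq> 1"
  shows "((\<lambda>k. jterm q q k * (rr q (int N - k) * rr q (int N + k)) / (1 - z * q powi k)) has_sum
    1 / ((\<Prod>i<Suc N. 1 - z * q ^ i) * (\<Prod>i<N. 1 - q / z * q ^ i))) UNIV"
proof (induction N)
  case 0
  have "jterm q q k * (rr q (int 0 - k) * rr q (int 0 + k)) = 0" if "k \<noteq> 0" for k
    using that by (cases "k < 0") (simp_all add: rr_def)
  then have "((\<lambda>k. jterm q q k * (rr q (int 0 - k) * rr q (int 0 + k)) / (1 - z * q powi k)) has_sum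
     (\<Sum>k\<in>{0}. jterm q q k * (rr q (int 0 - k) * rr q (int 0 + k)) / (1 - z * q powi k))) UNIV"
    by (intro has_sum_finite_neutralI[of "{0}"]) auto
  then show ?case by (simp add: jterm_def tri_def rr_def)
next
  case (Suc N)
  define M where "M = q ^ Suc N"
  define b where "b k = rr q (int (Suc N) - k) * rr q (int (Suc N) + k)" for k
  define D where "D = (1 - z * M) * (1 - M / z)"
  have D: "D \<noteq> 0"
  proof -
    have "z * q powi int (Suc N) \<noteq> 1" "z * q powi (- int (Suc N)) \<noteq> 1" by (rule z(2))+
    then have "z * M \<noteq> 1" "z * inverse M \<noteq> 1"
      by (simp_all only: power_int_of_nat power_int_minus M_def not_False_eq_True)
    moreover have "M \<noteq> 0" using q by (simp add: M_def)
    ultimately have "1 - z * M \<noteq> 0" "1 - M / z \<noteq> 0"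
      using z(1) by (auto simp: divide_eq_1_iff)
    then show ?thesis by (simp add: D_def)
  qed
  \<comment> \<open>For \<open>w = 1\<close> the factor 1 - w and for \<open>w = q\<close> the
    factor 1 - q/w is zero at \<open>i = 0\<close>.\<close>
  have sum0: "((\<lambda>k. jterm w q k * b k) has_sum 0) UNIV" if "w = q \<or> w = 1" for w
  proof -
    have p0: "(\<Prod>i<Suc N. (1 - w * q ^ i) * (1 - q / w * q ^ i)) = 0"
      using that q by (auto simp: prod.lessThan_Suc_shift simp del: prod.lessThan_Suc)
    have "w \<noteq> 0" using that q by auto
    from finite_jacobi_triple[OF q this, of "Suc N"] show ?thesis
      unfolding p0 b_def div_0 .
  qed
  have e: "D * (jterm q q k * b k / (1 - z * q powi k)) =
      jterm q q k * (rr q (int N - k) * rr q (int N + k)) / (1 - z * q powi k)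
      + M * (jterm 1 q k * b k) - M / z * (jterm q q k * b k)" for k
  proof -
    define x where "x = q powi k"
    have x: "x \<noteq> 0" "1 - z * x \<noteq> 0" using q z(2)[of k] by (simp_all add: x_def)
    have p: "q powi (int (Suc N) - k) = M / x" "q powi (int (Suc N) + k) = M * x"
      unfolding power_int_add_nat[OF q(1)] power_int_diff_nat[OF q(1)] M_def x_def
      by (simp_all add: power_int_minus divide_inverse)
    have "int N - k = int (Suc N) - k - 1" "int N + k = int (Suc N) + k - 1" by simp_all
    then have r: "rr q (int N - k) * rr q (int N + k) = (1 - M / x) * (1 - M * x) * b k"
      unfolding b_def by (simp only: rr_pred[OF q(2)] p mult_ac)
    have j: "jterm 1 q k = jterm q q k / x"
      using jterm_q_minus[OF q(1), of k] by (simp add: x_def power_int_minus divide_inverse)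
    \<comment> \<open>\<open>D\<close> differs from the factor that lowers \<open>rr\<close> by a
      multiple of 1 - z x, so the excess has no pole and is a combination of the sums in
      \<open>sum0\<close>.\<close>
    have "D = (1 - M / x) * (1 - M * x) + (M / x - M / z) * (1 - z * x)"
      unfolding D_def using x(1) z(1) by (simp add: field_simps)
    then have d: "D / (1 - z * x) = (1 - M / x) * (1 - M * x) / (1 - z * x) + (M / x - M / z)"
      using x(2) by (rule divide_add_eq)
    have "D * (t * b k / u) = t * b k * (D / u)" for t u by simp
    moreover have "t * b k * (a / u + (M / x - M / z)) = t * (a * b k) / u + M * (t / x * b k) - M / z * (t * b k)" for t u a
      by (simp add: algebra_simps)
    ultimately show ?thesis unfolding x_def[symmetric] r j by (simp only: d)
  qed
  have "((\<lambda>k. D * (jterm q q k * b k / (1 - z * q powi k))) has_sum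
     (1 / ((\<Prod>i<Suc N. 1 - z * q ^ i) * (\<Prod>i<N. 1 - q / z * q ^ i)) + M * 0 - M / z * 0)) UNIV"
    unfolding e by (intro has_sum_diff has_sum_add has_sum_cmult_right Suc sum0) auto
  then have hs: "((\<lambda>k. jterm q q k * b k / (1 - z * q powi k)) has_sum
     (1 / ((\<Prod>i<Suc N. 1 - z * q ^ i) * (\<Prod>i<N. 1 - q / z * q ^ i)) + M * 0 - M / z * 0) / D) UNIV"
    by (rule has_sum_divide_cancel) (rule D)
  have p: "(\<Prod>i<Suc (Suc N). 1 - z * q ^ i) * (\<Prod>i<Suc N. 1 - q / z * q ^ i) =
     ((\<Prod>i<Suc N. 1 - z * q ^ i) * (\<Prod>i<N. 1 - q / z * q ^ i)) * D"
    unfolding prod.lessThan_Suc[of _ "Suc N"] prod.lessThan_Suc[of "\<lambda>i. 1 - q / z * q ^ i" N] D_def M_def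
    by (simp add: mult_ac)
  show ?case
    using hs unfolding p b_def by (simp only: mult_zero_right add_0_right diff_0_right divide_divide_eq_left)
qed

theorem reciprocal_theta:
  assumes q: "q \<noteq> 0" "norm q < 1" and z: "z \<noteq> 0" "\<And>k. z * q powi k \<noteq> 1"
  shows "((\<lambda>k. jterm q q k / (1 - z * q powi k)) has_sum (eu q)\<^sup>2 / (qp z q * qp (q / z) q)) UNIV"
proof -
  obtain C where C: "0 < C" "\<And>m. norm (rr q m) \<le> C" using rr_bounded[OF q(2)] by blast
  have eu: "eu q \<noteq> 0" by (rule eu_nonzero[OF q(2)])
  have "Bseq (\<lambda>n. 1 / (1 - z * q ^ n))"
  proof (rule convergent_imp_Bseq, rule convergentI)
    show "(\<lambda>n. 1 / (1 - z * q ^ n)) \<longlonglongrightarrow> 1 / (1 - z * 0)"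
      by (intro tendsto_intros LIMSEQ_power_zero q) simp
  qed
  then obtain B1 where B1: "0 < B1" "\<And>n. norm (1 / (1 - z * q ^ n)) \<le> B1" by (auto simp: Bseq_def)
  \<comment> \<open>For k = -n the denominator grows, and 1/(1 - z q^k) equals q^n/(q^n - z), which
    is bounded in this form.\<close>
  have "Bseq (\<lambda>n. q ^ n / (q ^ n - z))"
  proof (rule convergent_imp_Bseq, rule convergentI)
    show "(\<lambda>n. q ^ n / (q ^ n - z)) \<longlonglongrightarrow> 0 / (0 - z)"
      using z by (intro tendsto_intros LIMSEQ_power_zero q) simp
  qed
  then obtain B2 where B2: "0 < B2" "\<And>n. norm (q ^ n / (q ^ n - z)) \<le> B2" by (auto simp: Bseq_def)
  have B: "norm (1 / (1 - z * q powi k)) \<le> B1 + B2" for k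
  proof (cases k rule: int_cases2)
    case (nonneg n)
    then show ?thesis using B1(2)[of n] B2(1) by simp
  next
    case (nonpos n)
    have "1 / (1 - z * q powi k) = q ^ n / (q ^ n - z)"
      unfolding nonpos power_int_minus power_int_of_nat using q by (simp add: field_simps)
    then show ?thesis using B2(2)[of n] B1(1) by simp
  qed
  have lim: "(\<lambda>N. rr q (int N - k) * rr q (int N + k)) \<longlonglongrightarrow> 1 / eu q * (1 / eu q)" for k
    using tendsto_mult[OF rr_LIMSEQ[OF q(2), of "- k"] rr_LIMSEQ[OF q(2), of k]] by simp
  have n1: "z * q ^ n \<noteq> 1" for n using z(2)[of "int n"] by simp
  have n2: "q / z * q ^ n \<noteq> 1" for n
  proof -
    have "z * q powi (- int (Suc n)) \<noteq> 1" by (rule z(2))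
    then have "z * inverse (q ^ Suc n) \<noteq> 1" by (simp only: power_int_minus power_int_of_nat not_False_eq_True)
    then show ?thesis using q z(1) by (simp add: field_simps)
  qed
  have "((\<lambda>k. jterm q q k * (1 / eu q * (1 / eu q)) / (1 - z * q powi k)) has_sum 1 / (qp z q * qp (q / z) q)) UNIV"
  proof (rule tannery_int)
    show "(\<lambda>N. jterm q q k * (rr q (int N - k) * rr q (int N + k)) / (1 - z * q powi k))
        \<longlonglongrightarrow> jterm q q k * (1 / eu q * (1 / eu q)) / (1 - z * q powi k)" for k
      by (intro tendsto_intros tendsto_mult_left lim) (use z(2)[of k] in auto)
    show "norm (jterm q q k * (rr q (int N - k) * rr q (int N + k)) / (1 - z * q powi k)) \<le>
        norm (jterm q q k) * (C * C) * (B1 + B2)" for N k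
    proof -
      have "norm (jterm q q k * (rr q (int N - k) * rr q (int N + k)) / (1 - z * q powi k)) =
         norm (jterm q q k) * (norm (rr q (int N - k)) * norm (rr q (int N + k))) * norm (1 / (1 - z * q powi k))"
        by (simp add: norm_mult norm_divide)
      also have "\<dots> \<le> norm (jterm q q k) * (C * C) * (B1 + B2)"
        by (intro mult_left_mono mult_mono C B) (use C in auto)
      finally show ?thesis .
    qed
    show "(\<lambda>k. norm (jterm q q k) * (C * C) * (B1 + B2)) summable_on UNIV"
      by (intro summable_on_cmult_left abs_summable_jterm q)
    show "((\<lambda>k. jterm q q k * (rr q (int N - k) * rr q (int N + k)) / (1 - z * q powi k)) has_sum
      1 / ((\<Prod>i<Suc N. 1 - z * q ^ i) * (\<Prod>i<N. 1 - q / z * q ^ i))) UNIV" for N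
      by (rule finite_reciprocal_theta[OF q z])
    show "(\<lambda>N. 1 / ((\<Prod>i<Suc N. 1 - z * q ^ i) * (\<Prod>i<N. 1 - q / z * q ^ i)))
       \<longlonglongrightarrow> 1 / (qp z q * qp (q / z) q)"
      using qp_nonzero[OF q(2) n1] qp_nonzero[OF q(2) n2]
      by (intro tendsto_intros qp_LIMSEQ LIMSEQ_Suc[OF qp_LIMSEQ] q) simp
  qed
  from has_sum_cmult_left[OF this, of "eu q * eu q"] eu show ?thesis
    by (simp add: power2_eq_square)
qed

text \<open>The finite triple product has a factor 1 - z; dividing it out and letting z tend to 1
  gives the derivative of the other side. Working with the finite sum avoids differentiating a
  series term by term.\<close>

lemma finite_jacobi_cube:
  assumes q: "q \<noteq> 0" "norm q < 1"
  shows "((\<lambda>k. of_int k * jterm 1 q k * (rr q (int (Suc N) - k) * rr q (int (Suc N) + k))) has_sum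
    - ((\<Prod>i<N. 1 - q * q ^ i) * (\<Prod>i<Suc N. 1 - q * q ^ i) / (\<Prod>i<2 * Suc N. 1 - q * q ^ i))) UNIV"
proof -
  define K where "K = {- int (Suc N)..int (Suc N)}"
  define c where "c k = jterm 1 q k * (rr q (int (Suc N) - k) * rr q (int (Suc N) + k))" for k
  define h where "h z = (\<Prod>i<N. 1 - z * q * q ^ i) * (\<Prod>i<Suc N. 1 - q / z * q ^ i) / (\<Prod>i<2 * Suc N. 1 - q * q ^ i)" for z
  define f where "f z = (\<Sum>k\<in>K. c k * z powi k)" for z
  have c0: "c k = 0" if "k \<notin> K" for k
    using that unfolding c_def K_def by (cases "k < 0") (auto simp: rr_def)
  have jt: "jterm z q k = jterm 1 q k * z powi k" for z k
    using power_int_mult_distrib[of "- 1" z k] by (simp add: jterm_def)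
  have f: "f z = (1 - z) * h z" if z: "z \<noteq> 0" for z
  proof -
    have "((\<lambda>k. c k * z powi k) has_sum f z) UNIV"
      unfolding f_def by (rule has_sum_finite_neutralI[of K]) (auto simp: K_def c0)
    moreover have "(\<lambda>k. c k * z powi k) = (\<lambda>k. jterm z q k * (rr q (int (Suc N) - k) * rr q (int (Suc N) + k)))"
      unfolding c_def jt[of z] by (simp add: mult_ac)
    moreover have "(\<Prod>i<Suc N. (1 - z * q ^ i) * (1 - q / z * q ^ i)) / (\<Prod>i<2 * Suc N. 1 - q * q ^ i) = (1 - z) * h z"
      unfolding prod.distrib prod.lessThan_Suc_shift[of "\<lambda>i. 1 - z * q ^ i"] h_def by (simp add: mult_ac)
    ultimately show ?thesis
      using finite_jacobi_triple[OF q z, of "Suc N"] has_sum_unique by metis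
  qed
  have "(f has_field_derivative (\<Sum>k\<in>K. c k * (of_int k * 1 powi (k - 1)))) (at 1)"
    unfolding f_def by (auto intro!: derivative_eq_intros simp: mult_ac)
  then have l1: "((\<lambda>z. (f z - f 1) / (z - 1)) \<longlongrightarrow> (\<Sum>k\<in>K. c k * of_int k)) (at 1)"
    by (simp add: has_field_derivative_iff)
  have l2: "((\<lambda>z. - h z) \<longlongrightarrow> - h 1) (at 1)"
    unfolding h_def using qfact_nonzero[OF q(2), of "2 * Suc N"] by (intro tendsto_intros) auto
  have ev: "eventually (\<lambda>z. (f z - f 1) / (z - 1) = - h z) (at 1)"
  proof -
    have "eventually (\<lambda>z :: complex. z \<noteq> 0) (at 1)" "eventually (\<lambda>z :: complex. z \<noteq> 1) (at 1)"
      by (auto intro: eventually_neq_at_within)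
    then show ?thesis
      by eventually_elim (simp add: f[of 1] f, simp add: field_simps)
  qed
  have e: "(\<Sum>k\<in>K. c k * of_int k) = - h 1"
    by (rule tendsto_unique[OF _ l1[unfolded tendsto_cong[OF ev]] l2]) simp
  have "((\<lambda>k. of_int k * c k) has_sum (\<Sum>k\<in>K. of_int k * c k)) UNIV"
    by (rule has_sum_finite_neutralI[of K]) (auto simp: K_def c0)
  moreover have "(\<Sum>k\<in>K. of_int k * c k) = - h 1" using e by (simp add: mult.commute)
  ultimately show ?thesis by (simp only: c_def h_def mult.assoc mult_1_left div_by_1)
qed

lemma half_powi: "(1 / 2 :: real) powi k = 2 powi (- k)"
  by (metis inverse_eq_divide power_int_inverse power_int_minus)

text \<open>A factor \<open>k\<close> in front of a theta series is thus dominated by two theta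
  series with argument doubled and halved.\<close>

lemma int_le_powi: "\<bar>real_of_int k\<bar> \<le> 2 powi k + 2 powi (- k)"
proof (cases k rule: int_cases2)
  case (nonneg n)
  have "real n \<le> 2 ^ n" using of_nat_less_two_power[of n, where 'a = real] by simp
  moreover have "0 \<le> (2 :: real) powi (- int n)" by simp
  ultimately show ?thesis unfolding nonneg power_int_of_nat of_int_of_nat_eq abs_of_nat by linarith
next
  case (nonpos n)
  have "real n \<le> 2 ^ n" using of_nat_less_two_power[of n, where 'a = real] by simp
  moreover have "0 \<le> (2 :: real) powi (- int n)" by simp
  ultimately show ?thesis unfolding nonpos minus_minus power_int_of_nat of_int_minus of_int_of_nat_eq abs_minus_cancel abs_of_nat by linarith
qed

theorem jacobi_cube:
  assumes q: "q \<noteq> 0" "norm q < 1"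
  shows "((\<lambda>k. of_int k * jterm 1 q k) has_sum - (eu q ^ 3)) UNIV"
proof -
  obtain C where C: "0 < C" "\<And>m. norm (rr q m) \<le> C" using rr_bounded[OF q(2)] by blast
  have eu: "eu q \<noteq> 0" by (rule eu_nonzero[OF q(2)])
  have lim: "(\<lambda>N. rr q (int (Suc N) - k) * rr q (int (Suc N) + k)) \<longlonglongrightarrow> 1 / eu q * (1 / eu q)" for k
    using LIMSEQ_Suc[OF tendsto_mult[OF rr_LIMSEQ[OF q(2), of "- k"] rr_LIMSEQ[OF q(2), of k]]] by simp
  have sm: "(\<lambda>k. (2 powi k + 2 powi (- k)) * norm (jterm 1 q k)) summable_on UNIV"
  proof -
    have *: "norm (jterm w q k) = norm w powi k * norm (jterm 1 q k)" for w k
      by (simp add: jterm_def norm_mult norm_power_int)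
    have "(\<lambda>k. norm (jterm 2 q k) + norm (jterm (1/2) q k)) summable_on UNIV"
      by (intro summable_on_add abs_summable_jterm q) auto
    then show ?thesis
      unfolding *[of 2] *[of "1/2"] norm_divide norm_one norm_numeral half_powi distrib_right .
  qed
  have "((\<lambda>k. of_int k * jterm 1 q k * (1 / eu q * (1 / eu q))) has_sum - (eu q * eu q / eu q)) UNIV"
  proof (rule tannery_int)
    show "(\<lambda>N. of_int k * jterm 1 q k * (rr q (int (Suc N) - k) * rr q (int (Suc N) + k)))
        \<longlonglongrightarrow> of_int k * jterm 1 q k * (1 / eu q * (1 / eu q))" for k
      by (intro tendsto_mult_left lim)
    show "norm (of_int k * jterm 1 q k * (rr q (int (Suc N) - k) * rr q (int (Suc N) + k))) \<le>
        (2 powi k + 2 powi (- k)) * norm (jterm 1 q k) * (C * C)" for N k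
      unfolding norm_mult norm_of_int by (intro mult_mono C int_le_powi) (use C in auto)
    show "(\<lambda>k. (2 powi k + 2 powi (- k)) * norm (jterm 1 q k) * (C * C)) summable_on UNIV"
      by (intro summable_on_cmult_left sm)
    show "((\<lambda>k. of_int k * jterm 1 q k * (rr q (int (Suc N) - k) * rr q (int (Suc N) + k))) has_sum
      - ((\<Prod>i<N. 1 - q * q ^ i) * (\<Prod>i<Suc N. 1 - q * q ^ i) / (\<Prod>i<2 * Suc N. 1 - q * q ^ i))) UNIV" for N
      by (rule finite_jacobi_cube[OF q])
    have "strict_mono (\<lambda>N. 2 * Suc N)" by (simp add: strict_mono_def)
    from LIMSEQ_subseq_LIMSEQ[OF qp_LIMSEQ[OF q(2), of q] this]
    have "(\<lambda>N. \<Prod>i<2 * Suc N. 1 - q * q ^ i) \<longlonglongrightarrow> eu q"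
      by (simp add: o_def eu_def)
    then show "(\<lambda>N. - ((\<Prod>i<N. 1 - q * q ^ i) * (\<Prod>i<Suc N. 1 - q * q ^ i) / (\<Prod>i<2 * Suc N. 1 - q * q ^ i)))
       \<longlonglongrightarrow> - (eu q * eu q / eu q)"
      using qp_LIMSEQ[OF q(2), of q] LIMSEQ_Suc[OF qp_LIMSEQ[OF q(2), of q]] eu
      unfolding eu_def[symmetric] by (intro tendsto_intros)
  qed
  from has_sum_cmult_left[OF this, of "eu q * eu q"] eu show ?thesis
    by (simp add: power3_eq_cube mult.assoc)
qed

section \<open>Theta quotients\<close>

definition jt :: "complex \<Rightarrow> complex \<Rightarrow> complex" where
  "jt z q = qp z q * qp (q / z) q * eu q"

lemma jt_has_sum: "q \<noteq> 0 \<Longrightarrow> norm q < 1 \<Longrightarrow> z \<noteq> 0 \<Longrightarrow> (jterm z q has_sum jt z q) UNIV"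
  unfolding jt_def by (rule jacobi_triple)

lemma jt_1: "norm q < 1 \<Longrightarrow> jt 1 q = 0"
  unfolding jt_def by (subst qp_rec) auto

lemma jt_swap: "q \<noteq> 0 \<Longrightarrow> jt (q / z) q = jt z q"
  by (cases "z = 0") (simp_all add: jt_def)

lemma jterm_shift:
  assumes "q \<noteq> 0" "z \<noteq> 0"
  shows "jterm (z * q powi a) q (m - a) = (- z) powi (- a) * q powi (- tri a) * jterm z q m * q powi 0"
proof -
  have "(- (z * q powi a)) powi (m - a) = (- z) powi (m - a) * q powi (a * (m - a))"
    using power_int_mult_distrib[of "- z" "q powi a" "m - a"] by (simp add: power_int_mult)
  moreover have e: "tri (m - a) + a * (m - a) = tri m - tri a"
    using tri_add[of "m - a" a] by (simp add: algebra_simps)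
  have "q powi (a * (m - a)) * q powi tri (m - a) = q powi (tri (m - a) + a * (m - a))"
    using assms(1) by (simp add: power_int_add mult.commute)
  then have "q powi (a * (m - a)) * q powi tri (m - a) = q powi tri m * q powi (- tri a)"
    unfolding e using assms(1) by (simp add: power_int_diff power_int_minus divide_inverse)
  moreover have "(- z) powi (m - a) = (- z) powi m * (- z) powi (- a)"
    using assms(2) power_int_add[of "- z" m "- a"] by simp
  ultimately show ?thesis unfolding jterm_def by (simp add: mult_ac)
qed

text \<open>Quasi-periodicity is a shift of the summation index in the theta series.\<close>

lemma jt_shift:
  assumes "q \<noteq> 0" "norm q < 1" "z \<noteq> 0"
  shows "jt (z * q powi a) q = (- z) powi (- a) * q powi (- tri a) * jt z q"
proof (rule has_sum_unique)
  have "(jterm (z * q powi a) q has_sum jt (z * q powi a) q) UNIV"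
    using assms by (intro jt_has_sum) auto
  then show "((\<lambda>m. jterm (z * q powi a) q (m + - a)) has_sum jt (z * q powi a) q) UNIV"
    unfolding has_sum_shift_int .
  have "((\<lambda>m. (- z) powi (- a) * q powi (- tri a) * jterm z q m) has_sum (- z) powi (- a) * q powi (- tri a) * jt z q) UNIV"
    by (intro has_sum_cmult_right jt_has_sum assms)
  then show "((\<lambda>m. jterm (z * q powi a) q (m + - a)) has_sum (- z) powi (- a) * q powi (- tri a) * jt z q) UNIV"
    using jterm_shift[OF assms(1,3), of a] by simp
qed

lemma jt_power: "q \<noteq> 0 \<Longrightarrow> norm q < 1 \<Longrightarrow> jt (q powi a) q = 0"
  using jt_shift[of q 1 a] by (simp add: jt_1)

lemma jt_inverse:
  assumes "q \<noteq> 0" "norm q < 1" "z \<noteq> 0"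
  shows "jt (1 / z) q = - jt z q / z"
proof -
  have "tri 1 = 0" by (simp add: tri_def)
  then show ?thesis using jt_shift[of q "1 / z" 1] jt_swap[of q z] assms by (simp add: power_int_minus field_simps)
qed

lemma norm_pow_less_1: "norm (x :: complex) < 1 \<Longrightarrow> 0 < n \<Longrightarrow> norm (x ^ n) < 1"
  by (simp add: norm_power power_less_one_iff)

lemma qp_neg_eu: "norm q < 1 \<Longrightarrow> qp (- q) q = eu (q\<^sup>2) / eu q"
  using qp_neg[of q q] eu_nonzero[of q] by (simp add: eu_def field_simps)

lemma qp_odd: "norm q < 1 \<Longrightarrow> qp q (q\<^sup>2) = eu q / eu (q\<^sup>2)"
  using qp_split2[of q q] eu_nonzero[of "q\<^sup>2"] norm_pow_less_1[of q 2]
  by (simp add: eu_def field_simps power2_eq_square)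

definition phi :: "complex \<Rightarrow> complex" where "phi q = jt q (q\<^sup>2)"

lemma phi_eq:
  assumes "q \<noteq> 0" "norm q < 1"
  shows "phi q = (eu q)\<^sup>2 / eu (q\<^sup>2)"
proof -
  have "eu (q\<^sup>2) \<noteq> 0" using assms by (intro eu_nonzero norm_pow_less_1) auto
  moreover have "q\<^sup>2 / q = q" using assms by (simp add: power2_eq_square)
  ultimately show ?thesis
    unfolding phi_def jt_def by (simp only: qp_odd[OF assms(2)]) (simp add: field_simps power2_eq_square)
qed

text \<open>In Ramanujan's notation \<open>phi q\<close> is \<open>\<phi>(-q)\<close>, \<open>thA x\<close> is \<open>\<phi>(-x\<^sup>3)\<close>
  and \<open>thJ x\<close> is \<open>2 \<psi>(x\<^sup>3)\<close>.\<close>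

definition thA where "thA x = phi (x ^ 3)"
definition thB where "thB x = jt x (x ^ 6)"
definition thP where "thP x = jt (- x) (x ^ 3)"
definition thJ where "thJ x = jt (- 1) (x ^ 3)"

lemma thA_eq: "x \<noteq> 0 \<Longrightarrow> norm x < 1 \<Longrightarrow> thA x = (eu (x ^ 3))\<^sup>2 / eu (x ^ 6)"
  using phi_eq[of "x ^ 3"] norm_pow_less_1[of x 3] by (simp add: thA_def flip: power_mult)

lemma thJ_eq:
  assumes "x \<noteq> 0" "norm x < 1"
  shows "thJ x = 2 * (eu (x ^ 6))\<^sup>2 / eu (x ^ 3)"
proof -
  have q: "norm (x ^ 3) < 1" using assms by (intro norm_pow_less_1) auto
  have "qp (- 1) (x ^ 3) = 2 * qp (- (x ^ 3)) (x ^ 3)" using qp_rec[OF q, of "- 1"] by simp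
  then show ?thesis
    using eu_nonzero[OF q] by (simp add: thJ_def jt_def qp_neg_eu[OF q] power2_eq_square flip: power_mult)
qed

lemma thP_eq:
  assumes "x \<noteq> 0" "norm x < 1"
  shows "thP x = eu (x\<^sup>2) * (eu (x ^ 3))\<^sup>2 / (eu x * eu (x ^ 6))"
proof -
  have q: "norm (x ^ 3) < 1" using assms by (intro norm_pow_less_1) auto
  have q6: "eu (x ^ 6) \<noteq> 0" using assms by (intro eu_nonzero norm_pow_less_1) auto
  have "qp (- x) x = qp (- x) (x ^ 3) * qp (- (x\<^sup>2)) (x ^ 3) * qp (- (x ^ 3)) (x ^ 3)"
    using qp_split3[OF assms(2), of "- x"] by (simp add: power2_eq_square power3_eq_cube mult.assoc)
  then have "eu (x\<^sup>2) / eu x = qp (- x) (x ^ 3) * qp (- (x\<^sup>2)) (x ^ 3) * (eu (x ^ 6) / eu (x ^ 3))"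
    using qp_neg_eu[OF assms(2)] qp_neg_eu[OF q] by (simp flip: power_mult)
  moreover have "x ^ 3 / (- x) = - (x\<^sup>2)" using assms by (simp add: power3_eq_cube power2_eq_square)
  ultimately show ?thesis
    using eu_nonzero[OF q] eu_nonzero[OF assms(2)] q6
    by (simp add: thP_def jt_def field_simps power2_eq_square)
qed

lemma thB_eq:
  assumes "x \<noteq> 0" "norm x < 1"
  shows "thB x = eu x * (eu (x ^ 6))\<^sup>2 / (eu (x\<^sup>2) * eu (x ^ 3))"
proof -
  have q2: "norm (x\<^sup>2) < 1" and q3: "norm (x ^ 3) < 1" and q6: "norm (x ^ 6) < 1"
    using assms by (auto intro!: norm_pow_less_1)
  have e: "(x\<^sup>2) ^ 3 = x ^ 6" "x * x\<^sup>2 = x ^ 3" "x * (x\<^sup>2)\<^sup>2 = x ^ 5"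
    by (simp_all add: eval_nat_numeral)
  have "qp x (x\<^sup>2) = qp x (x ^ 6) * qp (x ^ 3) (x ^ 6) * qp (x ^ 5) (x ^ 6)"
    using qp_split3[OF q2, of x] by (simp only: e)
  then have "eu x / eu (x\<^sup>2) = qp x (x ^ 6) * (eu (x ^ 3) / eu (x ^ 6)) * qp (x ^ 5) (x ^ 6)"
    using qp_odd[OF assms(2)] qp_odd[OF q3] by (simp flip: power_mult)
  moreover have "x ^ 6 / x = x ^ 5" using assms by (simp add: eval_nat_numeral)
  ultimately show ?thesis
    using eu_nonzero[OF q2] eu_nonzero[OF q3] eu_nonzero[OF q6]
    by (simp add: thB_def jt_def field_simps power2_eq_square)
qed

lemma eu_split3:
  assumes "norm x < 1"
  shows "eu x = qp x (x ^ 3) * qp (x\<^sup>2) (x ^ 3) * eu (x ^ 3)"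
  using qp_split3[OF assms, of x] by (simp add: eu_def power2_eq_square power3_eq_cube mult.assoc)

text \<open>The exponents 2, 4 and 6 modulo 6 together run through all even numbers. Read as a
  series, this is the pentagonal number theorem in x^2.\<close>

lemma jt_square_sixth:
  assumes "x \<noteq> 0" "norm x < 1"
  shows "jt (x\<^sup>2) (x ^ 6) = eu (x\<^sup>2)" "jt (x ^ 4) (x ^ 6) = eu (x\<^sup>2)"
proof -
  have q2: "norm (x\<^sup>2) < 1" using assms by (intro norm_pow_less_1) auto
  have e: "(x\<^sup>2) ^ 3 = x ^ 6" "(x\<^sup>2)\<^sup>2 = x ^ 4" "x ^ 6 / x\<^sup>2 = x ^ 4" "x ^ 6 / x ^ 4 = x\<^sup>2"
    using assms by (simp_all add: eval_nat_numeral)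
  show "jt (x\<^sup>2) (x ^ 6) = eu (x\<^sup>2)" "jt (x ^ 4) (x ^ 6) = eu (x\<^sup>2)"
    using eu_split3[OF q2] by (simp_all only: jt_def e mult_ac)
qed

lemma thP_thB: "x \<noteq> 0 \<Longrightarrow> norm x < 1 \<Longrightarrow> 2 * thP x * thB x = thJ x * thA x"
  using eu_nonzero[of x] eu_nonzero[of "x\<^sup>2"] eu_nonzero[of "x ^ 3"] eu_nonzero[of "x ^ 6"]
    norm_pow_less_1[of x 2] norm_pow_less_1[of x 3] norm_pow_less_1[of x 6]
  by (simp add: thP_eq thB_eq thJ_eq thA_eq field_simps power2_eq_square)

lemma cube_root_of_unity: "\<exists>w::complex. w ^ 3 = 1 \<and> 1 + w + w\<^sup>2 = 0 \<and> norm w = 1"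
proof -
  define w where "w = Complex (- 1 / 2) (sqrt 3 / 2)"
  have w: "1 + w + w\<^sup>2 = 0" by (simp add: w_def power2_eq_square complex_eq_iff)
  have "w ^ 3 - 1 = (w - 1) * (1 + w + w\<^sup>2)" by (simp add: algebra_simps power2_eq_square power3_eq_cube)
  moreover have "norm w = 1" by (simp add: w_def cmod_def power2_eq_square)
  ultimately show ?thesis using w by auto
qed

text \<open>The factors 1 - q^n with n not divisible by 3 multiply to 1 - q^(3n), giving
  eu(q^3)/eu(q^9) in total; those with n divisible by 3 are cubed.\<close>

lemma eu_cube:
  assumes q: "norm q < 1" and w: "w ^ 3 = 1" "1 + w + w\<^sup>2 = (0 :: complex)" "norm w = 1"
  shows "eu q * eu (w * q) * eu (w\<^sup>2 * q) = eu (q ^ 3) ^ 4 / eu (q ^ 9)"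
proof -
  have q3: "norm (q ^ 3) < 1" and q9: "norm (q ^ 9) < 1" using q by (auto intro!: norm_pow_less_1)
  have nw: "norm (w * q) < 1" "norm (w\<^sup>2 * q) < 1" using q w(3) by (simp_all add: norm_mult norm_power)
  have w2: "(w\<^sup>2) ^ 3 = 1" "(w\<^sup>2)\<^sup>2 = w" using w(1) by (simp_all add: power_mult[symmetric] eval_nat_numeral mult.assoc)
  have w3: "1 + w\<^sup>2 + (w\<^sup>2)\<^sup>2 = 0" using w(2) w2(2) by (simp add: algebra_simps)
  have c: "(w * q) ^ 3 = q ^ 3" "(w\<^sup>2 * q) ^ 3 = q ^ 3" "(w * q)\<^sup>2 = w\<^sup>2 * q\<^sup>2" "(w\<^sup>2 * q)\<^sup>2 = (w\<^sup>2)\<^sup>2 * q\<^sup>2"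
    using w(1) w2(1) by (simp_all add: power_mult_distrib)
  have 1: "qp q (q ^ 3) * qp (w * q) (q ^ 3) * qp (w\<^sup>2 * q) (q ^ 3) = qp (q ^ 3) (q ^ 9)"
    using qp_cube[OF q3 w(1,2), of q] by (simp flip: power_mult)
  have 2: "qp (q\<^sup>2) (q ^ 3) * qp (w\<^sup>2 * q\<^sup>2) (q ^ 3) * qp ((w\<^sup>2)\<^sup>2 * q\<^sup>2) (q ^ 3) = qp (q ^ 6) (q ^ 9)"
    using qp_cube[OF q3 w2(1) w3, of "q\<^sup>2"] by (simp flip: power_mult)
  have 3: "eu (q ^ 3) = qp (q ^ 3) (q ^ 9) * qp (q ^ 6) (q ^ 9) * eu (q ^ 9)"
    using eu_split3[OF q3] by (simp flip: power_mult)
  have "eu q * eu (w * q) * eu (w\<^sup>2 * q) = (qp q (q ^ 3) * qp (w * q) (q ^ 3) * qp (w\<^sup>2 * q) (q ^ 3)) *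
     (qp (q\<^sup>2) (q ^ 3) * qp (w\<^sup>2 * q\<^sup>2) (q ^ 3) * qp ((w\<^sup>2)\<^sup>2 * q\<^sup>2) (q ^ 3)) * eu (q ^ 3) ^ 3"
    unfolding eu_split3[OF q] eu_split3[OF nw(1)] eu_split3[OF nw(2)] c
    by (simp add: power3_eq_cube mult_ac)
  also have "\<dots> = (qp (q ^ 3) (q ^ 9) * qp (q ^ 6) (q ^ 9) * eu (q ^ 9)) * eu (q ^ 3) ^ 3 / eu (q ^ 9)"
    unfolding 1 2 using eu_nonzero[OF q9] by simp
  finally show ?thesis unfolding 3[symmetric] by (simp add: eval_nat_numeral mult.assoc)
qed

lemma phi_cube:
  assumes q: "q \<noteq> 0" "norm q < 1" and w: "w ^ 3 = 1" "1 + w + w\<^sup>2 = (0 :: complex)" "norm w = 1"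
  shows "phi q * phi (w * q) * phi (w\<^sup>2 * q) = phi (q ^ 3) ^ 4 / phi (q ^ 9)"
proof -
  have w0: "w \<noteq> 0" using w(3) by auto
  have n: "norm (w * q) < 1" "norm (w\<^sup>2 * q) < 1" "norm (q\<^sup>2) < 1" "norm (q ^ 3) < 1" "norm (q ^ 9) < 1"
    "norm (q ^ 6) < 1" "norm (q ^ 18) < 1"
    using q w(3) by (auto simp: norm_mult norm_power power_less_one_iff)
  have c: "(w * q)\<^sup>2 = w\<^sup>2 * q\<^sup>2" "(w\<^sup>2 * q)\<^sup>2 = w * q\<^sup>2"
    using w(1) by (simp_all add: power_mult_distrib power_mult[symmetric] eval_nat_numeral mult.assoc)
  have 1: "eu q * eu (w * q) * eu (w\<^sup>2 * q) = eu (q ^ 3) ^ 4 / eu (q ^ 9)" by (rule eu_cube) fact+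
  have 2: "eu (q\<^sup>2) * eu (w\<^sup>2 * q\<^sup>2) * eu (w * q\<^sup>2) = eu (q ^ 6) ^ 4 / eu (q ^ 18)"
    using eu_cube[OF n(3) w] by (simp add: mult_ac flip: power_mult)
  have "phi q * phi (w * q) * phi (w\<^sup>2 * q) =
     (eu q * eu (w * q) * eu (w\<^sup>2 * q))\<^sup>2 / (eu (q\<^sup>2) * eu (w\<^sup>2 * q\<^sup>2) * eu (w * q\<^sup>2))"
    using phi_eq[of q] phi_eq[of "w * q"] phi_eq[of "w\<^sup>2 * q"] q w0 n unfolding c
    by (simp add: power_mult_distrib del: power_mult_distrib) (simp add: power_mult_distrib)
  also have "\<dots> = phi (q ^ 3) ^ 4 / phi (q ^ 9)"
    unfolding 1 2 using q n eu_nonzero[OF n(4)] eu_nonzero[OF n(5)] eu_nonzero[OF n(6)] eu_nonzero[OF n(7)]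
    by (simp add: phi_eq field_simps flip: power_mult)
  finally show ?thesis .
qed

section \<open>The dissection of phi modulo 3 and its cubic relation\<close>

lemma has_sum_int_mod3:
  fixes f :: "int \<Rightarrow> complex"
  assumes "(f has_sum s) UNIV"
  shows "((\<lambda>k. f (3 * k) + f (3 * k + 1) + f (3 * k + 2)) has_sum s) UNIV"
proof -
  have bij: "bij_betw (\<lambda>(k, r). 3 * k + r) (UNIV \<times> {0, 1, 2}) (UNIV :: int set)"
    by (rule bij_betwI[where g = "\<lambda>n. (n div 3, n mod 3)"]) auto
  have "((\<lambda>p. f (case p of (k, r) \<Rightarrow> 3 * k + r)) has_sum s) (UNIV \<times> {0, 1, 2})"
    using assms has_sum_reindex_bij_betw[OF bij, of f s] by simp
  then show ?thesis
  proof (rule has_sum_SigmaD)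
    fix k :: int
    show "((\<lambda>r. f (case (k, r) of (k, r) \<Rightarrow> 3 * k + r)) has_sum f (3 * k) + f (3 * k + 1) + f (3 * k + 2)) {0, 1, 2}"
      by (rule has_sum_finiteI) (simp_all add: add.assoc)
  qed
qed

lemma has_sum_minus_int:
  fixes f :: "int \<Rightarrow> complex"
  shows "((\<lambda>k. f (- k)) has_sum s) UNIV \<longleftrightarrow> (f has_sum s) UNIV"
proof -
  have "bij_betw (\<lambda>k. - k) UNIV (UNIV :: int set)"
    by (rule bij_betwI[where g = "\<lambda>k. - k"]) auto
  from has_sum_reindex_bij_betw[OF this, of f s] show ?thesis .
qed

lemma jterm_power:
  assumes "x \<noteq> 0"
  shows "jterm (c * x powi a) (x ^ b) k = (- c) powi k * x powi (a * k + int b * tri k)"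
proof -
  have "(- (c * x powi a)) powi k = (- c) powi k * x powi (a * k)"
    using power_int_mult_distrib[of "- c" "x powi a" k] by (simp add: power_int_mult)
  moreover have "(x ^ b) powi tri k = x powi (int b * tri k)"
    by (simp add: power_int_mult)
  ultimately show ?thesis using assms unfolding jterm_def by (simp add: power_int_add)
qed

lemma neg_one_powi: "(- 1 :: complex) powi (a + b) = (- 1) powi a * (- 1) powi b"
  "(- 1 :: complex) powi (- a) = (- 1) powi a" "(- 1 :: complex) powi (3 * a) = (- 1) powi a"
  "(- 1 :: complex) powi 1 = - 1" "(- 1 :: complex) powi 2 = 1"
proof -
  have p: "(- 1 :: complex) powi k = (if even k then 1 else - 1)" for k :: int
    by (simp add: power_int_minus_left)
  show "(- 1 :: complex) powi (a + b) = (- 1) powi a * (- 1) powi b"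
    "(- 1 :: complex) powi (- a) = (- 1) powi a" "(- 1 :: complex) powi (3 * a) = (- 1) powi a"
    "(- 1 :: complex) powi 1 = - 1" "(- 1 :: complex) powi 2 = 1"
    unfolding p by auto
qed

lemma powi_mult_cong:
  fixes x :: complex
  shows "x \<noteq> 0 \<Longrightarrow> a + b = c + d \<Longrightarrow> x powi a * x powi b = x powi c * x powi d"
  by (metis power_int_add)

lemma powi_cong: "m = n \<Longrightarrow> x powi m = x powi n" by simp

text \<open>The exponents are squares, so only the residues 0 and 1 modulo 3 occur. The indices 3k+1
  and 3k+2 give the same series up to reflection and shift, hence the factor 2.\<close>

lemma phi_dissection:
  assumes q: "q \<noteq> 0" "norm q < 1"
  shows "phi q = thA (q ^ 3) - 2 * q * thB (q ^ 3)"
proof -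
  define f where "f = jterm q (q\<^sup>2)"
  define g where "g = jterm (q ^ 3) (q ^ 18)"
  have n: "norm (q\<^sup>2) < 1" "norm (q ^ 18) < 1" using q by (auto intro!: norm_pow_less_1)
  have f: "f k = (- 1) powi k * q powi (k * k)" for k
    using jterm_power[OF q(1), of 1 1 2 k] two_tri[of k] by (simp add: f_def algebra_simps)
  have g: "g k = (- 1) powi k * q powi (9 * (k * k) - 6 * k)" for k
  proof -
    have e: "3 * k + int 18 * tri k = 9 * (k * k) - 6 * k" using two_tri[of k] by (simp add: algebra_simps)
    show ?thesis using jterm_power[OF q(1), of 1 3 18 k] unfolding e by (simp add: g_def)
  qed
  have a: "jterm (q ^ 9) (q ^ 18) k = (- 1) powi k * q powi (9 * (k * k))" for k
  proof -
    have e: "9 * k + int 18 * tri k = 9 * (k * k)" using two_tri[of k] by (simp add: algebra_simps)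
    show ?thesis using jterm_power[OF q(1), of 1 9 18 k] unfolding e by simp
  qed
  have f0: "f (3 * k) = jterm (q ^ 9) (q ^ 18) k" for k
    unfolding f a neg_one_powi by (simp add: algebra_simps)
  have f1: "f (3 * k + 1) = - q * g (- k)" for k
  proof -
    have "q powi ((3 * k + 1) * (3 * k + 1)) = q powi (1 + (9 * (- k * - k) - 6 * - k))"
      by (rule powi_cong) (simp add: algebra_simps)
    also have "\<dots> = q * q powi (9 * (- k * - k) - 6 * - k)"
      by (subst power_int_add) (use q(1) in auto)
    finally show ?thesis unfolding f g neg_one_powi by simp
  qed
  have f2: "f (3 * k + 2) = - q * g (k + 1)" for k
  proof -
    have "q powi ((3 * k + 2) * (3 * k + 2)) = q powi (1 + (9 * ((k + 1) * (k + 1)) - 6 * (k + 1)))"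
      by (rule powi_cong) (simp add: algebra_simps)
    also have "\<dots> = q * q powi (9 * ((k + 1) * (k + 1)) - 6 * (k + 1))"
      by (subst power_int_add) (use q(1) in auto)
    finally show ?thesis unfolding f g neg_one_powi by simp
  qed
  have "(f has_sum phi q) UNIV"
    unfolding f_def phi_def using q n by (intro jt_has_sum) auto
  then have 1: "((\<lambda>k. jterm (q ^ 9) (q ^ 18) k + - q * g (- k) + - q * g (k + 1)) has_sum phi q) UNIV"
    using has_sum_int_mod3[of f "phi q"] unfolding f0 f1 f2 by simp
  have G: "(g has_sum thB (q ^ 3)) UNIV"
    using jt_has_sum[OF _ n(2), of "q ^ 3"] q by (simp add: g_def thB_def flip: power_mult)
  have "(jterm (q ^ 9) (q ^ 18) has_sum thA (q ^ 3)) UNIV"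
    using jt_has_sum[OF _ n(2), of "q ^ 9"] q by (simp add: thA_def phi_def flip: power_mult)
  then have 2: "((\<lambda>k. jterm (q ^ 9) (q ^ 18) k + - q * g (- k) + - q * g (k + 1)) has_sum
      thA (q ^ 3) + - q * thB (q ^ 3) + - q * thB (q ^ 3)) UNIV"
    by (intro has_sum_add has_sum_cmult_right) (use G in \<open>simp_all add: has_sum_minus_int has_sum_shift_int\<close>)
  show ?thesis using has_sum_unique[OF 1 2] by simp
qed

text \<open>The dissection is taken at all three cube roots of \<open>x\<close>. Its product is the
  norm form thA^3 - (2 q thB)^3 with q^3 = x, and \<open>phi_cube\<close> evaluates the other
  side.\<close>

lemma thA_thB_cubic:
  assumes "x \<noteq> 0" "norm x < 1"
  shows "thA x * (thA x ^ 3 - 8 * x * thB x ^ 3) = phi x ^ 4"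
proof -
  obtain w :: complex where w: "w ^ 3 = 1" "1 + w + w\<^sup>2 = 0" "norm w = 1"
    using cube_root_of_unity by blast
  obtain q where qx: "q ^ 3 = x" using exists_complex_root[of 3 x] by auto
  have q: "q \<noteq> 0" "norm q < 1"
  proof -
    show "q \<noteq> 0" using qx assms by auto
    show "norm q < 1"
    proof (rule ccontr)
      assume "\<not> norm q < 1"
      then have "1 \<le> norm q ^ 3" by simp
      then show False using assms(2) unfolding qx[symmetric] norm_power by simp
    qed
  qed
  have w0: "w \<noteq> 0" using w(3) by auto
  have nw: "norm (w * q) < 1" "norm (w\<^sup>2 * q) < 1" using q w(3) by (simp_all add: norm_mult norm_power)
  have w2: "(w\<^sup>2) ^ 3 = 1" using w(1) by (simp add: power_mult[symmetric] eval_nat_numeral mult.assoc)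
  have c: "(w * q) ^ 3 = x" "(w\<^sup>2 * q) ^ 3 = x" using w(1) w2 qx by (simp_all only: power_mult_distrib mult_1)
  have "phi x ^ 4 / phi (x ^ 3) = phi q * phi (w * q) * phi (w\<^sup>2 * q)"
    using phi_cube[OF q w] by (simp add: qx[symmetric] flip: power_mult)
  also have "\<dots> = (thA x - 2 * q * thB x) * (thA x - 2 * (w * q) * thB x) * (thA x - 2 * (w\<^sup>2 * q) * thB x)"
    using phi_dissection[OF q] phi_dissection[OF _ nw(1)] phi_dissection[OF _ nw(2)] q w0 unfolding c qx by simp
  also have "\<dots> = thA x ^ 3 - (1 + w + w\<^sup>2) * (2 * q * thB x) * (thA x)\<^sup>2
     + w * (1 + w + w\<^sup>2) * (2 * q * thB x)\<^sup>2 * thA x - w ^ 3 * q ^ 3 * 8 * thB x ^ 3"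
    by (simp add: algebra_simps power2_eq_square power3_eq_cube)
  also have "\<dots> = thA x ^ 3 - 8 * x * thB x ^ 3" using w qx by simp
  finally have "phi x ^ 4 / phi (x ^ 3) = thA x ^ 3 - 8 * x * thB x ^ 3" .
  moreover have "phi (x ^ 3) \<noteq> 0"
  proof -
    have "norm (x ^ 3) < 1" "norm ((x ^ 3)\<^sup>2) < 1" using assms by (auto intro!: norm_pow_less_1)
    then show ?thesis using assms by (simp add: phi_eq eu_nonzero)
  qed
  ultimately show ?thesis by (simp add: thA_def field_simps)
qed

section \<open>A theta series with weights 6k + 1\<close>

lemma has_sum_product:
  fixes f g :: "_ \<Rightarrow> complex"
  assumes "(f has_sum a) A" "(g has_sum b) B"
    and "(\<lambda>x. norm (f x)) summable_on A" "(\<lambda>x. norm (g x)) summable_on B"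
  shows "((\<lambda>(x, y). f x * g y) has_sum a * b) (A \<times> B)"
    and "(\<lambda>(x, y). norm (f x * g y)) summable_on A \<times> B"
proof -
  obtain s where s: "((\<lambda>x. norm (g x)) has_sum s) B" using assms(4) by (auto simp: summable_on_def)
  show n: "(\<lambda>(x, y). norm (f x * g y)) summable_on A \<times> B"
  proof (rule summable_on_SigmaI)
    show "((\<lambda>y. case (x, y) of (x, y) \<Rightarrow> norm (f x * g y)) has_sum norm (f x) * s) B" for x
      unfolding norm_mult prod.case by (intro has_sum_cmult_right s)
    show "(\<lambda>x. norm (f x) * s) summable_on A"
      by (intro summable_on_cmult_left assms)
  qed auto
  then have "(\<lambda>p. norm (case p of (x, y) \<Rightarrow> f x * g y)) summable_on A \<times> B"
    by (simp add: case_prod_unfold)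
  then have "(\<lambda>(x, y). f x * g y) summable_on A \<times> B"
    by (rule abs_summable_summable)
  moreover have "((\<lambda>y. case (x, y) of (x, y) \<Rightarrow> f x * g y) has_sum f x * b) B" for x
    unfolding prod.case by (intro has_sum_cmult_right assms)
  moreover have "((\<lambda>x. f x * b) has_sum a * b) A"
    by (intro has_sum_cmult_left assms)
  ultimately show "((\<lambda>(x, y). f x * g y) has_sum a * b) (A \<times> B)"
    by (intro has_sum_SigmaI) auto
qed

lemma abs_summable_int_jterm:
  assumes "z \<noteq> 0" "q \<noteq> 0" "norm q < 1"
  shows "(\<lambda>k. norm (of_int k * jterm z q k)) summable_on UNIV"
proof (rule Infinite_Sum.abs_summable_on_comparison_test')
  have *: "norm (jterm (w * z) q k) = norm w powi k * norm (jterm z q k)" for w k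
    using power_int_mult_distrib[of w "- z" k] by (simp add: jterm_def norm_mult norm_power_int)
  show "(\<lambda>k. norm (jterm (2 * z) q k) + norm (jterm (1 / 2 * z) q k)) summable_on UNIV"
    by (intro summable_on_add abs_summable_jterm assms) (use assms in auto)
  show "norm (of_int k * jterm z q k) \<le> norm (jterm (2 * z) q k) + norm (jterm (1 / 2 * z) q k)" for k
  proof -
    have "norm (jterm (2 * z) q k) + norm (jterm (1 / 2 * z) q k) = (2 powi k + 2 powi (- k)) * norm (jterm z q k)"
      unfolding * norm_divide norm_one norm_numeral half_powi distrib_right ..
    moreover have "norm (of_int k * jterm z q k) \<le> (2 powi k + 2 powi (- k)) * norm (jterm z q k)"
      unfolding norm_mult norm_of_int by (intro mult_right_mono int_le_powi) auto
    ultimately show ?thesis by simp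
  qed
qed

text \<open>The exponent is the generalized pentagonal number
  \<open>k * (3 * k + 1) / 2\<close>.\<close>

definition thE :: "complex \<Rightarrow> int \<Rightarrow> complex" where
  "thE x k = (6 * of_int k + 1) * x powi (3 * tri k + 2 * k)"

text \<open>Modulo 6 the exponent 4 - 2N is 4, 2 or 0 according to N modulo 3. Quasi-periodicity
  moves the argument to x^4 or x^2, where the theta function is eu(x^2), or to a power of the base,
  where it is 0.\<close>

lemma quintuple_coeff:
  assumes x: "x \<noteq> 0" "norm x < 1"
  shows "jt (x powi (4 - 2 * (3 * k))) (x ^ 6) * x powi tri (3 * k) = (- 1) powi k * x powi (3 * tri k + k) * eu (x\<^sup>2)"
    "jt (x powi (4 - 2 * (3 * k + 1))) (x ^ 6) * x powi tri (3 * k + 1) = (- 1) powi k * x powi (3 * tri k + 2 * k) * eu (x\<^sup>2)"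
    "jt (x powi (4 - 2 * (3 * k + 2))) (x ^ 6) = 0"
proof -
  have n: "x ^ 6 \<noteq> 0" "norm (x ^ 6) < 1" using x by (auto intro!: norm_pow_less_1)
  have sh: "jt (x ^ a * (x ^ 6) powi (- k)) (x ^ 6) = (- 1) powi k * x powi (int a * k - 6 * tri (- k)) * jt (x ^ a) (x ^ 6)" for a
  proof -
    have "(- (x ^ a)) powi k = (- 1) powi k * x powi (int a * k)"
      using power_int_mult_distrib[of "- 1" "x powi int a" k] by (simp add: power_int_mult)
    moreover have "(x ^ 6) powi (- tri (- k)) = x powi (- (6 * tri (- k)))"
      using power_int_mult[of x 6 "- tri (- k)"] by simp
    moreover have "x powi (int a * k) * x powi (- (6 * tri (- k))) = x powi (int a * k - 6 * tri (- k))"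
      using x by (simp add: power_int_diff power_int_minus divide_inverse)
    ultimately show ?thesis using jt_shift[OF n, of "x ^ a" "- k"] x by (simp add: mult_ac)
  qed
  have pw: "x powi (int a - 6 * k) = x ^ a * (x ^ 6) powi (- k)" for a
    using x power_int_mult[of x 6 "- k"] by (simp add: power_int_diff power_int_minus divide_inverse)
  have t: "2 * tri (3 * k) = 3 * k * (3 * k - 1)" "2 * tri (3 * k + 1) = (3 * k + 1) * (3 * k)" "2 * tri (- k) = k * (k + 1)"
      "2 * tri k = k * (k - 1)"
    using two_tri[of "3 * k"] two_tri[of "3 * k + 1"] two_tri[of "- k"] two_tri[of k] by (simp_all add: algebra_simps)
  have "jt (x powi (4 - 2 * (3 * k))) (x ^ 6) * x powi tri (3 * k) =
     (- 1) powi k * (x powi (4 * k - 6 * tri (- k)) * x powi tri (3 * k)) * eu (x\<^sup>2)"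
    using pw[of 4] sh[of 4] jt_square_sixth[OF x] by simp
  also have "x powi (4 * k - 6 * tri (- k)) * x powi tri (3 * k) = x powi (4 * k - 6 * tri (- k) + tri (3 * k))"
    using x by (simp add: power_int_add)
  also have "4 * k - 6 * tri (- k) + tri (3 * k) = 3 * tri k + k"
    using t by (simp add: algebra_simps)
  finally show "jt (x powi (4 - 2 * (3 * k))) (x ^ 6) * x powi tri (3 * k) = (- 1) powi k * x powi (3 * tri k + k) * eu (x\<^sup>2)" .
  have "jt (x powi (4 - 2 * (3 * k + 1))) (x ^ 6) * x powi tri (3 * k + 1) =
     (- 1) powi k * (x powi (2 * k - 6 * tri (- k)) * x powi tri (3 * k + 1)) * eu (x\<^sup>2)"
    using pw[of 2] sh[of 2] jt_square_sixth[OF x] by simp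
  also have "x powi (2 * k - 6 * tri (- k)) * x powi tri (3 * k + 1) = x powi (2 * k - 6 * tri (- k) + tri (3 * k + 1))"
    using x by (simp add: power_int_add)
  also have "2 * k - 6 * tri (- k) + tri (3 * k + 1) = 3 * tri k + 2 * k"
    using t by (simp add: algebra_simps)
  finally show "jt (x powi (4 - 2 * (3 * k + 1))) (x ^ 6) * x powi tri (3 * k + 1) = (- 1) powi k * x powi (3 * tri k + 2 * k) * eu (x\<^sup>2)" .
  show "jt (x powi (4 - 2 * (3 * k + 2))) (x ^ 6) = 0"
    using pw[of 0] jt_power[OF n, of "- k"] by simp
qed

text \<open>Multiplying the series for \<open>eu x ^ 3\<close> and \<open>phi x\<close> and sorting the double sum by
  \<open>N = n + 2 * m\<close> makes every inner sum a theta function, which vanishes or is \<open>eu (x ^ 2)\<close> up to a power.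
  The weight \<open>2 * m\<close> may be added because \<open>jt 1 x = 0\<close>.\<close>

lemma thE_has_sum:
  assumes x: "x \<noteq> 0" "norm x < 1"
  shows "(thE x has_sum eu x ^ 3 * phi x / eu (x\<^sup>2)) UNIV"
proof -
  have n2: "x\<^sup>2 \<noteq> 0" "norm (x\<^sup>2) < 1" and n6: "x ^ 6 \<noteq> 0" "norm (x ^ 6) < 1" using x by (auto intro!: norm_pow_less_1)
  define F where "F = (\<lambda>(n, m). (of_int n + 2 * of_int m) * (jterm 1 x n * jterm x (x\<^sup>2) m))"
  have phi: "(jterm x (x\<^sup>2) has_sum phi x) UNIV" unfolding phi_def by (rule jt_has_sum[OF n2 x(1)])
  have one: "(jterm 1 x has_sum 0) UNIV" using jt_has_sum[OF x, of 1] jt_1[OF x(2)] by simp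
  obtain d where d: "((\<lambda>m. of_int m * jterm x (x\<^sup>2) m) has_sum d) UNIV"
    using abs_summable_summable[OF abs_summable_int_jterm[OF x(1) n2]] by (auto simp: summable_on_def)
  have "((\<lambda>(n, m). (of_int n * jterm 1 x n) * jterm x (x\<^sup>2) m) has_sum - (eu x ^ 3) * phi x) (UNIV \<times> UNIV)"
    by (intro has_sum_product jacobi_cube phi abs_summable_int_jterm abs_summable_jterm x n2) auto
  moreover have "((\<lambda>(n, m). jterm 1 x n * (of_int m * jterm x (x\<^sup>2) m)) has_sum 0 * d) (UNIV \<times> UNIV)"
    by (intro has_sum_product one d abs_summable_int_jterm abs_summable_jterm x n2) auto
  ultimately have "((\<lambda>p. (case p of (n, m) \<Rightarrow> (of_int n * jterm 1 x n) * jterm x (x\<^sup>2) m) +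
       2 * (case p of (n, m) \<Rightarrow> jterm 1 x n * (of_int m * jterm x (x\<^sup>2) m)))
      has_sum - (eu x ^ 3) * phi x + 2 * (0 * d)) (UNIV \<times> UNIV)"
    by (intro has_sum_add has_sum_cmult_right)
  then have F: "(F has_sum - (eu x ^ 3 * phi x)) UNIV"
    by (simp add: F_def case_prod_unfold algebra_simps)
  \<comment> \<open>On the line n + 2m = N the weight n + 2m is the constant N, so the inner sum is
    an unweighted theta series.\<close>
  define c where "c N = of_int N * (- 1) powi N * (jt (x powi (4 - 2 * N)) (x ^ 6) * x powi tri N)" for N
  have "bij_betw (\<lambda>(N, m). (N - 2 * m, m)) (UNIV \<times> UNIV) (UNIV :: (int \<times> int) set)"
    by (rule bij_betwI[where g = "\<lambda>(n, m). (n + 2 * m, m)"]) auto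
  then have "((\<lambda>p. F (case p of (N, m) \<Rightarrow> (N - 2 * m, m))) has_sum - (eu x ^ 3 * phi x)) (UNIV \<times> UNIV)"
    using F by (subst has_sum_reindex_bij_betw[where g = "\<lambda>(N, m). (N - 2 * m, m)" and f = F])
  then have "(c has_sum - (eu x ^ 3 * phi x)) UNIV"
  proof (rule has_sum_SigmaD)
    fix N :: int
    have e: "F (N - 2 * m, m) = of_int N * (- 1) powi N * x powi tri N * jterm (x powi (4 - 2 * N)) (x ^ 6) m" for m
    proof -
      have 1: "jterm 1 x (N - 2 * m) = (- 1) powi N * x powi tri (N - 2 * m)"
        unfolding jterm_def using neg_one_powi(1)[of N "- 2 * m"] power_int_mult[of "- 1 :: complex" 2 "- m"] by simp
      have 2: "jterm x (x\<^sup>2) m = (- 1) powi m * x powi (m + 2 * tri m)"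
        using jterm_power[OF x(1), of 1 1 2 m] by simp
      have 3: "jterm (x powi (4 - 2 * N)) (x ^ 6) m = (- 1) powi m * x powi ((4 - 2 * N) * m + 6 * tri m)"
        using jterm_power[OF x(1), of 1 "4 - 2 * N" 6 m] by simp
      have "tri (N - 2 * m) + (m + 2 * tri m) = tri N + ((4 - 2 * N) * m + 6 * tri m)"
        using two_tri[of "N - 2 * m"] two_tri[of N] two_tri[of m] by (simp add: algebra_simps)
      then have "x powi tri (N - 2 * m) * x powi (m + 2 * tri m) = x powi tri N * x powi ((4 - 2 * N) * m + 6 * tri m)"
        by (rule powi_mult_cong[OF x(1)])
      then show ?thesis unfolding F_def prod.case 1 2 3 by (simp add: mult_ac)
    qed
    show "((\<lambda>m. F (case (N, m) of (N, m) \<Rightarrow> (N - 2 * m, m))) has_sum c N) UNIV"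
      unfolding prod.case e c_def
      using has_sum_cmult_right[OF jt_has_sum[OF n6, of "x powi (4 - 2 * N)"], of "of_int N * (- 1) powi N * x powi tri N"] x
      by (simp add: mult_ac)
  qed
  from has_sum_int_mod3[OF this]
  have "((\<lambda>k. (3 * of_int k * x powi (3 * tri k + k) - (3 * of_int k + 1) * x powi (3 * tri k + 2 * k)) * eu (x\<^sup>2))
      has_sum - (eu x ^ 3 * phi x)) UNIV"
  proof (rule has_sum_cong[THEN iffD1, rotated])
    fix k :: int
    have s: "(- 1 :: complex) powi k * (- 1) powi k = 1"
      using neg_one_powi(1)[of k "- k"] neg_one_powi(2)[of k] by simp
    show "c (3 * k) + c (3 * k + 1) + c (3 * k + 2) =
       (3 * of_int k * x powi (3 * tri k + k) - (3 * of_int k + 1) * x powi (3 * tri k + 2 * k)) * eu (x\<^sup>2)"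
      unfolding c_def quintuple_coeff[OF x] neg_one_powi using s by (simp add: algebra_simps)
  qed
  from has_sum_divide_const[OF this, of "eu (x\<^sup>2)"] have G: "((\<lambda>k. 3 * of_int k * x powi (3 * tri k + k) - (3 * of_int k + 1) * x powi (3 * tri k + 2 * k))
      has_sum - (eu x ^ 3 * phi x) / eu (x\<^sup>2)) UNIV" (is "(?G has_sum _) _")
    using eu_nonzero[OF n2(2)] by simp
  have sm: "(\<lambda>k. of_int k * x powi (3 * tri k + k)) summable_on UNIV"
  proof -
    have "jterm (- x) (x ^ 3) k = x powi (3 * tri k + k)" for k
      using jterm_power[OF x(1), of "- 1" 1 3 k] by (simp add: add.commute)
    then show ?thesis
      using abs_summable_summable[OF abs_summable_int_jterm[of "- x" "x ^ 3"]] x norm_pow_less_1[of x 3] by simp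
  qed
  then obtain u where u: "((\<lambda>k. of_int k * x powi (3 * tri k + k)) has_sum u) UNIV"
    by (auto simp: summable_on_def)
  have r: "3 * tri (- k) + - k = 3 * tri k + 2 * k" for k by (simp add: tri_minus)
  \<comment> \<open>Reflection exchanges the two families of exponents, which allows the terms with
    exponent \<open>3 * tri k + k\<close> to be moved onto the other family.\<close>
  have "((\<lambda>k. of_int (- k) * x powi (3 * tri (- k) + - k)) has_sum u) UNIV"
    using u by (subst has_sum_minus_int)
  then have v: "((\<lambda>k. - of_int k * x powi (3 * tri k + 2 * k)) has_sum u) UNIV"
    unfolding r by simp
  have "((\<lambda>k. - ?G k + 3 * (of_int k * x powi (3 * tri k + k)) + - 3 * (- of_int k * x powi (3 * tri k + 2 * k))) has_sum
     - (- (eu x ^ 3 * phi x) / eu (x\<^sup>2)) + 3 * u + - 3 * u) UNIV"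
    by (intro has_sum_add has_sum_cmult_right has_sum_uminusI u v G)
  then have "((\<lambda>k. (6 * of_int k + 1) * x powi (3 * tri k + 2 * k)) has_sum eu x ^ 3 * phi x / eu (x\<^sup>2)) UNIV"
    by (simp add: algebra_simps)
  then show ?thesis by (simp add: thE_def[abs_def])
qed

section \<open>Dissection of the Lambert-type series\<close>

lemma has_sum_nat_mod3:
  fixes f :: "nat \<Rightarrow> complex"
  assumes "(f has_sum s) UNIV"
  shows "((\<lambda>k. f (3 * k) + f (3 * k + 1) + f (3 * k + 2)) has_sum s) UNIV"
proof -
  have bij: "bij_betw (\<lambda>(k, r). 3 * k + r) (UNIV \<times> {0, 1, 2}) (UNIV :: nat set)"
    by (rule bij_betwI[where g = "\<lambda>n. (n div 3, n mod 3)"]) (auto, presburger+)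
  have "((\<lambda>p. f (case p of (k, r) \<Rightarrow> 3 * k + r)) has_sum s) (UNIV \<times> {0, 1, 2})"
    using assms has_sum_reindex_bij_betw[OF bij, of f s] by simp
  then show ?thesis
  proof (rule has_sum_SigmaD)
    fix k :: nat
    show "((\<lambda>r. f (case (k, r) of (k, r) \<Rightarrow> 3 * k + r)) has_sum f (3 * k) + f (3 * k + 1) + f (3 * k + 2)) {0, 1, 2}"
      by (rule has_sum_finiteI) (simp_all add: add.assoc)
  qed
qed

lemma has_sum_int_halves:
  fixes f :: "int \<Rightarrow> complex"
  assumes "(f has_sum s) UNIV"
  shows "((\<lambda>n. f (int n) + f (- 1 - int n)) has_sum s) UNIV"
proof -
  have bij: "bij_betw (\<lambda>(n, b). if b then int n else - 1 - int n) (UNIV \<times> UNIV) (UNIV :: int set)"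
    by (rule bij_betwI[where g = "\<lambda>k. if 0 \<le> k then (nat k, True) else (nat (- 1 - k), False)"]) (auto split: if_splits)
  have "((\<lambda>p. f (case p of (n, b) \<Rightarrow> if b then int n else - 1 - int n)) has_sum s) (UNIV \<times> UNIV)"
    using assms has_sum_reindex_bij_betw[OF bij, of f s] by simp
  then show ?thesis
  proof (rule has_sum_SigmaD)
    fix n :: nat
    show "((\<lambda>b. f (case (n, b) of (n, b) \<Rightarrow> if b then int n else - 1 - int n)) has_sum f (int n) + f (- 1 - int n)) UNIV"
      by (rule has_sum_finiteI) (simp_all add: UNIV_bool add.commute)
  qed
qed

lemma has_sum_int_fold:
  fixes f :: "int \<Rightarrow> complex"
  assumes "(f has_sum s) UNIV"
  shows "((\<lambda>n. if n = 0 then 0 else f (int n) + f (- int n)) has_sum s - f 0) UNIV"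
proof -
  have bij: "bij_betw (\<lambda>(n, b). if b then int n else - int n) ({1..} \<times> UNIV) (UNIV - {0} :: int set)"
    by (rule bij_betwI[where g = "\<lambda>k. (nat \<bar>k\<bar>, 0 \<le> k)"]) (auto split: if_splits)
  obtain t where t: "(f has_sum t) (UNIV - {0})"
    using summable_on_subset[of f UNIV "UNIV - {0}"] assms by (auto simp: summable_on_def)
  have "(f has_sum f 0 + t) UNIV"
    using has_sum_insert[OF _ t, of 0] by (simp add: insert_absorb)
  then have "f 0 + t = s" using assms has_sum_unique by blast
  then have ts: "t = s - f 0" by auto
  have "((\<lambda>p. f (case p of (n, b) \<Rightarrow> if b then int n else - int n)) has_sum t) ({1..} \<times> UNIV)"
    using t has_sum_reindex_bij_betw[OF bij, of f t] by simp
  then have "((\<lambda>n. f (int n) + f (- int n)) has_sum t) {1..}"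
  proof (rule has_sum_SigmaD)
    fix n :: nat
    show "((\<lambda>b. f (case (n, b) of (n, b) \<Rightarrow> if b then int n else - int n)) has_sum f (int n) + f (- int n)) UNIV"
      by (rule has_sum_finiteI) (simp_all add: UNIV_bool add.commute)
  qed
  then show ?thesis unfolding ts
    by (rule has_sum_cong_neutral[THEN iffD1, rotated -1]) auto
qed

text \<open>Passing from \<open>k\<close> to \<open>k + 1\<close> adds the nonconstant terms of a theta function that vanishes,
  so the sum over \<open>n\<close> is linear in \<open>k\<close>.\<close>

definition hterm :: "complex \<Rightarrow> int \<Rightarrow> nat \<Rightarrow> complex" where
  "hterm x k n = (- 1) ^ n * x powi tri (int n + 1) * (x powi (- (int n * k)) - x powi (int n * k)) / (1 - x ^ n)"

text \<open>With u = x^(nk) and y = x^n, the numerator changes by (1 - y)(u + 1/(u y)). The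
  denominator cancels, and the terms of a theta series at \<open>n\<close> and \<open>-n\<close>
  remain.\<close>

lemma hterm_step:
  assumes x: "x \<noteq> 0" "norm x < 1"
  shows "hterm x (k + 1) n = hterm x k n + (if n = 0 then 0 else
    jterm (x powi (k + 1)) x (int n) + jterm (x powi (k + 1)) x (- int n))"
proof (cases "n = 0")
  case False
  define y where "y = x ^ n"
  define u where "u = x powi (int n * k)"
  have nz: "1 - y \<noteq> 0" using one_minus_power_nonzero[OF x(2), of n] False by (simp add: y_def)
  have y: "y \<noteq> 0" and u: "u \<noteq> 0" using x by (simp_all add: y_def u_def)
  have p1: "x powi (int n * (k + 1)) = u * y"
    using x by (simp add: u_def y_def power_int_add ring_distribs)
  have p: "x powi (int n * (k + 1)) = u * y" "x powi (- (int n * (k + 1))) = 1 / (u * y)" "x powi (- (int n * k)) = 1 / u"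
    unfolding power_int_minus p1 u_def[symmetric] inverse_eq_divide by (rule refl)+
  define a where "a = (- 1) ^ n * x powi tri (int n + 1)"
  have sgn: "(- 1 :: complex) powi int n = (- 1) ^ n" by simp
  have j1: "jterm (x powi (k + 1)) x (int n) = a * u"
  proof -
    have "jterm (x powi (k + 1)) x (int n) = (- 1) ^ n * x powi ((k + 1) * int n + tri (int n))"
      using jterm_power[OF x(1), of 1 "k + 1" 1 "int n"] by simp
    also have "(k + 1) * int n + tri (int n) = tri (int n + 1) + int n * k"
      using tri_Suc[of "int n"] by (simp add: algebra_simps)
    finally show ?thesis using x by (simp add: a_def u_def power_int_add)
  qed
  have j2: "jterm (x powi (k + 1)) x (- int n) = a / (u * y)"
  proof -
    have "jterm (x powi (k + 1)) x (- int n) = (- 1) ^ n * x powi ((k + 1) * (- int n) + tri (- int n))"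
      using jterm_power[OF x(1), of 1 "k + 1" 1 "- int n"] neg_one_powi(2)[of "int n"] by simp
    also have "(k + 1) * (- int n) + tri (- int n) = tri (int n + 1) + - (int n * (k + 1))"
      using tri_Suc[of "int n"] tri_minus[of "int n"] by (simp add: algebra_simps)
    also have "x powi \<dots> = x powi tri (int n + 1) * x powi (- (int n * (k + 1)))"
      by (rule power_int_add) (use x in auto)
    finally show ?thesis by (simp add: a_def p)
  qed
  have "a * (1 / (u * y) - u * y) / (1 - y) = a * (1 / u - u) / (1 - y) + (a * u + a / (u * y))"
    using nz y u by (simp add: field_simps)
  then show ?thesis
    using False unfolding hterm_def a_def[symmetric] y_def[symmetric] p u_def[symmetric] j1 j2 by simp
qed (simp add: hterm_def)

text \<open>The theta series of \<open>hterm_step\<close> vanishes, its argument being a power of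
  the base. Its term of index 0 is 1 and is absent from the increments, so each step of
  \<open>k\<close> adds -1, starting from 0 at \<open>k = 0\<close> and going in both
  directions.\<close>

lemma hterm_sum:
  assumes x: "x \<noteq> 0" "norm x < 1"
  shows "(hterm x k has_sum - of_int k) UNIV"
proof -
  define d where "d k n = (if n = 0 then 0 else jterm (x powi (k + 1)) x (int n) + jterm (x powi (k + 1)) x (- int n))" for k n
  have d: "(d k has_sum - 1) UNIV" for k
  proof -
    have "(jterm (x powi (k + 1)) x has_sum 0) UNIV"
      using jt_has_sum[OF x, of "x powi (k + 1)"] jt_power[OF x, of "k + 1"] x by simp
    from has_sum_int_fold[OF this] show ?thesis
      unfolding d_def[abs_def] by (simp add: jterm_def tri_def)
  qed
  have st: "hterm x (k + 1) n = hterm x k n + d k n" for k n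
    unfolding d_def by (rule hterm_step[OF x])
  show ?thesis
  proof (induction k rule: int_induct[where k = 0])
    case base
    show ?case by (simp add: hterm_def)
  next
    case (step1 k)
    have "((\<lambda>n. hterm x k n + d k n) has_sum - of_int k + - 1) UNIV"
      by (intro has_sum_add step1 d)
    then show ?case unfolding st[symmetric] by (simp add: algebra_simps)
  next
    case (step2 k)
    have "((\<lambda>n. hterm x k n - d (k - 1) n) has_sum - of_int k - - 1) UNIV"
      by (intro has_sum_diff step2 d)
    moreover have "hterm x k n - d (k - 1) n = hterm x (k - 1) n" for n
      using st[of "k - 1" n] by simp
    ultimately show ?case by (simp add: algebra_simps)
  qed
qed

lemma summable_geometric_abs_int: "0 \<le> s \<Longrightarrow> s < (1::real) \<Longrightarrow> (\<lambda>k. s ^ nat \<bar>k\<bar>) summable_on UNIV"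
  by (rule summable_on_intI) (auto intro!: summable_nonneg_imp_summable_on summable_geometric)

section \<open>A double series summed in two orders\<close>

lemma abs_summable_double:
  assumes x: "x \<noteq> 0" "norm x < 1"
  shows "(\<lambda>(n, k). norm (x powi (k + 3 * tri k) * hterm x k n)) summable_on UNIV \<times> UNIV"
proof -
  define r where "r = norm x"
  define s where "s = root 12 r"
  have r: "0 < r" "r < 1" using x by (simp_all add: r_def)
  have s: "0 < s" "s < 1" "s ^ 12 = r" using r by (simp_all add: s_def)
  \<comment> \<open>The negative powers in \<open>hterm\<close> could spoil convergence, but 12
    times the total exponent is (2n - 3|k|)^2 + 2n^2 + 9k^2 + 6n - 6k. The factor 12 clears
    fractions and leaves room for n + |k|, which is why \<open>s\<close> is a 12th root of
    |x|.\<close>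
  have ineq: "int n + \<bar>k\<bar> \<le> 12 * (k + 3 * tri k + tri (int n + 1) - int n * \<bar>k\<bar>)" for n k
  proof -
    define m where "m = \<bar>k\<bar>"
    define N where "N = int n"
    have m: "0 \<le> m" "k \<le> m" "m * m = k * k" by (auto simp: m_def abs_if)
    have N: "0 \<le> N" by (simp add: N_def)
    have "12 * (k + 3 * tri k + tri (N + 1) - N * m) = 18 * (k * k) - 6 * k + 6 * (N * N) + 6 * N - 12 * (N * m)"
      using two_tri[of k] two_tri[of "N + 1"] by (simp add: algebra_simps)
    also have "\<dots> = (2 * N - 3 * m) * (2 * N - 3 * m) + 2 * (N * N) + 9 * (m * m) + 6 * N - 6 * k"
      using m(3) by (simp add: algebra_simps)
    also have "\<dots> \<ge> N + m"
    proof -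
      have "0 \<le> (2 * N - 3 * m) * (2 * N - 3 * m)" "0 \<le> N * N" by simp_all
      moreover have "m \<le> m * m" using m(1) by (cases "m = 0") (auto simp: mult_le_cancel_left1)
      ultimately show ?thesis using m N by linarith
    qed
    finally show ?thesis by (simp only: m_def N_def)
  qed
  have bound: "norm (x powi (k + 3 * tri k) * hterm x k n) \<le> (2 / (1 - r) * s ^ n) * s ^ nat \<bar>k\<bar>" for n k
  proof (cases "n = 0")
    case True
    then show ?thesis using s r by (simp add: hterm_def)
  next
    case False
    have "norm (x ^ n) \<le> r ^ 1"
      unfolding norm_power r_def[symmetric] by (rule power_decreasing) (use r False in auto)
    then have den: "1 - r \<le> norm (1 - x ^ n)"
      using norm_triangle_ineq2[of 1 "x ^ n"] by simp
    have pw: "r powi j \<le> r powi (- (int n * \<bar>k\<bar>))" if "- (int n * \<bar>k\<bar>) \<le> j" for j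
      by (rule power_int_decreasing) (use that r in auto)
    have "\<bar>int n * k\<bar> = int n * \<bar>k\<bar>" by (simp add: abs_mult)
    then have "norm (x powi (- (int n * k)) - x powi (int n * k)) \<le> 2 * r powi (- (int n * \<bar>k\<bar>))"
      using norm_triangle_ineq4[of "x powi (- (int n * k))" "x powi (int n * k)"]
        pw[of "- (int n * k)"] pw[of "int n * k"] unfolding norm_power_int r_def[symmetric] by linarith
    then have num: "norm (x powi (- (int n * k)) - x powi (int n * k)) / norm (1 - x ^ n) \<le>
        2 * r powi (- (int n * \<bar>k\<bar>)) / (1 - r)"
      by (intro frac_le den) (use r in auto)
    have "norm (x powi (k + 3 * tri k) * hterm x k n) = (r powi (k + 3 * tri k) * r powi tri (int n + 1)) *
       (norm (x powi (- (int n * k)) - x powi (int n * k)) / norm (1 - x ^ n))"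
      by (simp add: hterm_def norm_mult norm_divide norm_power norm_power_int r_def)
    also have "\<dots> \<le> (r powi (k + 3 * tri k) * r powi tri (int n + 1)) * (2 * r powi (- (int n * \<bar>k\<bar>)) / (1 - r))"
      by (intro mult_left_mono num) (use r in auto)
    also have "\<dots> = 2 / (1 - r) * r powi (k + 3 * tri k + tri (int n + 1) - int n * \<bar>k\<bar>)"
      using r by (simp add: power_int_add power_int_diff power_int_minus divide_inverse)
    also have "\<dots> \<le> 2 / (1 - r) * (s ^ n * s ^ nat \<bar>k\<bar>)"
    proof (rule mult_left_mono)
      have "r powi (k + 3 * tri k + tri (int n + 1) - int n * \<bar>k\<bar>) =
          s powi (12 * (k + 3 * tri k + tri (int n + 1) - int n * \<bar>k\<bar>))"
        unfolding s(3)[symmetric] by (simp only: power_int_mult power_int_numeral)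
      also have "\<dots> \<le> s powi (int n + \<bar>k\<bar>)"
        by (rule power_int_decreasing) (use ineq s in auto)
      also have "s powi (int n + \<bar>k\<bar>) = s ^ n * s ^ nat \<bar>k\<bar>"
        using s power_int_of_nat[of s "nat \<bar>k\<bar>"] by (simp add: power_int_add)
      finally show "r powi (k + 3 * tri k + tri (int n + 1) - int n * \<bar>k\<bar>) \<le> s ^ n * s ^ nat \<bar>k\<bar>" .
    qed (use r in simp)
    finally show ?thesis by (simp only: mult.assoc)
  qed
  have "((\<lambda>n. s ^ n) has_sum 1 / (1 - s)) UNIV"
    using s by (intro sums_nonneg_imp_has_sum geometric_sums) auto
  then have sn: "(\<lambda>n. 2 / (1 - r) * s ^ n) summable_on UNIV"
    by (intro summable_on_cmult_right) (auto simp: summable_on_def)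
  obtain c where c: "((\<lambda>k. s ^ nat \<bar>k\<bar>) has_sum c) UNIV"
    using summable_geometric_abs_int[of s] s by (auto simp: summable_on_def)
  have "(\<lambda>(n, k). (2 / (1 - r) * s ^ n) * s ^ nat \<bar>k\<bar>) summable_on UNIV \<times> UNIV"
  proof (rule summable_on_SigmaI)
    show "((\<lambda>k. case (n, k) of (n, k) \<Rightarrow> (2 / (1 - r) * s ^ n) * s ^ nat \<bar>k\<bar>) has_sum (2 / (1 - r) * s ^ n) * c) UNIV" for n
      unfolding prod.case by (intro has_sum_cmult_right c)
    show "(\<lambda>n. (2 / (1 - r) * s ^ n) * c) summable_on UNIV"
      by (intro summable_on_cmult_left sn)
  qed (use r s in auto)
  then show ?thesis
    by (rule summable_on_comparison_test) (use bound in auto)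
qed

text \<open>One family containing \<open>thJ\<close> at \<open>b = 0\<close> and \<open>thP\<close>
  at \<open>b = 1\<close> and \<open>b = 2\<close>; every other \<open>b\<close> reduces to these by
  steps of 3.\<close>

definition theta3 :: "complex \<Rightarrow> int \<Rightarrow> complex" where
  "theta3 x b = jt (- (x powi b)) (x ^ 3)"

lemma theta3_shift:
  assumes x: "x \<noteq> 0" "norm x < 1"
  shows "theta3 x (b + 3 * a) = x powi (- (b * a) - 3 * tri a) * theta3 x b"
proof -
  have n: "x ^ 3 \<noteq> 0" "norm (x ^ 3) < 1" using x by (auto intro!: norm_pow_less_1)
  have "- (x powi (b + 3 * a)) = - (x powi b) * (x ^ 3) powi a"
    using x power_int_mult[of x 3 a] by (simp add: power_int_add)
  moreover have "(x powi b) powi (- a) = x powi (- (b * a))" using power_int_mult[of x b "- a"] by simp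
  moreover have "(x ^ 3) powi (- tri a) = x powi (- (3 * tri a))" using power_int_mult[of x 3 "- tri a"] by simp
  moreover have "x powi (- (b * a) - 3 * tri a) = x powi (- (b * a)) * x powi (- (3 * tri a))"
    using x by (simp add: power_int_diff power_int_minus divide_inverse)
  ultimately show ?thesis
    unfolding theta3_def using jt_shift[OF n, of "- (x powi b)" a] x by simp
qed

lemma theta3_values:
  assumes x: "x \<noteq> 0" "norm x < 1"
  shows "theta3 x 0 = thJ x" "theta3 x 1 = thP x" "theta3 x 2 = thP x" "theta3 x (- 1) = thP x / x"
proof -
  have n: "x ^ 3 \<noteq> 0" "norm (x ^ 3) < 1" using x by (auto intro!: norm_pow_less_1)
  show "theta3 x 0 = thJ x" "theta3 x 1 = thP x" by (simp_all add: theta3_def thJ_def thP_def)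
  have "x ^ 3 / (- x) = - (x\<^sup>2)" using x by (simp add: power3_eq_cube power2_eq_square)
  then show "theta3 x 2 = thP x"
    using jt_swap[OF n(1), of "- x"] by (simp add: theta3_def thP_def)
  show "theta3 x (- 1) = thP x / x"
    using jt_inverse[OF n, of "- x"] x by (simp add: theta3_def thP_def power_int_minus inverse_eq_divide)
qed

text \<open>This is the sum over \<open>k\<close> of
  \<open>x powi (k + 3 * tri k) * hterm x k n\<close>: each of the two powers in
  \<open>hterm\<close> only moves the argument of a theta series. The value at \<open>n = 0\<close>
  is 0/0, hence 0.\<close>

definition lterm :: "complex \<Rightarrow> nat \<Rightarrow> complex" where
  "lterm x n = (- 1) ^ n * x powi tri (int n + 1) * (theta3 x (1 - int n) - theta3 x (1 + int n)) / (1 - x ^ n)"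

text \<open>Summing the double series over \<open>n\<close> first gives -k for each \<open>k\<close>
  by \<open>hterm_sum\<close>; summing over \<open>k\<close> first gives
  \<open>lterm\<close>.\<close>

lemma lterm_sum:
  assumes x: "x \<noteq> 0" "norm x < 1"
  assumes u: "((\<lambda>k. of_int k * x powi (k + 3 * tri k)) has_sum u) UNIV"
  shows "(lterm x has_sum - u) UNIV"
proof -
  have n: "x ^ 3 \<noteq> 0" "norm (x ^ 3) < 1" using x by (auto intro!: norm_pow_less_1)
  define f where "f = (\<lambda>(n, k). x powi (k + 3 * tri k) * hterm x k n)"
  have "(\<lambda>p. norm (f p)) summable_on UNIV \<times> UNIV"
    using abs_summable_double[OF x] by (simp add: f_def case_prod_unfold)
  then have "f summable_on UNIV \<times> UNIV" by (rule abs_summable_summable)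
  then obtain t where t: "(f has_sum t) (UNIV \<times> UNIV)" by (auto simp: summable_on_def)
  have "((\<lambda>(k, n). f (n, k)) has_sum t) (UNIV \<times> UNIV)" using t by (subst (asm) has_sum_swap)
  then have "((\<lambda>k. x powi (k + 3 * tri k) * - of_int k) has_sum t) UNIV"
  proof (rule has_sum_SigmaD)
    fix k :: int
    show "((\<lambda>n. case (k, n) of (k, n) \<Rightarrow> f (n, k)) has_sum x powi (k + 3 * tri k) * - of_int k) UNIV"
      unfolding f_def prod.case by (intro has_sum_cmult_right hterm_sum x)
  qed
  moreover have "((\<lambda>k. - (of_int k * x powi (k + 3 * tri k))) has_sum - u) UNIV"
    by (rule has_sum_uminusI[OF u])
  ultimately have tu: "t = - u" by (simp add: mult.commute) (metis has_sum_unique)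
  from t have "(lterm x has_sum t) UNIV"
  proof (rule has_sum_SigmaD)
    fix n' :: nat
    have th: "((\<lambda>k. x powi (k + 3 * tri k) * x powi (c * k)) has_sum theta3 x (1 + c)) UNIV" for c
    proof -
      have "jterm (- (x powi (1 + c))) (x ^ 3) k = x powi (k + 3 * tri k) * x powi (c * k)" for k
        using jterm_power[OF x(1), of "- 1" "1 + c" 3 k] x by (simp add: algebra_simps power_int_add)
      then have e: "jterm (- (x powi (1 + c))) (x ^ 3) = (\<lambda>k. x powi (k + 3 * tri k) * x powi (c * k))"
        by (rule ext)
      show ?thesis
        using jt_has_sum[OF n, of "- (x powi (1 + c))"] x unfolding theta3_def e by simp
    qed
    have "((\<lambda>k. (- 1) ^ n' * x powi tri (int n' + 1) / (1 - x ^ n') * (x powi (k + 3 * tri k) * x powi (- int n' * k)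
         - x powi (k + 3 * tri k) * x powi (int n' * k))) has_sum
        (- 1) ^ n' * x powi tri (int n' + 1) / (1 - x ^ n') * (theta3 x (1 + - int n') - theta3 x (1 + int n'))) UNIV"
      by (intro has_sum_cmult_right has_sum_diff th)
    then show "((\<lambda>k. f (n', k)) has_sum lterm x n') UNIV"
      by (simp add: f_def hterm_def lterm_def algebra_simps diff_divide_distrib)
  qed
  then show ?thesis by (simp add: tu)
qed

lemma tri_quad: "2 * tri (a * int m + b) = a * a * (int m * int m) + (2 * a * b - a) * int m + b * (b - 1)"
  using two_tri[of "a * int m + b"] by (simp add: algebra_simps)

lemma powi_nat_cong: "i = int n \<Longrightarrow> x powi i = x ^ n"
  by simp

text \<open>In this lemma and the next two, the arguments 1 - n and 1 + n are reduced modulo 3: to 1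
  and 1 for n = 3m, to 0 and 2 for n = 3m+1, to -1 and 0 for n = 3m+2. At \<open>m = 0\<close> both
  sides here are 0 through division by 0.\<close>

lemma lterm_0:
  assumes x: "x \<noteq> 0" "norm x < 1"
  shows "lterm x (3 * m) = thP x * ((- 1) ^ m * (x ^ (3 * m * m + m) - x ^ (3 * m * m + 2 * m)) / (1 - x ^ (3 * m)))"
proof -
  have 1: "theta3 x (1 - int (3 * m)) = x powi (int m - 3 * tri (- int m)) * thP x"
    using theta3_shift[OF x, of 1 "- int m"] theta3_values[OF x] by simp
  have 2: "theta3 x (1 + int (3 * m)) = x powi (- int m - 3 * tri (int m)) * thP x"
    using theta3_shift[OF x, of 1 "int m"] theta3_values[OF x] by simp
  have e1: "x powi tri (int (3 * m) + 1) * x powi (int m - 3 * tri (- int m)) = x ^ (3 * m * m + m)"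
    by (subst power_int_add[symmetric], (use x in simp), rule powi_nat_cong)
      (use tri_quad[of 3 m 1] two_tri[of "int m"] tri_minus[of "int m"] in \<open>simp add: algebra_simps\<close>)
  have e2: "x powi tri (int (3 * m) + 1) * x powi (- int m - 3 * tri (int m)) = x ^ (3 * m * m + 2 * m)"
    by (subst power_int_add[symmetric], (use x in simp), rule powi_nat_cong)
      (use tri_quad[of 3 m 1] two_tri[of "int m"] in \<open>simp add: algebra_simps\<close>)
  have s: "(- 1 :: complex) ^ (3 * m) = (- 1) ^ m" by (simp add: power_mult)
  show ?thesis
    unfolding lterm_def 1 2 s e1[symmetric] e2[symmetric] by (simp add: algebra_simps)
qed

lemma lterm_1:
  assumes x: "x \<noteq> 0" "norm x < 1"
  shows "lterm x (3 * m + 1) = thP x * ((- 1) ^ m * x ^ (3 * m * m + 4 * m + 1) / (1 - x ^ (3 * m + 1)))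
     - x * thJ x * ((- 1) ^ m * x ^ (3 * m * m + 3 * m) / (1 - x ^ (3 * m + 1)))"
proof -
  have 1: "theta3 x (1 - int (3 * m + 1)) = x powi (- (3 * tri (- int m))) * thJ x"
    using theta3_shift[OF x, of 0 "- int m"] theta3_values[OF x] by simp
  have 2: "theta3 x (1 + int (3 * m + 1)) = x powi (- (2 * int m) - 3 * tri (int m)) * thP x"
    using theta3_shift[OF x, of 2 "int m"] theta3_values[OF x] by (simp add: algebra_simps)
  have e1: "x powi tri (int (3 * m + 1) + 1) * x powi (- (3 * tri (- int m))) = x ^ Suc (3 * m * m + 3 * m)"
    by (subst power_int_add[symmetric], (use x in simp), rule powi_nat_cong)
      (use tri_quad[of 3 m 2] two_tri[of "int m"] tri_minus[of "int m"] in \<open>simp add: algebra_simps\<close>)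
  have e2: "x powi tri (int (3 * m + 1) + 1) * x powi (- (2 * int m) - 3 * tri (int m)) = x ^ (3 * m * m + 4 * m + 1)"
    by (subst power_int_add[symmetric], (use x in simp), rule powi_nat_cong)
      (use tri_quad[of 3 m 2] two_tri[of "int m"] in \<open>simp add: algebra_simps\<close>)
  have s: "(- 1 :: complex) ^ (3 * m + 1) = - ((- 1) ^ m)" by (simp add: power_mult)
  have "lterm x (3 * m + 1) = thP x * ((- 1) ^ m * (x ^ (3 * m * m + 4 * m + 1)) / (1 - x ^ (3 * m + 1)))
     - thJ x * ((- 1) ^ m * (x ^ Suc (3 * m * m + 3 * m)) / (1 - x ^ (3 * m + 1)))"
    unfolding lterm_def 1 2 s e1[symmetric] e2[symmetric] by (simp add: algebra_simps diff_divide_distrib)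
  then show ?thesis by simp
qed

lemma lterm_2:
  assumes x: "x \<noteq> 0" "norm x < 1"
  shows "lterm x (3 * m + 2) = thP x * ((- 1) ^ m * x ^ (3 * m * m + 5 * m + 2) / (1 - x ^ (3 * m + 2)))
     - x * thJ x * ((- 1) ^ m * x ^ (3 * m * m + 6 * m + 2) / (1 - x ^ (3 * m + 2)))"
proof -
  have 1: "theta3 x (1 - int (3 * m + 2)) = x powi (- int m - 3 * tri (- int m) - 1) * thP x"
    using theta3_shift[OF x, of "- 1" "- int m"] theta3_values[OF x] x by (simp add: power_int_diff)
  have 2: "theta3 x (1 + int (3 * m + 2)) = x powi (- (3 * tri (int m + 1))) * thJ x"
    using theta3_shift[OF x, of 0 "int m + 1"] theta3_values[OF x] by (simp add: algebra_simps)
  have e1: "x powi tri (int (3 * m + 2) + 1) * x powi (- int m - 3 * tri (- int m) - 1) = x ^ (3 * m * m + 5 * m + 2)"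
    by (subst power_int_add[symmetric], (use x in simp), rule powi_nat_cong)
      (use tri_quad[of 3 m 3] two_tri[of "int m"] tri_minus[of "int m"] in \<open>simp add: algebra_simps\<close>)
  have e2: "x powi tri (int (3 * m + 2) + 1) * x powi (- (3 * tri (int m + 1))) = x ^ Suc (3 * m * m + 6 * m + 2)"
    by (subst power_int_add[symmetric], (use x in simp), rule powi_nat_cong)
      (use tri_quad[of 3 m 3] two_tri[of "int m"] tri_Suc[of "int m"] in \<open>simp add: algebra_simps\<close>)
  have s: "(- 1 :: complex) ^ (3 * m + 2) = (- 1) ^ m" by (simp add: power_mult)
  have "lterm x (3 * m + 2) = thP x * ((- 1) ^ m * (x ^ (3 * m * m + 5 * m + 2)) / (1 - x ^ (3 * m + 2)))
     - thJ x * ((- 1) ^ m * (x ^ Suc (3 * m * m + 6 * m + 2)) / (1 - x ^ (3 * m + 2)))"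
    unfolding lterm_def 1 2 s e1[symmetric] e2[symmetric] by (simp add: algebra_simps diff_divide_distrib)
  then show ?thesis by simp
qed

section \<open>The Lambert-type sums in each residue class\<close>

text \<open>\<open>aterm\<close> and \<open>bterm\<close> are the parts of three consecutive
  \<open>sterm\<close> with exponents 0 and 2 modulo 3, written in x = q^3. The same two
  combinations arise from \<open>lterm\<close>, which is what makes the linear relation
  useful.\<close>

definition aterm :: "complex \<Rightarrow> nat \<Rightarrow> complex" where
  "aterm x m = (- 1) ^ m * (x ^ (3 * m * m + m) - x ^ (3 * m * m + 2 * m)) / (1 - x ^ (3 * m))
     + (- 1) ^ m * x ^ (3 * m * m + 4 * m + 1) / (1 - x ^ (3 * m + 1))
     + (- 1) ^ m * x ^ (3 * m * m + 5 * m + 2) / (1 - x ^ (3 * m + 2))"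

definition bterm :: "complex \<Rightarrow> nat \<Rightarrow> complex" where
  "bterm x m = (- 1) ^ m * x ^ (3 * m * m + 3 * m) / (1 - x ^ (3 * m + 1))
     + (- 1) ^ m * x ^ (3 * m * m + 6 * m + 2) / (1 - x ^ (3 * m + 2))"

text \<open>The part of \<open>bterm\<close> that the reciprocal theta series does not account
  for.\<close>

definition yterm :: "complex \<Rightarrow> nat \<Rightarrow> complex" where
  "yterm x m = (- 1) ^ m * x ^ (3 * m * m + 6 * m) / (1 - x ^ (6 * m + 2))
     + (- 1) ^ m * x ^ (3 * m * m + 6 * m + 1) / (1 - x ^ (6 * m + 4))"

text \<open>The summand of the series in the overview; at \<open>n = 0\<close> it is 0/0, hence
  0.\<close>

definition sterm :: "complex \<Rightarrow> nat \<Rightarrow> complex" where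
  "sterm q n = (- 1) ^ n * (q ^ (n * n + n) - q ^ (n * n + 2 * n)) / (1 - q ^ (3 * n))"

lemma lterm_dissection:
  assumes x: "x \<noteq> 0" "norm x < 1"
  shows "lterm x (3 * m) + lterm x (3 * m + 1) + lterm x (3 * m + 2) = thP x * aterm x m - x * thJ x * bterm x m"
  unfolding lterm_0[OF x] lterm_1[OF x] lterm_2[OF x] aterm_def bterm_def
  by (simp only: ring_distribs) simp

lemma sterm_dissection:
  "sterm q (3 * m) + sterm q (3 * m + 1) + sterm q (3 * m + 2) = aterm (q ^ 3) m - q\<^sup>2 * bterm (q ^ 3) m"
proof -
  have s: "(- 1 :: complex) ^ (3 * m) = (- 1) ^ m" "(- 1 :: complex) ^ (3 * m + 1) = - ((- 1) ^ m)"
    "(- 1 :: complex) ^ (3 * m + 2) = (- 1) ^ m" by (simp_all add: power_mult)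
  have e: "q ^ (3 * m * (3 * m) + 3 * m) = (q ^ 3) ^ (3 * m * m + m)"
    "q ^ (3 * m * (3 * m) + 2 * (3 * m)) = (q ^ 3) ^ (3 * m * m + 2 * m)"
    "q ^ ((3 * m + 1) * (3 * m + 1) + (3 * m + 1)) = q\<^sup>2 * (q ^ 3) ^ (3 * m * m + 3 * m)"
    "q ^ ((3 * m + 1) * (3 * m + 1) + 2 * (3 * m + 1)) = (q ^ 3) ^ (3 * m * m + 4 * m + 1)"
    "q ^ ((3 * m + 2) * (3 * m + 2) + (3 * m + 2)) = (q ^ 3) ^ (3 * m * m + 5 * m + 2)"
    "q ^ ((3 * m + 2) * (3 * m + 2) + 2 * (3 * m + 2)) = q\<^sup>2 * (q ^ 3) ^ (3 * m * m + 6 * m + 2)"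
    unfolding power_mult[symmetric] power_add[symmetric]
    by (rule arg_cong[where f = "\<lambda>n. q ^ n"], simp add: algebra_simps)+
  have d: "q ^ (3 * n) = (q ^ 3) ^ n" for n by (rule power_mult)
  have "c * (u - w) / v = - (- c * u / v) + - c * w / v" for c u v w :: complex
    by (simp add: algebra_simps diff_divide_distrib)
  show ?thesis
    unfolding sterm_def aterm_def bterm_def s e d
    by (simp only: right_diff_distrib distrib_left diff_divide_distrib times_divide_eq_right) (simp add: mult_ac)
qed

text \<open>With v = x^(3m+1) and v = x^(3m+2), writing 1/(1-v) as (1+v)/(1-v^2) gives four pieces
  with denominators 1 - x^(6m+2) and 1 - x^(6m+4). One piece of each kind belongs to a reciprocal
  theta series with base x^6.\<close>

lemma bterm_split:
  assumes x: "norm x < 1"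
  shows "bterm x m = ((- 1) ^ m * x ^ (3 * m * m + 3 * m) / (1 - x ^ (6 * m + 2))
     + (- 1) ^ m * x ^ (3 * m * m + 9 * m + 4) / (1 - x ^ (6 * m + 4))) + x * yterm x m"
proof -
  have fr: "a / (1 - v) = a / (1 - v\<^sup>2) + a * v / (1 - v\<^sup>2)" if "1 - v\<^sup>2 \<noteq> 0" for a v :: complex
  proof -
    have v: "1 - v\<^sup>2 = (1 - v) * (1 + v)" by (simp add: algebra_simps power2_eq_square)
    then have "1 - v \<noteq> 0" "1 + v \<noteq> 0" using that by auto
    then have "a / (1 - v) = a * (1 + v) / (1 - v\<^sup>2)" unfolding v by simp
    then show ?thesis by (simp add: distrib_left add_divide_distrib)
  qed
  have sq: "(x ^ (3 * m + 1))\<^sup>2 = x ^ (6 * m + 2)" "(x ^ (3 * m + 2))\<^sup>2 = x ^ (6 * m + 4)"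
    unfolding power_mult[symmetric] by (rule arg_cong[where f = "\<lambda>n. x ^ n"], simp)+
  have nz: "1 - x ^ (6 * m + 2) \<noteq> 0" "1 - x ^ (6 * m + 4) \<noteq> 0"
    by (rule one_minus_power_nonzero[OF x], simp)+
  have p: "x ^ (3 * m * m + 3 * m) * x ^ (3 * m + 1) = x * x ^ (3 * m * m + 6 * m)"
    "x ^ (3 * m * m + 6 * m + 2) * x ^ (3 * m + 2) = x ^ (3 * m * m + 9 * m + 4)"
    "x ^ (3 * m * m + 6 * m + 2) = x * x ^ (3 * m * m + 6 * m + 1)"
    unfolding power_add[symmetric] power_Suc[symmetric]
    by (rule arg_cong[where f = "\<lambda>n. x ^ n"], simp add: algebra_simps)+
  show ?thesis
    unfolding bterm_def yterm_def
    unfolding fr[of "x ^ (3 * m + 1)", unfolded sq, OF nz(1)] fr[of "x ^ (3 * m + 2)", unfolded sq, OF nz(2)]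
    unfolding mult.assoc[of "(- 1) ^ m"] p(1,2) unfolding p(3) by (simp only: distrib_left times_divide_eq_right mult_ac add_ac)
qed

text \<open>This is \<open>reciprocal_theta\<close> with base x^6 and argument x^2, the indices
  \<open>m\<close> and \<open>-1 - m\<close> being paired.\<close>

lemma reciprocal_halves:
  assumes x: "x \<noteq> 0" "norm x < 1"
  shows "((\<lambda>m. (- 1) ^ m * x ^ (3 * m * m + 3 * m) / (1 - x ^ (6 * m + 2))
     + (- 1) ^ m * x ^ (3 * m * m + 9 * m + 4) / (1 - x ^ (6 * m + 4))) has_sum eu (x ^ 6) ^ 3 / eu (x\<^sup>2)) UNIV"
proof -
  define Q where "Q = x ^ 6"
  have Q: "Q \<noteq> 0" "norm Q < 1" using x by (auto simp: Q_def intro!: norm_pow_less_1)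
  have pw: "x\<^sup>2 * Q powi k = x powi (2 + 6 * k)" for k
    using x power_int_mult[of x 6 k] by (simp add: Q_def power_int_add)
  have nz: "x\<^sup>2 * Q powi k \<noteq> 1" for k
  proof
    assume "x\<^sup>2 * Q powi k = 1"
    then have "norm (x powi (2 + 6 * k)) = 1" by (simp only: pw norm_one)
    then have *: "norm x powi (2 + 6 * k) = 1" by (simp only: norm_power_int)
    show False
    proof (cases "0 \<le> k")
      case True
      then have "norm x powi (2 + 6 * k) \<le> norm x powi 1" using x by (intro power_int_decreasing) auto
      then show False using * x by simp
    next
      case False
      then have "norm x powi (- 1) \<le> norm x powi (2 + 6 * k)" using x by (intro power_int_decreasing) auto
      then have "inverse (norm x) \<le> 1" using * by (simp add: power_int_minus)
      then show False using x by (simp add: inverse_le_1_iff)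
    qed
  qed
  have "jt (x\<^sup>2) Q = qp (x\<^sup>2) Q * qp (Q / x\<^sup>2) Q * eu Q" by (simp add: jt_def)
  then have pr: "eu (x\<^sup>2) = qp (x\<^sup>2) Q * qp (Q / x\<^sup>2) Q * eu Q"
    using jt_square_sixth(1)[OF x] by (simp add: Q_def)
  have e0: "eu (x\<^sup>2) \<noteq> 0" "eu Q \<noteq> 0" using x Q by (auto intro!: eu_nonzero norm_pow_less_1)
  have "(eu Q)\<^sup>2 / (qp (x\<^sup>2) Q * qp (Q / x\<^sup>2) Q) = eu Q ^ 3 / eu (x\<^sup>2)"
    using e0 unfolding pr by (simp add: field_simps power2_eq_square power3_eq_cube)
  then have "((\<lambda>k. jterm Q Q k / (1 - x\<^sup>2 * Q powi k)) has_sum eu Q ^ 3 / eu (x\<^sup>2)) UNIV"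
    using reciprocal_theta[OF Q _ nz] x by simp
  from has_sum_int_halves[OF this]
  have h: "((\<lambda>m. jterm Q Q (int m) / (1 - x\<^sup>2 * Q powi int m) +
        jterm Q Q (- 1 - int m) / (1 - x\<^sup>2 * Q powi (- 1 - int m))) has_sum eu Q ^ 3 / eu (x\<^sup>2)) UNIV" .
  have e: "jterm Q Q (int m) / (1 - x\<^sup>2 * Q powi int m) +
        jterm Q Q (- 1 - int m) / (1 - x\<^sup>2 * Q powi (- 1 - int m)) =
        (- 1) ^ m * x ^ (3 * m * m + 3 * m) / (1 - x ^ (6 * m + 2)) + (- 1) ^ m * x ^ (3 * m * m + 9 * m + 4) / (1 - x ^ (6 * m + 4))" for m
  proof -
    have j: "jterm Q Q k = (- 1) powi k * x powi (6 * k + 6 * tri k)" for k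
      using jterm_power[OF x(1), of 1 6 6 k] by (simp add: Q_def)
    have 1: "x powi (6 * int m + 6 * tri (int m)) = x ^ (3 * m * m + 3 * m)"
      by (rule powi_nat_cong) (use two_tri[of "int m"] in \<open>simp add: algebra_simps\<close>)
    have 2: "x powi (2 + 6 * int m) = x ^ (6 * m + 2)"
      by (rule powi_nat_cong) simp
    have 3: "x powi (6 * (- 1 - int m) + 6 * tri (- 1 - int m)) = x ^ (3 * m * m + 3 * m)"
      by (rule powi_nat_cong) (use tri_quad[of "- 1" m "- 1"] in \<open>simp add: algebra_simps\<close>)
    have 4: "x powi (2 + 6 * (- 1 - int m)) = inverse (x ^ (6 * m + 4))"
      unfolding power_int_of_nat[symmetric] power_int_minus[symmetric] by (rule powi_cong) simp
    have s: "(- 1 :: complex) powi int m = (- 1) ^ m" "(- 1 :: complex) powi (- 1 - int m) = - ((- 1) ^ m)"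
      using neg_one_powi(1)[of "- 1" "- int m"] neg_one_powi(2)[of 1] neg_one_powi(2)[of "int m"] by simp_all
    define y where "y = x ^ (6 * m + 4)"
    have y: "y \<noteq> 0" "1 - y \<noteq> 0" using x one_minus_power_nonzero[OF x(2), of "6 * m + 4"] by (simp_all add: y_def)
    have f: "- a / (1 - inverse y) = a * y / (1 - y)" for a
      using y by (simp add: field_simps)
    have py: "x ^ (3 * m * m + 3 * m) * y = x ^ (3 * m * m + 9 * m + 4)"
      unfolding y_def power_add[symmetric] by (rule arg_cong[where f = "\<lambda>n. x ^ n"]) (simp add: algebra_simps)
    show ?thesis
      unfolding pw j 1 2 3 4 s y_def[symmetric] py[symmetric]
      by (simp only: mult_minus_left f mult.assoc)
  qed
  show ?thesis using h unfolding e unfolding Q_def .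
qed

text \<open>With r = eu(x^2)/eu(x) one has thP = r thA, thJ = 2 r thB and r phi = eu, so the claim
  is the cubic relation multiplied by r^3.\<close>

lemma thE_value:
  assumes x: "x \<noteq> 0" "norm x < 1"
  shows "eu x ^ 3 * phi x = thA x * (thP x ^ 3 - x * thJ x ^ 3)"
proof -
  define r where "r = eu (x\<^sup>2) / eu x"
  have nz: "eu x \<noteq> 0" "eu (x\<^sup>2) \<noteq> 0" "eu (x ^ 3) \<noteq> 0" "eu (x ^ 6) \<noteq> 0"
    using x by (auto intro!: eu_nonzero norm_pow_less_1)
  have "thP x = r * thA x" "thJ x = 2 * r * thB x" "r * phi x = eu x"
    using nz x by (simp_all add: r_def thP_eq thA_eq thJ_eq thB_eq phi_eq power2_eq_square field_simps)
  then have "thA x * (thP x ^ 3 - x * thJ x ^ 3) = r ^ 3 * (thA x * (thA x ^ 3 - 8 * x * thB x ^ 3))"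
    and "eu x ^ 3 = r ^ 3 * phi x ^ 3"
    by (simp_all add: power_mult_distrib algebra_simps flip: power_mult_distrib[of r "phi x"])
  then show ?thesis unfolding thA_thB_cubic[OF x] by (simp add: power3_eq_cube power4_eq_xxxx)
qed

text \<open>The hypotheses express \<open>B\<close>, \<open>u\<close> and \<open>Th\<close> by
  \<open>A\<close>, \<open>P\<close>, \<open>J\<close> and \<open>E\<close>. The parameter
  \<open>ys\<close> may stay arbitrary, because 2B/A = J/P and q^3 = x match its two
  contributions.\<close>

lemma linear_identity:
  fixes A B P J E u Th ys q x :: complex
  assumes nz: "A \<noteq> 0" "P \<noteq> 0" "E \<noteq> 0"
    and PB: "2 * P * B = J * A"
    and E0: "(P - 6 * u) * E = A * (P ^ 3 - x * J ^ 3)"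
    and Th: "4 * E * Th = A * J\<^sup>2" and x: "q ^ 3 = x"
  shows "(A - 2 * q * B) * (P\<^sup>2 / E + q * (P * J / E) + q\<^sup>2 * (- (J\<^sup>2 / (2 * E)) - 6 * x * ys / A)) =
    1 + 6 * ((- u + x * J * (Th + x * ys)) / P) - 6 * q\<^sup>2 * (Th + x * ys)"
proof -
  have B: "B = J * A / (2 * P)" using PB nz by (simp add: field_simps)
  have T: "Th = A * J\<^sup>2 / (4 * E)" using Th nz by (simp add: field_simps)
  have U: "u = (P - A * (P ^ 3 - x * J ^ 3) / E) / 6" using E0 nz by (simp add: field_simps)
  show ?thesis unfolding B T U x[symmetric] using nz
    by (simp add: field_simps power2_eq_square power3_eq_cube)
qed

theorem phi_dissected_quotient:
  assumes q: "q \<noteq> 0" "norm q < 1" and s: "(sterm q has_sum s) UNIV"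
    and ys: "(yterm (q ^ 3) has_sum ys) UNIV"
  defines "x \<equiv> q ^ 3"
  shows "phi q * ((thP x)\<^sup>2 / eu (x\<^sup>2) + q * (thP x * thJ x / eu (x\<^sup>2))
      + q\<^sup>2 * (- ((thJ x)\<^sup>2 / (2 * eu (x\<^sup>2))) - 6 * x * ys / thA x)) = 1 + 6 * s"
proof -
  have x: "x \<noteq> 0" "norm x < 1" using q by (auto simp: x_def intro!: norm_pow_less_1)
  have n3: "x ^ 3 \<noteq> 0" "norm (x ^ 3) < 1" using x by (auto intro!: norm_pow_less_1)
  have nz: "eu x \<noteq> 0" "eu (x\<^sup>2) \<noteq> 0" "eu (x ^ 3) \<noteq> 0" "eu (x ^ 6) \<noteq> 0"
    using x by (auto intro!: eu_nonzero norm_pow_less_1)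
  have A0: "thA x \<noteq> 0" and P0: "thP x \<noteq> 0" using nz x by (simp_all add: thA_eq thP_eq)
  define Th where "Th = eu (x ^ 6) ^ 3 / eu (x\<^sup>2)"
  have b: "(bterm x has_sum Th + x * ys) UNIV"
    unfolding bterm_split[OF x(2), abs_def] Th_def
    by (intro has_sum_add has_sum_cmult_right reciprocal_halves x) (use ys in \<open>simp add: x_def\<close>)
  have jp: "jterm (- x) (x ^ 3) = (\<lambda>k. x powi (k + 3 * tri k))"
    using jterm_power[OF x(1), of "- 1" 1 3] by (simp add: fun_eq_iff)
  have P: "((\<lambda>k. x powi (k + 3 * tri k)) has_sum thP x) UNIV"
    using jt_has_sum[OF n3, of "- x"] x unfolding jp thP_def by simp
  obtain u where u: "((\<lambda>k. of_int k * x powi (k + 3 * tri k)) has_sum u) UNIV"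
    using abs_summable_summable[OF abs_summable_int_jterm[of "- x" "x ^ 3"]] x n3 unfolding jp
    by (auto simp: summable_on_def)
  \<comment> \<open>Reflection changes the weight 6k+1 to 1-6k on the exponents of
    \<open>thP\<close>, so the product for \<open>thE\<close> determines \<open>u\<close>.\<close>
  have e: "thE x (- k) = x powi (k + 3 * tri k) - 6 * (of_int k * x powi (k + 3 * tri k))" for k
  proof -
    have "3 * tri (- k) + 2 * (- k) = k + 3 * tri k" using tri_minus[of k] by simp
    then show ?thesis unfolding thE_def by (simp add: algebra_simps)
  qed
  have "((\<lambda>k. thE x (- k)) has_sum thP x - 6 * u) UNIV"
    unfolding e by (intro has_sum_diff has_sum_cmult_right P u)
  then have "thP x - 6 * u = eu x ^ 3 * phi x / eu (x\<^sup>2)"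
    unfolding has_sum_minus_int using thE_has_sum[OF x] has_sum_unique by blast
  then have E0: "(thP x - 6 * u) * eu (x\<^sup>2) = thA x * (thP x ^ 3 - x * thJ x ^ 3)"
    using nz thE_value[OF x] by simp
  have l: "((\<lambda>m. thP x * aterm x m - x * thJ x * bterm x m) has_sum - u) UNIV"
    using has_sum_nat_mod3[OF lterm_sum[OF x u]] unfolding lterm_dissection[OF x] .
  \<comment> \<open>Adding the known \<open>bterm\<close> sum back isolates \<open>aterm\<close> and
    yields its summability at the same time.\<close>
  have "((\<lambda>m. (thP x * aterm x m - x * thJ x * bterm x m) + x * thJ x * bterm x m) has_sum - u + x * thJ x * (Th + x * ys)) UNIV"
    by (intro has_sum_add l has_sum_cmult_right b)
  then have "((\<lambda>m. thP x * aterm x m) has_sum - u + x * thJ x * (Th + x * ys)) UNIV"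
    by simp
  then have a: "(aterm x has_sum (- u + x * thJ x * (Th + x * ys)) / thP x) UNIV"
    by (rule has_sum_divide_cancel) (rule P0)
  have "((\<lambda>m. aterm x m - q\<^sup>2 * bterm x m) has_sum s) UNIV"
    using has_sum_nat_mod3[OF s] unfolding sterm_dissection x_def .
  moreover have "((\<lambda>m. aterm x m - q\<^sup>2 * bterm x m) has_sum
      (- u + x * thJ x * (Th + x * ys)) / thP x - q\<^sup>2 * (Th + x * ys)) UNIV"
    by (intro has_sum_diff a has_sum_cmult_right b)
  ultimately have s: "s = (- u + x * thJ x * (Th + x * ys)) / thP x - q\<^sup>2 * (Th + x * ys)"
    by (rule has_sum_unique)
  have Th: "4 * eu (x\<^sup>2) * Th = thA x * (thJ x)\<^sup>2"
    using nz x by (simp add: Th_def thA_eq thJ_eq power2_eq_square power3_eq_cube field_simps)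
  have phi: "phi q = thA x - 2 * q * thB x"
    using phi_dissection[OF q] by (simp add: x_def)
  have "1 + 6 * s = 1 + 6 * ((- u + x * thJ x * (Th + x * ys)) / thP x) - 6 * q\<^sup>2 * (Th + x * ys)"
    unfolding s by (simp only: right_diff_distrib add_diff_eq mult.assoc)
  then show ?thesis
    using linear_identity[OF A0 P0 nz(2) thP_thB[OF x] E0 Th, of q ys] unfolding phi x_def by simp
qed

section \<open>Power series expansions and positivity\<close>

text \<open>The formal sum of the terms c(i) X^(e(i)). An arbitrary index type serves integers and
  pairs alike; fibres of \<open>e\<close> are required to be finite wherever a value is
  computed.\<close>

definition monomial_sum :: "('i \<Rightarrow> complex) \<Rightarrow> ('i \<Rightarrow> nat) \<Rightarrow> complex fps" where
  "monomial_sum c e = Abs_fps (\<lambda>n. \<Sum>i | e i = n. c i)"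

lemma monomial_sum:
  fixes c :: "'i \<Rightarrow> complex"
  assumes fin: "\<And>n. finite {i. e i = n}"
    and sm: "(\<lambda>i. norm (c i) * r ^ e i) summable_on UNIV" and q: "norm q \<le> r"
  shows "((\<lambda>i. c i * q ^ e i) has_sum eval_fps (monomial_sum c e) q) UNIV"
proof -
  have "(\<lambda>i. norm (c i * q ^ e i)) summable_on UNIV"
    by (rule summable_on_comparison_test[OF sm]) (use q in \<open>auto simp: norm_mult norm_power intro!: mult_left_mono power_mono\<close>)
  then have "(\<lambda>i. c i * q ^ e i) summable_on UNIV" by (rule abs_summable_summable)
  then obtain s where s: "((\<lambda>i. c i * q ^ e i) has_sum s) UNIV" by (auto simp: summable_on_def)
  have bij: "bij_betw snd (Sigma UNIV (\<lambda>n. {i. e i = n})) (UNIV :: 'i set)"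
    by (rule bij_betwI[where g = "\<lambda>i. (e i, i)"]) auto
  have "((\<lambda>p. c (snd p) * q ^ e (snd p)) has_sum s) (Sigma UNIV (\<lambda>n. {i. e i = n}))"
    using s has_sum_reindex_bij_betw[OF bij, of "\<lambda>i. c i * q ^ e i" s] by simp
  then have "((\<lambda>n. fps_nth (monomial_sum c e) n * q ^ n) has_sum s) UNIV"
  proof (rule has_sum_SigmaD)
    fix n
    show "((\<lambda>i. c (snd (n, i)) * q ^ e (snd (n, i))) has_sum fps_nth (monomial_sum c e) n * q ^ n) {i. e i = n}"
      by (rule has_sum_finiteI[OF fin]) (simp add: monomial_sum_def sum_distrib_right)
  qed
  then have "(\<lambda>n. fps_nth (monomial_sum c e) n * q ^ n) sums s" by (rule has_sum_imp_sums)
  then have "eval_fps (monomial_sum c e) q = s" by (simp add: eval_fps_def sums_iff)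
  with s show ?thesis by simp
qed

lemma monomial_sum_conv_radius:
  fixes c :: "'i \<Rightarrow> complex"
  assumes fin: "\<And>n. finite {i. e i = n}"
    and sm: "(\<lambda>i. norm (c i) * r ^ e i) summable_on UNIV" and r: "0 < r"
  shows "0 < fps_conv_radius (monomial_sum c e)"
proof -
  have bij: "bij_betw snd (Sigma UNIV (\<lambda>n. {i. e i = n})) (UNIV :: 'i set)"
    by (rule bij_betwI[where g = "\<lambda>i. (e i, i)"]) auto
  obtain s where s: "((\<lambda>i. norm (c i) * r ^ e i) has_sum s) UNIV" using sm by (auto simp: summable_on_def)
  have "((\<lambda>p. norm (c (snd p)) * r ^ e (snd p)) has_sum s) (Sigma UNIV (\<lambda>n. {i. e i = n}))"
    using s has_sum_reindex_bij_betw[OF bij, of "\<lambda>i. norm (c i) * r ^ e i" s] by simp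
  then have "((\<lambda>n. (\<Sum>i | e i = n. norm (c i)) * r ^ n) has_sum s) UNIV"
  proof (rule has_sum_SigmaD)
    fix n
    show "((\<lambda>i. norm (c (snd (n, i))) * r ^ e (snd (n, i))) has_sum (\<Sum>i | e i = n. norm (c i)) * r ^ n) {i. e i = n}"
      by (rule has_sum_finiteI[OF fin]) (simp add: sum_distrib_right)
  qed
  then have "summable (\<lambda>n. (\<Sum>i | e i = n. norm (c i)) * r ^ n)"
    by (rule has_sum_imp_sums[THEN sums_summable])
  then have "summable (\<lambda>n. fps_nth (monomial_sum c e) n * of_real r ^ n)"
    by (rule summable_comparison_test[rotated])
      (use r in \<open>auto intro!: exI[of _ 0] mult_right_mono norm_sum simp: monomial_sum_def norm_mult norm_power\<close>)
  then have "ereal (norm (of_real r :: complex)) \<le> fps_conv_radius (monomial_sum c e)"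
    unfolding fps_conv_radius_def by (rule conv_radius_geI)
  then show ?thesis using r by (simp add: less_le_trans[of 0 "ereal r"])
qed

section \<open>Series in x = q^3 and nonnegative coefficients\<close>

definition dilate3 :: "complex fps \<Rightarrow> complex fps" where
  "dilate3 F = F oo fps_X ^ 3"

lemma dilate3_nth: "fps_nth (dilate3 F) n = (if 3 dvd n then fps_nth F (n div 3) else 0)"
proof -
  have "fps_nth (dilate3 F) n = (\<Sum>i=0..n. fps_nth F i * (if n = 3 * i then 1 else 0))"
    by (simp add: dilate3_def fps_compose_nth power_mult[symmetric] fps_X_power_nth)
  also have "\<dots> = (\<Sum>i\<in>(if 3 dvd n then {n div 3} else {}). fps_nth F i * (if n = 3 * i then 1 else 0))"
    by (rule sum.mono_neutral_right) auto
  finally show ?thesis by auto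
qed

lemma dilate3_mult: "dilate3 (F * G) = dilate3 F * dilate3 G"
  by (simp add: dilate3_def fps_compose_mult_distrib)

lemma dilate3_sums:
  assumes "norm (q ^ 3) < fps_conv_radius F"
  shows "(\<lambda>n. fps_nth (dilate3 F) n * q ^ n) sums eval_fps F (q ^ 3)"
proof -
  have "(\<lambda>n. fps_nth F n * (q ^ 3) ^ n) sums eval_fps F (q ^ 3)"
    by (rule sums_eval_fps) (use assms in auto)
  then have "(\<lambda>n. fps_nth (dilate3 F) (3 * n) * q ^ (3 * n)) sums eval_fps F (q ^ 3)"
    by (simp add: dilate3_nth power_mult)
  then show ?thesis
    by (subst (asm) sums_mono_reindex) (auto simp: strict_mono_def dilate3_nth)
qed

lemma eval_dilate3: "norm (q ^ 3) < fps_conv_radius F \<Longrightarrow> eval_fps (dilate3 F) q = eval_fps F (q ^ 3)"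
  using dilate3_sums by (simp add: eval_fps_def sums_iff)

lemma dilate3_conv_radius:
  assumes "0 < fps_conv_radius F"
  shows "0 < fps_conv_radius (dilate3 F)"
proof -
  obtain r where r: "0 < r" "ereal r < fps_conv_radius F"
    using ereal_dense2[OF assms] by (metis ereal_less(2) less_ereal.simps(1) zero_ereal_def)
  define s where "s = min r 1"
  have s: "0 < s" "s \<le> 1" "s \<le> r" using r by (auto simp: s_def)
  then have "s ^ 3 \<le> s" by (simp add: power_le_one power3_eq_cube mult_le_one mult_left_le)
  then have "ereal (norm ((of_real s :: complex) ^ 3)) < fps_conv_radius F"
    using s r by (simp add: norm_power) (meson ereal_less_eq(3) le_less_trans order_trans)
  then have "summable (\<lambda>n. fps_nth (dilate3 F) n * of_real s ^ n)"
    by (rule dilate3_sums[THEN sums_summable])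
  then have "ereal (norm (of_real s :: complex)) \<le> fps_conv_radius (dilate3 F)"
    unfolding fps_conv_radius_def by (rule conv_radius_geI)
  then show ?thesis using s by (simp add: less_le_trans[of 0 "ereal s"])
qed

definition nonneg_fps :: "complex fps \<Rightarrow> bool" where
  "nonneg_fps F \<longleftrightarrow> (\<forall>n. fps_nth F n \<in> \<real>\<^sub>\<ge>\<^sub>0)"

lemma sum_nonneg_Reals: "(\<And>i. i \<in> A \<Longrightarrow> f i \<in> \<real>\<^sub>\<ge>\<^sub>0) \<Longrightarrow> (\<Sum>i\<in>A. f i) \<in> \<real>\<^sub>\<ge>\<^sub>0" for f :: "'i \<Rightarrow> complex"
  by (induction A rule: infinite_finite_induct) auto

lemma nonneg_fps_mult: "nonneg_fps F \<Longrightarrow> nonneg_fps G \<Longrightarrow> nonneg_fps (F * G)"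
  by (auto simp: nonneg_fps_def fps_mult_nth intro!: sum_nonneg_Reals nonneg_Reals_mult_I)

lemma nonneg_fps_add: "nonneg_fps F \<Longrightarrow> nonneg_fps G \<Longrightarrow> nonneg_fps (F + G)"
  by (auto simp: nonneg_fps_def)

lemma nonneg_fps_fsum: "(\<And>s. nonneg_fps (F s)) \<Longrightarrow> nonneg_fps (fsum F)"
  by (auto simp: nonneg_fps_def fsum_def intro!: sum_nonneg_Reals)

lemma nonneg_fps_Re: "nonneg_fps F \<Longrightarrow> 0 \<le> Re (fps_nth F n)"
  by (auto simp: nonneg_fps_def complex_nonneg_Reals_iff)

lemma Re_mult_nonneg: "a \<in> \<real>\<^sub>\<ge>\<^sub>0 \<Longrightarrow> b \<in> \<real>\<^sub>\<ge>\<^sub>0 \<Longrightarrow> Re (a * b) = Re a * Re b"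
  by (auto simp: complex_nonneg_Reals_iff)

lemma nth_mult_ge:
  assumes F: "nonneg_fps F" and G: "nonneg_fps G"
  shows "Re (fps_nth F i) * Re (fps_nth G j) \<le> Re (fps_nth (F * G) (i + j))"
proof -
  have m: "Re (fps_nth F i * fps_nth G j) = Re (fps_nth F i) * Re (fps_nth G j)" for i j
    using F G by (intro Re_mult_nonneg) (auto simp: nonneg_fps_def)
  have "Re (fps_nth (F * G) (i + j)) = (\<Sum>k=0..i + j. Re (fps_nth F k) * Re (fps_nth G (i + j - k)))"
    by (simp only: fps_mult_nth Re_sum m)
  moreover have "Re (fps_nth F i) * Re (fps_nth G (i + j - i)) \<le> \<dots>"
    by (rule member_le_sum) (use nonneg_fps_Re[OF F] nonneg_fps_Re[OF G] in auto)
  ultimately show ?thesis by simp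
qed

text \<open>The expansion of jt(-c X^a, X^b). For \<open>a < b\<close> all exponents are
  nonnegative, so \<open>nat\<close> changes nothing.\<close>

definition theta_fps :: "complex \<Rightarrow> nat \<Rightarrow> nat \<Rightarrow> complex fps" where
  "theta_fps c a b = monomial_sum (\<lambda>k::int. c powi k) (\<lambda>k. nat (int a * k + int b * tri k))"

lemma theta_exponent_ge:
  assumes "a < b"
  shows "\<bar>k\<bar> - 1 \<le> int a * k + int b * tri k" "0 \<le> int a * k + int b * tri k"
proof -
  have b: "1 \<le> int b" "int a \<le> int b - 1" using assms by auto
  have t: "k - 1 \<le> tri k" "- k \<le> tri k + 1"
  proof -
    have "0 \<le> (k - 1) * (k - 2)" by (cases "k \<le> 1") (auto simp: mult_nonpos_nonpos)
    then show "k - 1 \<le> tri k" using two_tri[of k] by (simp add: algebra_simps)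
    have "0 \<le> k * (k + 1)" by (cases "0 \<le> k") (auto simp: mult_nonpos_nonpos)
    then show "- k \<le> tri k + 1" using two_tri[of k] by (simp add: algebra_simps)
  qed
  have *: "\<bar>k\<bar> - 1 \<le> int a * k + int b * tri k \<and> 0 \<le> int a * k + int b * tri k"
  proof (cases "0 \<le> k")
    case True
    then have "0 \<le> int a * k" by simp
    moreover have "1 * tri k \<le> int b * tri k" using b tri_nonneg[of k] by (intro mult_right_mono) auto
    ultimately show ?thesis using True t(1) tri_nonneg[of k] by linarith
  next
    case False
    have "- k \<le> tri k"
    proof -
      have "0 \<le> (- k) * (- k - 1)" using False by (intro mult_nonneg_nonneg) auto
      then show ?thesis using two_tri[of k] by (simp add: algebra_simps)
    qed
    then have "int b * (- k) \<le> int b * tri k" by (intro mult_left_mono) auto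
    moreover have "(int b - 1) * k \<le> int a * k" using b False by (intro mult_right_mono_neg) auto
    ultimately have "- k \<le> int a * k + int b * tri k" by (simp add: algebra_simps)
    then show ?thesis using False by linarith
  qed
  then show "\<bar>k\<bar> - 1 \<le> int a * k + int b * tri k" "0 \<le> int a * k + int b * tri k" by auto
qed

lemma theta_finite: "a < b \<Longrightarrow> finite {k. nat (int a * k + int b * tri k) = n}"
proof (rule finite_subset)
  assume ab: "a < b"
  show "{k. nat (int a * k + int b * tri k) = n} \<subseteq> {- int n - 1..int n + 1}"
  proof
    fix k assume "k \<in> {k. nat (int a * k + int b * tri k) = n}"
    then have "\<bar>k\<bar> - 1 \<le> int n" using theta_exponent_ge[OF ab, of k] by auto
    then show "k \<in> {- int n - 1..int n + 1}" by auto
  qed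
qed simp

lemma theta_summand:
  assumes "a < b" "q \<noteq> 0"
  shows "c powi k * q ^ nat (int a * k + int b * tri k) = jterm (- c * q ^ a) (q ^ b) k"
proof -
  have "q ^ nat (int a * k + int b * tri k) = q powi (int a * k + int b * tri k)"
    using power_int_of_nat[of q "nat (int a * k + int b * tri k)"] theta_exponent_ge(2)[OF assms(1), of k] by simp
  then show ?thesis using jterm_power[OF assms(2), of "- c" "int a" b k] by simp
qed

lemma theta_fps:
  assumes ab: "a < b" and c: "norm c = 1"
  shows "0 < fps_conv_radius (theta_fps c a b)"
    and "q \<noteq> 0 \<Longrightarrow> norm q \<le> 1 / 2 \<Longrightarrow> eval_fps (theta_fps c a b) q = jt (- c * q ^ a) (q ^ b)"
proof -
  have h: "(\<lambda>k. norm (jterm (- c * (1 / 2) ^ a) ((1 / 2) ^ b) k)) summable_on UNIV"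
    by (rule abs_summable_jterm) (use ab c in \<open>auto simp: norm_power norm_divide power_less_one_iff\<close>)
  have sm: "(\<lambda>k::int. norm (c powi k) * (1 / 2) ^ nat (int a * k + int b * tri k)) summable_on UNIV"
  proof (rule summable_on_cong[THEN iffD1, OF _ h])
    fix k :: int
    show "norm (jterm (- c * (1 / 2) ^ a) ((1 / 2) ^ b) k) = norm (c powi k) * (1 / 2) ^ nat (int a * k + int b * tri k)"
    proof -
      have s: "c powi k * (1 / 2) ^ nat (int a * k + int b * tri k) = jterm (- c * (1 / 2) ^ a) ((1 / 2) ^ b) k"
        by (rule theta_summand[OF ab]) simp
      show ?thesis unfolding s[symmetric] by (simp add: norm_mult norm_power norm_divide)
    qed
  qed
  show "0 < fps_conv_radius (theta_fps c a b)"
    unfolding theta_fps_def by (rule monomial_sum_conv_radius[OF theta_finite[OF ab] sm]) simp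
  assume q: "q \<noteq> 0" "norm q \<le> 1 / 2"
  have "((\<lambda>k. c powi k * q ^ nat (int a * k + int b * tri k)) has_sum eval_fps (theta_fps c a b) q) UNIV"
    unfolding theta_fps_def by (rule monomial_sum[OF theta_finite[OF ab] sm q(2)])
  then have "(jterm (- c * q ^ a) (q ^ b) has_sum eval_fps (theta_fps c a b) q) UNIV"
    unfolding theta_summand[OF ab q(1)] .
  moreover have "norm (q ^ b) < 1" using q ab by (intro norm_pow_less_1) auto
  then have "(jterm (- c * q ^ a) (q ^ b) has_sum jt (- c * q ^ a) (q ^ b)) UNIV"
    using q c by (intro jt_has_sum) auto
  ultimately show "eval_fps (theta_fps c a b) q = jt (- c * q ^ a) (q ^ b)"
    by (rule has_sum_unique)
qed

lemma fsum_monomial_sum: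
  assumes fin: "\<And>i n. finite {k. e i k = n}" and le: "\<And>i k. i \<le> e i k"
  shows "fsum (\<lambda>i. monomial_sum c (e i)) = monomial_sum (\<lambda>(i, k). c k) (\<lambda>(i, k). e i k)"
proof (rule fps_ext)
  fix n
  have "{(i, k). e i k = n} = Sigma {..n} (\<lambda>i. {k. e i k = n})"
    using le by auto
  then have "(\<Sum>(i, k) | e i k = n. c k) = (\<Sum>i\<le>n. \<Sum>k | e i k = n. c k)"
    using fin by (simp add: sum.Sigma)
  then show "fps_nth (fsum (\<lambda>i. monomial_sum c (e i))) n = fps_nth (monomial_sum (\<lambda>(i, k). c k) (\<lambda>(i, k). e i k)) n"
    by (simp add: fsum_def monomial_sum_def case_prod_unfold)
qed

lemma rank_tail_num_monomial:
  "rank_tail_num m = monomial_sum (\<lambda>k. (- 1) ^ k) (\<lambda>k. Suc k * Suc k + m * Suc k)"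
proof (rule fps_ext)
  fix n
  let ?e = "\<lambda>k. Suc k * Suc k + m * Suc k"
  have le: "k \<le> ?e k" for k by simp
  have "fps_nth (rank_tail_num m) n = (\<Sum>k\<le>n. if n = ?e k then (- 1) ^ k else 0)"
    unfolding rank_tail_num_def fsum_def fps_nth_Abs_fps neg_one_power_fps fps_mult_left_const_nth fps_X_power_nth
    by (rule sum.cong) auto
  also have "\<dots> = (\<Sum>k | ?e k = n. (- 1) ^ k)"
    by (rule sum.mono_neutral_cong_right) (use le in auto)
  finally show "fps_nth (rank_tail_num m) n = fps_nth (monomial_sum (\<lambda>k. (- 1) ^ k) ?e) n"
    by (simp add: monomial_sum_def)
qed

lemma nat_fibre_finite: "(\<And>k. k \<le> e k) \<Longrightarrow> finite {k :: nat. e k = (n :: nat)}"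
  by (rule finite_subset[of _ "{..n}"]) auto

lemma shift_dilate3_monomial:
  assumes "\<And>k. a \<le> 3 * e k"
  shows "fps_shift a (dilate3 (monomial_sum c e)) = monomial_sum c (\<lambda>k. 3 * e k - a)"
proof (rule fps_ext)
  fix n
  have "{k. 3 * e k - a = n} = (if 3 dvd n + a then {k. e k = (n + a) div 3} else {})"
    using assms by (auto simp: dvd_def)
  then show "fps_nth (fps_shift a (dilate3 (monomial_sum c e))) n = fps_nth (monomial_sum c (\<lambda>k. 3 * e k - a)) n"
    by (simp add: dilate3_nth monomial_sum_def)
qed

text \<open>Each denominator is expanded as a geometric series in a second index \<open>i\<close>.
  The bound by \<open>i + k\<close> gives finite fibres and domination by (1/2)^(i+k) on the disc of
  radius 1/2.\<close>

lemma geometric_pairs: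
  fixes c :: "nat \<Rightarrow> complex"
  assumes c: "\<And>k. norm (c k) \<le> 1" and d: "\<And>k. 0 < d k" and e: "\<And>i k. i + k \<le> e0 k + d k * i"
  defines "F \<equiv> monomial_sum (\<lambda>(i, k). c k) (\<lambda>(i, k). e0 k + d k * i)"
  shows "0 < fps_conv_radius F"
    and "norm q \<le> 1 / 2 \<Longrightarrow> ((\<lambda>k. c k * q ^ e0 k / (1 - q ^ d k)) has_sum eval_fps F q) UNIV"
proof -
  have fin: "finite {p. (case p of (i, k) \<Rightarrow> e0 k + d k * i) = n}" for n
  proof (rule finite_subset)
    show "{p. (case p of (i, k) \<Rightarrow> e0 k + d k * i) = n} \<subseteq> {..n} \<times> {..n}"
      using e by (auto intro: order_trans[OF le_add1 e] order_trans[OF le_add2 e])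
  qed simp
  have g: "(\<lambda>i. (1 / 2 :: complex) ^ i) summable_on UNIV" "(\<lambda>i. norm ((1 / 2 :: complex) ^ i)) summable_on UNIV"
  proof -
    have "summable (\<lambda>i. norm ((1 / 2 :: complex) ^ i))"
      by (simp add: norm_power norm_divide)
    then show "(\<lambda>i. norm ((1 / 2 :: complex) ^ i)) summable_on UNIV"
      by (intro summable_nonneg_imp_summable_on) auto
    then show "(\<lambda>i. (1 / 2 :: complex) ^ i) summable_on UNIV" by (rule abs_summable_summable)
  qed
  obtain t where t: "((\<lambda>i. (1 / 2 :: complex) ^ i) has_sum t) UNIV" using g(1) by (auto simp: summable_on_def)
  have "(\<lambda>(i, k). norm ((1 / 2 :: complex) ^ i * (1 / 2) ^ k)) summable_on UNIV \<times> UNIV"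
    by (rule has_sum_product(2)[OF t t g(2) g(2)])
  then have sm: "(\<lambda>p. norm (case p of (i, k) \<Rightarrow> c k) * (1 / 2) ^ (case p of (i, k) \<Rightarrow> e0 k + d k * i)) summable_on UNIV"
    unfolding UNIV_Times_UNIV
  proof (rule summable_on_comparison_test)
    fix p :: "nat \<times> nat"
    obtain i k where p: "p = (i, k)" by (cases p)
    have "norm (c k) * (1 / 2) ^ (e0 k + d k * i) \<le> 1 * (1 / 2 :: real) ^ (i + k)"
      by (intro mult_mono c power_decreasing e) auto
    then show "norm (case p of (i, k) \<Rightarrow> c k) * (1 / 2) ^ (case p of (i, k) \<Rightarrow> e0 k + d k * i) \<le>
        (case p of (i, k) \<Rightarrow> norm ((1 / 2 :: complex) ^ i * (1 / 2) ^ k))"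
      by (simp add: p norm_mult norm_power norm_divide power_add)
  qed auto
  show "0 < fps_conv_radius F" unfolding F_def by (rule monomial_sum_conv_radius[OF fin sm]) simp
  assume q: "norm q \<le> 1 / 2"
  have "((\<lambda>p. (case p of (i, k) \<Rightarrow> c k) * q ^ (case p of (i, k) \<Rightarrow> e0 k + d k * i)) has_sum eval_fps F q) (UNIV \<times> UNIV)"
    unfolding UNIV_Times_UNIV F_def by (rule monomial_sum[OF fin sm q])
  then have "((\<lambda>(k, i). c k * q ^ (e0 k + d k * i)) has_sum eval_fps F q) (UNIV \<times> UNIV)"
    by (subst (asm) has_sum_swap) (simp add: case_prod_unfold)
  then show "((\<lambda>k. c k * q ^ e0 k / (1 - q ^ d k)) has_sum eval_fps F q) UNIV"
  proof (rule has_sum_SigmaD)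
    fix k
    have n: "norm (q ^ d k) < 1" using q d[of k] by (intro norm_pow_less_1) auto
    then have "((\<lambda>i. (q ^ d k) ^ i) has_sum 1 / (1 - q ^ d k)) UNIV"
      by (intro norm_summable_imp_has_sum geometric_sums) (simp_all add: norm_power)
    from has_sum_cmult_right[OF this, of "c k * q ^ e0 k"]
    show "((\<lambda>i. case (k, i) of (k, i) \<Rightarrow> c k * q ^ (e0 k + d k * i)) has_sum c k * q ^ e0 k / (1 - q ^ d k)) UNIV"
      by (simp add: power_add power_mult mult.assoc)
  qed
qed

lemma has_sum_Suc_shift:
  fixes f :: "nat \<Rightarrow> complex"
  assumes "((\<lambda>k. f (Suc k)) has_sum s) UNIV" "f 0 = 0"
  shows "(f has_sum s) UNIV"
proof -
  have bij: "bij_betw Suc UNIV {1..}"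
    by (rule bij_betwI[where g = "\<lambda>n. n - 1"]) auto
  have "(f has_sum s) {1..}"
    using assms(1) has_sum_reindex_bij_betw[OF bij, of f s] by simp
  then show ?thesis
    by (rule has_sum_cong_neutral[THEN iffD1, rotated -1]) (use assms(2) in \<open>auto simp: not_le\<close>)
qed

text \<open>Equality is only required away from \<open>0\<close>, where the theta functions below have junk values.\<close>

definition expands :: "complex fps \<Rightarrow> (complex \<Rightarrow> complex) \<Rightarrow> bool" where
  "expands F f \<longleftrightarrow> 0 < fps_conv_radius F \<and> eventually (\<lambda>q. eval_fps F q = f q) (at 0)"

lemma eventually_conv_radius: "0 < R \<Longrightarrow> eventually (\<lambda>q :: complex. ereal (norm q) < R) (at 0)"
proof -
  assume "0 < R"
  then obtain r where r: "0 < r" "ereal r < R"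
    by (metis ereal_dense2 ereal_less(2))
  have "eventually (\<lambda>q :: complex. norm q < r) (at 0)"
    unfolding eventually_at using r by (intro exI[of _ r]) (auto simp: dist_norm)
  then show ?thesis
    by eventually_elim (use r in \<open>meson ereal_less(1) less_ereal.simps(1) less_trans\<close>)
qed

lemma expandsI:
  assumes "0 < fps_conv_radius F" "\<And>q. q \<noteq> 0 \<Longrightarrow> norm q \<le> 1 / 2 \<Longrightarrow> eval_fps F q = f q"
  shows "expands F f"
  unfolding expands_def eventually_at using assms by (auto intro!: exI[of _ "1 / 2"] simp: dist_norm)

lemma expands_const: "expands (fps_const c) (\<lambda>_. c)"
  by (simp add: expands_def)

lemma expands_X: "expands fps_X (\<lambda>q. q)"
  by (simp add: expands_def)

lemma expands_diff:
  assumes "expands F f" "expands G g"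
  shows "expands (F - G) (\<lambda>q. f q - g q)"
proof -
  have r: "0 < fps_conv_radius F" "0 < fps_conv_radius G"
    and e: "eventually (\<lambda>q. eval_fps F q = f q) (at 0)" "eventually (\<lambda>q. eval_fps G q = g q) (at 0)"
    using assms by (auto simp: expands_def)
  have "eventually (\<lambda>q. eval_fps (F - G) q = f q - g q) (at 0)"
    using eventually_conv_radius[OF r(1)] eventually_conv_radius[OF r(2)] e
    by eventually_elim (simp add: eval_fps_diff)
  moreover have "0 < fps_conv_radius (F - G)"
    using r fps_conv_radius_diff[of F G] by (auto intro: less_le_trans simp: min_def split: if_splits)
  ultimately show ?thesis by (simp add: expands_def)
qed

lemma expands_mult:
  assumes "expands F f" "expands G g"
  shows "expands (F * G) (\<lambda>q. f q * g q)"
proof -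
  have r: "0 < fps_conv_radius F" "0 < fps_conv_radius G"
    and e: "eventually (\<lambda>q. eval_fps F q = f q) (at 0)" "eventually (\<lambda>q. eval_fps G q = g q) (at 0)"
    using assms by (auto simp: expands_def)
  have "eventually (\<lambda>q. eval_fps (F * G) q = f q * g q) (at 0)"
    using eventually_conv_radius[OF r(1)] eventually_conv_radius[OF r(2)] e
    by eventually_elim (simp add: eval_fps_mult)
  moreover have "0 < fps_conv_radius (F * G)"
    using r fps_conv_radius_mult[of F G] by (auto intro: less_le_trans simp: min_def split: if_splits)
  ultimately show ?thesis by (simp add: expands_def)
qed

lemma expands_add:
  assumes "expands F f" "expands G g"
  shows "expands (F + G) (\<lambda>q. f q + g q)"
  using expands_diff[OF assms(1) expands_diff[OF expands_const[of 0] assms(2)]] by simp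

lemma expands_inverse:
  assumes "expands F f" "fps_nth F 0 \<noteq> 0"
  shows "expands (inverse F) (\<lambda>q. 1 / f q)"
proof -
  have r: "0 < fps_conv_radius F" "0 < fps_conv_radius (inverse F)"
    and e: "eventually (\<lambda>q. eval_fps F q = f q) (at 0)"
    using assms fps_conv_radius_inverse_pos by (auto simp: expands_def)
  have FF: "F * inverse F = 1" using inverse_mult_eq_1'[OF assms(2)] .
  have "eventually (\<lambda>q. f q * eval_fps (inverse F) q = 1) (at 0)"
    using eventually_conv_radius[OF r(1)] eventually_conv_radius[OF r(2)] e
    by eventually_elim (use FF in \<open>metis eval_fps_mult eval_fps_1\<close>)
  then have "eventually (\<lambda>q. eval_fps (inverse F) q = 1 / f q) (at 0)"
    by eventually_elim (metis nonzero_mult_div_cancel_left mult_zero_left zero_neq_one)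
  with r show ?thesis by (simp add: expands_def)
qed

lemma filterlim_cube_at_0: "filterlim (\<lambda>q :: complex. q ^ 3) (at 0) (at 0)"
  unfolding filterlim_at by (auto intro!: tendsto_eq_intros simp: eventually_at_filter)

lemma expands_dilate3:
  assumes "expands F f"
  shows "expands (dilate3 F) (\<lambda>q. f (q ^ 3))"
proof -
  have r: "0 < fps_conv_radius F" and e: "eventually (\<lambda>q. eval_fps F q = f q) (at 0)"
    using assms by (auto simp: expands_def)
  have "eventually (\<lambda>q. eval_fps (dilate3 F) q = f (q ^ 3)) (at 0)"
    using eventually_compose_filterlim[OF e filterlim_cube_at_0]
      eventually_compose_filterlim[OF eventually_conv_radius[OF r] filterlim_cube_at_0]
    by eventually_elim (simp add: eval_dilate3)
  then show ?thesis using dilate3_conv_radius[OF r] by (simp add: expands_def)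
qed

text \<open>Agreement is known only on a punctured disc; continuity supplies the value at 0, after
  which power series are determined by their values.\<close>

lemma expands_unique:
  assumes "expands F f" "expands G g" "eventually (\<lambda>q. f q = g q) (at 0)"
  shows "F = G"
proof (rule eval_fps_eqD)
  have r: "0 < fps_conv_radius F" "0 < fps_conv_radius G"
    and e: "eventually (\<lambda>q. eval_fps F q = f q) (at 0)" "eventually (\<lambda>q. eval_fps G q = g q) (at 0)"
    using assms by (auto simp: expands_def)
  have ev: "eventually (\<lambda>q. eval_fps F q = eval_fps G q) (at 0)"
    using e assms(3) by eventually_elim simp
  have "isCont (eval_fps F) 0" "isCont (eval_fps G) 0"
    using r by (intro continuous_eval_fps; simp add: zero_ereal_def)+
  then have "eval_fps F \<midarrow>0\<rightarrow> eval_fps F 0" "eval_fps G \<midarrow>0\<rightarrow> eval_fps G 0"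
    by (simp_all add: isCont_def)
  then have "eval_fps F 0 = eval_fps G 0"
    using tendsto_cong[OF ev] LIM_unique by blast
  then show "eventually (\<lambda>q. eval_fps F q = eval_fps G q) (nhds 0)"
    using ev by (simp add: eventually_nhds_conv_at)
  show "0 < fps_conv_radius F" "0 < fps_conv_radius G" by (fact r)+
qed

lemma expands_cong: "expands F f \<Longrightarrow> eventually (\<lambda>q. f q = g q) (at 0) \<Longrightarrow> expands F g"
  unfolding expands_def by (auto elim: eventually_elim2)

lemma expands_numeral: "expands (numeral n) (\<lambda>_. numeral n)" and expands_1: "expands 1 (\<lambda>_. 1)"
  by (simp_all add: expands_def)

lemma expands_power: "expands F f \<Longrightarrow> expands (F ^ n) (\<lambda>q. f q ^ n)"
  by (induction n) (auto intro: expands_mult expands_1)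

lemmas expands_intros = expands_const expands_X expands_add expands_diff expands_mult expands_inverse
  expands_dilate3 expands_numeral expands_1 expands_power

lemma eventually_small: "eventually (\<lambda>q :: complex. q \<noteq> 0 \<and> norm q \<le> 1 / 2) (at 0)"
  unfolding eventually_at by (auto intro!: exI[of _ "1 / 2"] simp: dist_norm)

lemma Phi_expands: "expands Phi phi"
proof -
  define U where "U = rank_tail_num 0"
  have U: "U = monomial_sum (\<lambda>k. (- 1) ^ k) (\<lambda>k. Suc k * Suc k)"
    unfolding U_def rank_tail_num_monomial by simp
  have fin: "finite {k. Suc k * Suc k = n}" for n
    by (rule nat_fibre_finite) simp
  have "(\<lambda>k. (1 / 2 :: real) ^ k) summable_on UNIV"
    by (intro summable_nonneg_imp_summable_on summable_geometric) auto
  then have sm: "(\<lambda>k. norm ((- 1 :: complex) ^ k) * (1 / 2) ^ (Suc k * Suc k)) summable_on UNIV"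
  proof (rule summable_on_comparison_test)
    show "norm ((- 1 :: complex) ^ k) * (1 / 2) ^ (Suc k * Suc k) \<le> (1 / 2 :: real) ^ k" for k
      using power_decreasing[of k "Suc k * Suc k" "1 / 2 :: real"] by (simp add: norm_power)
  qed auto
  have rU: "0 < fps_conv_radius U" unfolding U by (rule monomial_sum_conv_radius[OF fin sm]) simp
  have *: "1 - 2 * eval_fps U q = phi q" if q: "q \<noteq> 0" "norm q \<le> 1 / 2" for q
  proof -
  have "((\<lambda>k. (- 1) ^ k * q ^ (Suc k * Suc k)) has_sum eval_fps U q) UNIV"
    unfolding U by (rule monomial_sum[OF fin sm q(2)])
  from has_sum_cmult_right[OF this, of "- 2"]
  have 1: "((\<lambda>k. - 2 * ((- 1) ^ k * q ^ (Suc k * Suc k))) has_sum - 2 * eval_fps U q) UNIV" .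
  have n: "norm (q\<^sup>2) < 1" using q by (intro norm_pow_less_1) auto
  have j: "jterm q (q\<^sup>2) k = (- 1) powi k * q powi (k * k)" for k
  proof -
    have "1 * k + int 2 * tri k = k * k" using two_tri[of k] by (simp add: algebra_simps)
    then show ?thesis using jterm_power[OF q(1), of 1 1 2 k] by simp
  qed
  have "(jterm q (q\<^sup>2) has_sum phi q) UNIV"
    unfolding phi_def using q n by (intro jt_has_sum) auto
  from has_sum_int_fold[OF this]
  have 2: "((\<lambda>n. if n = 0 then 0 else 2 * ((- 1) ^ n * q ^ (n * n))) has_sum phi q - 1) UNIV"
  proof -
    have e: "jterm q (q\<^sup>2) (int n) + jterm q (q\<^sup>2) (- int n) = 2 * ((- 1) ^ n * q ^ (n * n))" for n
      unfolding j neg_one_powi using power_int_of_nat[of q "n * n"] by simp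
    have "jterm q (q\<^sup>2) 0 = 1" by (simp add: j)
    then show ?thesis using has_sum_int_fold[OF \<open>(jterm q (q\<^sup>2) has_sum phi q) UNIV\<close>] unfolding e by simp
  qed
  have 3: "((\<lambda>n. if n = 0 then 0 else 2 * ((- 1) ^ n * q ^ (n * n))) has_sum - 2 * eval_fps U q) UNIV"
    by (rule has_sum_Suc_shift) (use 1 in simp_all)
  have "phi q - 1 = - 2 * eval_fps U q" by (rule has_sum_unique[OF 2 3])
  then show ?thesis by (simp add: algebra_simps)
  qed
  have "expands U (eval_fps U)" using rU by (simp add: expands_def)
  then have "expands Phi (\<lambda>q. 1 - 2 * eval_fps U q)"
    unfolding Phi_def U_def[symmetric] by (intro expands_intros)
  then show ?thesis
    by (rule expands_cong) (use eventually_small in \<open>eventually_elim, use * in blast\<close>)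
qed

section \<open>The theta series of the final formula\<close>

definition P_fps where "P_fps = theta_fps 1 1 3"
definition J_fps where "J_fps = theta_fps 1 0 3"
text \<open>Euler's product in x^2, given by its pentagonal number series so that
  \<open>theta_fps\<close> applies.\<close>

definition eu2_fps where "eu2_fps = theta_fps (- 1) 2 6"

lemma P_expands: "expands P_fps thP" and J_expands: "expands J_fps thJ"
  unfolding P_fps_def J_fps_def
  by (rule expandsI; use theta_fps[of 1 3 1] theta_fps[of 0 3 1] in \<open>simp add: thP_def thJ_def\<close>)+

lemma eu2_expands: "expands eu2_fps (\<lambda>x. eu (x\<^sup>2))"
  unfolding eu2_fps_def
proof (rule expandsI)
  fix q :: complex assume q: "q \<noteq> 0" "norm q \<le> 1 / 2"
  then show "eval_fps (theta_fps (- 1) 2 6) q = eu (q\<^sup>2)"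
    using theta_fps(2)[of 2 6 "- 1" q] jt_square_sixth(1)[of q] by simp
qed (rule theta_fps, auto)

lemma theta_fps_nonneg: "nonneg_fps (theta_fps 1 a b)"
  by (auto simp: nonneg_fps_def theta_fps_def monomial_sum_def)

lemma theta_fps_nth_ge:
  assumes "a < b" "nat (int a * k + int b * tri k) = n"
  shows "1 \<le> Re (fps_nth (theta_fps 1 a b) n)"
proof -
  have "0 < card {k. nat (int a * k + int b * tri k) = n}"
    using theta_finite[OF assms(1), of n] assms(2) by (subst card_gt_0_iff) auto
  then show ?thesis by (simp add: theta_fps_def monomial_sum_def)
qed

text \<open>The reciprocal of \<open>eu2_fps\<close> is only known to be positive in even degrees,
  so the numerators need positive coefficients of both parities. For \<open>J_fps\<close> the first
  odd degree is 3.\<close>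

lemma P_J_coeffs: "1 \<le> Re (fps_nth P_fps 0)" "1 \<le> Re (fps_nth P_fps 1)" "1 \<le> Re (fps_nth J_fps 0)" "1 \<le> Re (fps_nth J_fps 3)"
  unfolding P_fps_def J_fps_def
  by (rule theta_fps_nth_ge[of _ _ 0] theta_fps_nth_ge[of _ _ 1] theta_fps_nth_ge[of _ _ 2]; simp add: tri_def; fail)+

lemma eu2_nth_0: "fps_nth eu2_fps 0 = 1"
proof -
  have "{k. nat (int 2 * k + int 6 * tri k) = 0} = {0}"
  proof (intro equalityI subsetI)
    fix k assume k: "k \<in> {k. nat (int 2 * k + int 6 * tri k) = 0}"
    then have z: "2 * k + 6 * tri k \<le> 0" by simp
    then have "\<bar>k\<bar> \<le> 1" using theta_exponent_ge(1)[of 2 6 k] by simp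
    then have "k = - 1 \<or> k = 0 \<or> k = 1" by linarith
    then show "k \<in> {0}" using z by (auto simp: tri_def)
  qed (simp add: tri_def)
  then show ?thesis by (simp add: eu2_fps_def theta_fps_def monomial_sum_def)
qed

section \<open>Nonnegativity of the reciprocal Euler product\<close>

text \<open>If the series minus 1 had order d < M, dividing it by x^d and letting x tend to 0 would
  make its leading coefficient 0. This permits comparison of coefficients with truncated products by
  an analytic estimate.\<close>

lemma expands_order:
  assumes K: "expands K f" and bd: "eventually (\<lambda>x. norm (f x - 1) \<le> c * norm x ^ M) (at 0)" and j: "j < M"
  shows "fps_nth K j = (if j = 0 then 1 else 0)"
proof -
  define G where "G = K - 1"
  have G: "expands G (\<lambda>x. f x - 1)" unfolding G_def by (intro expands_intros K)
  then have r: "0 < fps_conv_radius G" and e: "eventually (\<lambda>x. eval_fps G x = f x - 1) (at 0)"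
    by (auto simp: expands_def)
  have "fps_nth G j = 0"
  proof (rule ccontr)
    assume nz: "fps_nth G j \<noteq> 0"
    define d where "d = subdegree G"
    have d: "d \<le> j" "fps_nth G d \<noteq> 0" using nz by (auto simp: d_def intro: subdegree_leI)
    have "eventually (\<lambda>x. norm (eval_fps (fps_shift d G) x) \<le> c * norm x ^ (M - d)) (at 0)"
      using eventually_conv_radius[OF r] e bd eventually_small
    proof eventually_elim
      case (elim x)
      have "eval_fps (fps_shift d G) x = eval_fps G x / x ^ d"
        using eval_fps_shift[of d G x] elim by (simp add: d_def)
      then have "norm (eval_fps (fps_shift d G) x) * norm x ^ d = norm (f x - 1)"
        using elim by (simp add: norm_divide norm_power)
      also have "\<dots> \<le> c * norm x ^ (M - d) * norm x ^ d"
        using elim(3) d(1) j by (simp add: mult.assoc power_add[symmetric])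
      finally show ?case using elim by (simp add: mult_le_cancel_right)
    qed
    moreover have "((\<lambda>x :: complex. c * norm x ^ (M - d)) \<longlongrightarrow> c * norm (0 :: complex) ^ (M - d)) (at 0)"
      by (intro tendsto_intros)
    then have "((\<lambda>x :: complex. c * norm x ^ (M - d)) \<longlongrightarrow> 0) (at 0)"
      using d(1) j by (simp add: power_0_left)
    ultimately have "(eval_fps (fps_shift d G) \<longlongrightarrow> 0) (at 0)"
      by (rule Lim_null_comparison)
    moreover have "isCont (eval_fps (fps_shift d G)) 0"
      using r by (intro continuous_eval_fps) (simp add: zero_ereal_def)
    then have "(eval_fps (fps_shift d G) \<longlongrightarrow> eval_fps (fps_shift d G) 0) (at 0)"
      by (simp add: isCont_def)
    ultimately have "eval_fps (fps_shift d G) 0 = 0" using LIM_unique by blast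
    then show False using d(2) by (simp add: eval_fps_at_0)
  qed
  then show ?thesis by (simp add: G_def split: if_splits)
qed

lemma qp_iterate: "norm q < 1 \<Longrightarrow> qp z q = (\<Prod>i<N. 1 - z * q ^ i) * qp (z * q ^ N) q"
proof (induction N)
  case (Suc N)
  then show ?case using qp_rec[of q "z * q ^ N"] by (simp add: mult_ac)
qed simp

text \<open>The distance to 1 is at most exp(2|z|) - 1, hence at most 2|z| + 4|z|^2, and |z| \<le>
  1/2 bounds this by 4|z|.\<close>

lemma qp_near_1:
  assumes q: "norm q \<le> 1 / 2" and z: "norm z \<le> 1 / 2"
  shows "norm (qp z q - 1) \<le> 4 * norm z"
proof (rule LIMSEQ_le_const2)
  have "norm q < 1" using q by simp
  then show "(\<lambda>N. norm ((\<Prod>n<N. 1 - z * q ^ n) - 1)) \<longlonglongrightarrow> norm (qp z q - 1)"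
    by (intro tendsto_intros qp_LIMSEQ)
  have "norm ((\<Prod>n<N. 1 - z * q ^ n) - 1) \<le> 4 * norm z" for N
  proof -
    have "norm ((\<Prod>n<N. 1 - z * q ^ n) - 1) = norm ((\<Prod>n<N. 1 + - (z * q ^ n)) - 1)" by simp
    also have "\<dots> \<le> (\<Prod>n<N. 1 + norm (- (z * q ^ n))) - 1"
      by (rule norm_prod_minus1_le_prod_minus1)
    also have "(\<Prod>n<N. 1 + norm (- (z * q ^ n))) \<le> exp (\<Sum>n<N. norm (- (z * q ^ n)))"
      by (rule prod_le_exp_sum) auto
    also have "(\<Sum>n<N. norm (- (z * q ^ n))) \<le> norm z * 2"
    proof -
      have "(\<Sum>n<N. norm (- (z * q ^ n))) \<le> (\<Sum>n<N. norm z * (1 / 2) ^ n)"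
        using q by (intro sum_mono) (auto simp: norm_mult norm_power intro!: mult_left_mono power_mono)
      also have "\<dots> = norm z * (\<Sum>n<N. (1 / 2) ^ n)" by (simp add: sum_distrib_left)
      also have "(\<Sum>n<N. (1 / 2 :: real) ^ n) \<le> 2"
        using sum_le_suminf[of "\<lambda>n. (1 / 2 :: real) ^ n" "{..<N}"] by (simp add: suminf_geometric)
      finally show ?thesis by (simp add: mult_left_mono)
    qed
    also have "exp (norm z * 2) \<le> 1 + norm z * 2 + (norm z * 2)\<^sup>2"
      using z by (intro exp_bound) auto
    also have "(norm z * 2)\<^sup>2 \<le> norm z * 2"
    proof -
      have "(norm z * 2) * (norm z * 2) \<le> (norm z * 2) * 1" by (intro mult_left_mono) (use z in auto)
      then show ?thesis by (simp add: power2_eq_square)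
    qed
    finally show ?thesis by simp
  qed
  then show "\<exists>N. \<forall>n\<ge>N. norm ((\<Prod>i<n. 1 - z * q ^ i) - 1) \<le> 4 * norm z" by blast
qed

definition geo :: "nat \<Rightarrow> complex fps" where
  "geo m = Abs_fps (\<lambda>n. if m dvd n then 1 else 0)"

lemma geo: "0 < m \<Longrightarrow> (1 - fps_X ^ m) * geo m = 1"
proof (rule fps_ext)
  fix n assume m: "0 < m"
  have "fps_nth ((1 - fps_X ^ m) * geo m) n = (if m dvd n then 1 else 0) - (if n < m then 0 else if m dvd n - m then 1 else 0)"
    by (simp add: left_diff_distrib fps_X_power_mult_nth geo_def)
  also have "\<dots> = fps_nth 1 n"
    using m by (auto simp: dvd_minus_self not_less dest: dvd_imp_le)
  finally show "fps_nth ((1 - fps_X ^ m) * geo m) n = fps_nth 1 n" .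
qed

text \<open>The generating function of partitions into even parts of size at most
  \<open>2 * N\<close>.\<close>

definition even_geo :: "nat \<Rightarrow> complex fps" where
  "even_geo N = (\<Prod>i<N. geo (2 * Suc i))"

lemma geo_nonneg: "nonneg_fps (geo m)" by (auto simp: nonneg_fps_def geo_def)

lemma even_geo_nonneg: "nonneg_fps (even_geo N)"
proof (induction N)
  case (Suc N)
  then show ?case unfolding even_geo_def prod.lessThan_Suc by (intro nonneg_fps_mult geo_nonneg)
qed (simp add: even_geo_def nonneg_fps_def)

lemma even_geo_nth_ge: "1 \<le> Re (fps_nth (even_geo (Suc N)) (2 * n))"
proof -
  have "1 \<le> Re (fps_nth (even_geo (Suc N)) (2 * n))" if "1 \<le> Re (fps_nth (even_geo (Suc 0)) (2 * n))"
  proof (induction N)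
    case (Suc N)
    have "even_geo (Suc (Suc N)) = even_geo (Suc N) * geo (2 * Suc (Suc N))"
      by (simp add: even_geo_def)
    then show ?case
      using Suc nth_mult_ge[OF even_geo_nonneg[of "Suc N"] geo_nonneg[of "2 * Suc (Suc N)"], of "2 * n" 0]
      by (simp add: geo_def)
  qed (use that in simp)
  then show ?thesis by (simp add: even_geo_def geo_def)
qed

text \<open>The full product divided by its first \<open>N\<close> factors is the tail product,
  which is 1 + O(x^(2N+2)); lower coefficients of the reciprocal are therefore those of the
  truncation.\<close>

lemma eu2_inverse_nth:
  assumes "n < 2 * N + 2"
  shows "fps_nth (inverse eu2_fps) n = fps_nth (even_geo N) n"
proof -
  define Q :: "complex fps" where "Q = (\<Prod>i<N. 1 - fps_X ^ (2 * Suc i))"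
  have Qg: "Q * even_geo N = 1"
    unfolding Q_def even_geo_def prod.distrib[symmetric] by (simp add: geo del: mult_Suc_right)
  have Qx: "expands Q (\<lambda>x. \<Prod>i<N. 1 - x ^ (2 * Suc i))"
    unfolding Q_def by (induction N) (auto intro!: expands_intros simp del: mult_Suc_right)
  have Q0: "fps_nth Q 0 \<noteq> 0"
    using Qg by (metis fps_mult_nth_0 fps_one_nth mult_zero_left zero_neq_one)
  have gQ: "even_geo N = inverse Q" using Qg by (metis fps_inverse_unique)
  define K where "K = eu2_fps * even_geo N"
  have "expands K (\<lambda>x. eu (x\<^sup>2) * (1 / (\<Prod>i<N. 1 - x ^ (2 * Suc i))))"
    unfolding K_def gQ by (intro expands_intros eu2_expands Qx Q0)
  then have K: "expands K (\<lambda>x. qp (x ^ (2 * N + 2)) (x\<^sup>2))"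
  proof (rule expands_cong)
    show "eventually (\<lambda>x. eu (x\<^sup>2) * (1 / (\<Prod>i<N. 1 - x ^ (2 * Suc i))) = qp (x ^ (2 * N + 2)) (x\<^sup>2)) (at 0)"
      using eventually_small
    proof eventually_elim
      case (elim x)
      have n: "norm (x\<^sup>2) < 1" using elim by (intro norm_pow_less_1) auto
      have p: "1 - x\<^sup>2 * (x\<^sup>2) ^ i = 1 - x ^ (2 * Suc i)" for i
        by (simp only: power_mult power_Suc)
      have "(\<Prod>i<N. 1 - x ^ (2 * Suc i)) \<noteq> 0"
        using qfact_nonzero[OF n, of N] unfolding p .
      moreover have "x\<^sup>2 * (x\<^sup>2) ^ N = x ^ (2 * Suc N)" by (simp only: power_mult power_Suc)
      then have "x\<^sup>2 * (x\<^sup>2) ^ N = x ^ (2 * N + 2)" by simp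
      ultimately show ?case
        using qp_iterate[OF n, of "x\<^sup>2" N] unfolding p eu_def by simp
    qed
  qed
  have Kn: "fps_nth K j = (if j = 0 then 1 else 0)" if "j < 2 * N + 2" for j
  proof (rule expands_order[OF K _ that])
    show "eventually (\<lambda>x. norm (qp (x ^ (2 * N + 2)) (x\<^sup>2) - 1) \<le> 4 * norm x ^ (2 * N + 2)) (at 0)"
      using eventually_small
    proof eventually_elim
      case (elim x)
      have s: "norm (x ^ Suc m) \<le> 1 / 2" for m
      proof -
        have "norm x ^ Suc m \<le> norm x ^ 1" using elim by (intro power_decreasing) auto
        then show ?thesis using elim by (simp add: norm_power del: power_Suc)
      qed
      have "norm (x\<^sup>2) \<le> 1 / 2" "norm (x ^ (2 * N + 2)) \<le> 1 / 2"
        using s[of 1] s[of "2 * N + 1"] by (simp_all add: numeral_2_eq_2)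
      then show ?case using qp_near_1[of "x\<^sup>2" "x ^ (2 * N + 2)"] by (simp only: norm_power)
    qed
  qed
  have "inverse eu2_fps * K = even_geo N"
    using inverse_mult_eq_1[of eu2_fps] eu2_nth_0 by (simp add: K_def mult.assoc[symmetric])
  then have "fps_nth (even_geo N) n = (\<Sum>i=0..n. fps_nth (inverse eu2_fps) i * fps_nth K (n - i))"
    by (metis fps_mult_nth)
  also have "\<dots> = (\<Sum>i=0..n. fps_nth (inverse eu2_fps) i * (if n - i = 0 then 1 else 0))"
    using assms by (intro sum.cong refl) (simp add: Kn)
  also have "\<dots> = (\<Sum>i\<in>{n}. fps_nth (inverse eu2_fps) i)"
    by (rule sum.mono_neutral_cong_right) auto
  finally show ?thesis by simp
qed

lemma eu2_inverse_nonneg: "nonneg_fps (inverse eu2_fps)"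
  unfolding nonneg_fps_def
proof
  fix n
  show "fps_nth (inverse eu2_fps) n \<in> \<real>\<^sub>\<ge>\<^sub>0"
    using even_geo_nonneg[of n] eu2_inverse_nth[of n n] by (simp add: nonneg_fps_def)
qed

lemma eu2_inverse_nth_ge: "1 \<le> Re (fps_nth (inverse eu2_fps) (2 * n))"
  using even_geo_nth_ge[of "n" n] eu2_inverse_nth[of "2 * n" "Suc n"] by simp

lemma rank_tail_nonneg: "nonneg_fps (rank_tail m)"
proof -
  have "nonneg_fps (head_gf s l)" for s l by (simp add: nonneg_fps_def head_gf_def)
  then show ?thesis
    unfolding rank_tail_def rank_pair_gf_def rank_gf_def by (intro nonneg_fps_fsum nonneg_fps_add)
qed

text \<open>The shifts lose no coefficients: the dilated tail starts at degree \<open>6 * j + 3\<close>.\<close>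

definition Y_fps :: "complex fps" where
  "Y_fps = fsum (\<lambda>j. fps_shift (4 * j + 3) (dilate3 (rank_tail (2 * j))) + fps_shift (2 * j + 2) (dilate3 (rank_tail (2 * j))))"

lemma Y_nonneg: "nonneg_fps Y_fps"
proof -
  have "nonneg_fps (fps_shift a (dilate3 (rank_tail m)))" for a m
    using rank_tail_nonneg[of m] by (simp add: nonneg_fps_def dilate3_nth)
  then show ?thesis unfolding Y_fps_def by (intro nonneg_fps_fsum nonneg_fps_add)
qed

text \<open>Only the summand \<open>j = 0\<close> with shift 3 contributes; it reads off the single
  plain-headed overpartition of 1.\<close>

lemma Y_nth_0: "1 \<le> Re (fps_nth Y_fps 0)"
proof -
  have "fps_nth (rank_tail 0 + fps_X ^ Suc 0 * rank_tail (Suc (Suc 0))) 1 = fps_nth (fps_X ^ Suc 0 * (1 + 2 * rank_tail 0)) 1"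
    by (simp only: rank_tail_rec)
  then have "fps_nth (rank_tail 0) 1 = 1"
    by (simp add: rank_tail_nth_0 fps_X_power_mult_nth numeral_fps_const)
  moreover have "fps_nth Y_fps 0 = fps_nth (rank_tail 0) 1"
    unfolding Y_fps_def fsum_def fps_nth_Abs_fps atMost_0 by (simp add: dilate3_nth rank_tail_nth_0)
  ultimately show ?thesis by simp
qed

lemma Phi_Y:
  "dilate3 Phi * Y_fps = fsum (\<lambda>j. fps_shift (4 * j + 3) (dilate3 (rank_tail_num (2 * j))))
    + fsum (\<lambda>j. fps_shift (2 * j + 2) (dilate3 (rank_tail_num (2 * j))))"
proof -
  let ?D = "\<lambda>j. dilate3 (rank_tail (2 * j))"
  have z: "fps_nth (?D j) n = 0" if "n < 6 * j + 3" for j n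
    using that by (auto simp: dilate3_nth rank_tail_nth_0)
  have nz: "?D j \<noteq> 0 \<Longrightarrow> 6 * j + 3 \<le> subdegree (?D j)" for j
    by (rule subdegree_geI) (use z in auto)
  \<comment> \<open>The shift passes through the product because the dilated tail has order at least
    \<open>6 * j + 3\<close>, so no nonzero coefficient is cut off.\<close>
  have sh: "dilate3 Phi * fps_shift a (?D j) = fps_shift a (dilate3 (rank_tail_num (2 * j)))" if "a \<le> 6 * j + 3" for a j
  proof -
    have "dilate3 Phi * ?D j = dilate3 (rank_tail_num (2 * j))"
      by (simp add: dilate3_mult[symmetric] Phi_rank_tail)
    moreover have "dilate3 Phi * fps_shift a (?D j) = fps_shift a (dilate3 Phi * ?D j)"
      by (cases "?D j = 0") (use nz[of j] that in \<open>auto simp: fps_shift_mult\<close>)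
    ultimately show ?thesis by simp
  qed
  have "adm (\<lambda>j. fps_shift (4 * j + 3) (?D j) + fps_shift (2 * j + 2) (?D j))"
    unfolding adm_def by (auto simp: z)
  then have "dilate3 Phi * Y_fps = fsum (\<lambda>j. dilate3 Phi * (fps_shift (4 * j + 3) (?D j) + fps_shift (2 * j + 2) (?D j)))"
    unfolding Y_fps_def by (rule fsum_cmult[symmetric])
  then show ?thesis by (simp add: distrib_left sh fsum_add)
qed

lemma Phi_Y_expands:
  obtains ysum where "\<And>x. norm x \<le> 1 / 2 \<Longrightarrow> (yterm x has_sum ysum x) UNIV"
    "expands (dilate3 Phi * Y_fps) ysum"
proof -
  have g: "(\<lambda>j. fps_shift (a j) (dilate3 (rank_tail_num (2 * j)))) =
      (\<lambda>j. monomial_sum (\<lambda>k. (- 1) ^ k) (\<lambda>k. 3 * (Suc k * Suc k + 2 * j * Suc k) - a j))"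
    if "\<And>j. a j \<le> 6 * j + 3" for a
  proof (rule ext)
    fix j
    have "a j \<le> 3 * (Suc k * Suc k + 2 * j * Suc k)" for k
      using that[of j] by (simp add: algebra_simps)
    then show "fps_shift (a j) (dilate3 (rank_tail_num (2 * j))) =
      monomial_sum (\<lambda>k. (- 1) ^ k) (\<lambda>k. 3 * (Suc k * Suc k + 2 * j * Suc k) - a j)"
      unfolding rank_tail_num_monomial by (rule shift_dilate3_monomial)
  qed
  \<comment> \<open>The origin of the shifts in \<open>Y_fps\<close>: they are the constants by
    which the exponents of \<open>yterm\<close>, expanded geometrically in \<open>j\<close>, fall
    short of three times those of \<open>rank_tail_num (2 * j)\<close>.\<close>
  have e1: "3 * (Suc k * Suc k + 2 * j * Suc k) - (4 * j + 3) = (3 * k * k + 6 * k) + (6 * k + 2) * j" for j k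
    by (simp add: algebra_simps)
  have e2: "3 * (Suc k * Suc k + 2 * j * Suc k) - (2 * j + 2) = (3 * k * k + 6 * k + 1) + (6 * k + 4) * j" for j k
    by (simp add: algebra_simps)
  have g1: "(\<lambda>j. fps_shift (4 * j + 3) (dilate3 (rank_tail_num (2 * j)))) =
      (\<lambda>j. monomial_sum (\<lambda>k. (- 1) ^ k) (\<lambda>k. 3 * (Suc k * Suc k + 2 * j * Suc k) - (4 * j + 3)))"
    by (rule g) simp
  have g2: "(\<lambda>j. fps_shift (2 * j + 2) (dilate3 (rank_tail_num (2 * j)))) =
      (\<lambda>j. monomial_sum (\<lambda>k. (- 1) ^ k) (\<lambda>k. 3 * (Suc k * Suc k + 2 * j * Suc k) - (2 * j + 2)))"
    by (rule g) simp
  define F1 where "F1 = monomial_sum (\<lambda>(j :: nat, k). (- 1) ^ k) (\<lambda>(j, k). (3 * k * k + 6 * k) + (6 * k + 2) * j)"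
  define F2 where "F2 = monomial_sum (\<lambda>(j :: nat, k). (- 1) ^ k) (\<lambda>(j, k). (3 * k * k + 6 * k + 1) + (6 * k + 4) * j)"
  have "fsum (\<lambda>j. fps_shift (4 * j + 3) (dilate3 (rank_tail_num (2 * j)))) = F1"
    unfolding F1_def g1 e1
  proof (rule fsum_monomial_sum)
    show "finite {k. 3 * k * k + 6 * k + (6 * k + 2) * j = n}" for j n :: nat
      by (rule nat_fibre_finite) simp
    show "j \<le> 3 * k * k + 6 * k + (6 * k + 2) * j" for j k :: nat
      by (simp add: trans_le_add2)
  qed
  moreover have "fsum (\<lambda>j. fps_shift (2 * j + 2) (dilate3 (rank_tail_num (2 * j)))) = F2"
    unfolding F2_def g2 e2
  proof (rule fsum_monomial_sum)
    show "finite {k. 3 * k * k + 6 * k + 1 + (6 * k + 4) * j = n}" for j n :: nat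
      by (rule nat_fibre_finite) simp
    show "j \<le> 3 * k * k + 6 * k + 1 + (6 * k + 4) * j" for j k :: nat
      by (rule trans_le_add2) simp
  qed
  ultimately have F: "dilate3 Phi * Y_fps = F1 + F2" by (simp only: Phi_Y)
  have 1: "0 < fps_conv_radius F1" "norm x \<le> 1 / 2 \<Longrightarrow>
      ((\<lambda>k. (- 1) ^ k * x ^ (3 * k * k + 6 * k) / (1 - x ^ (6 * k + 2))) has_sum eval_fps F1 x) UNIV" for x
    unfolding F1_def by (rule geometric_pairs; simp add: norm_power)+
  have 2: "0 < fps_conv_radius F2" "norm x \<le> 1 / 2 \<Longrightarrow>
      ((\<lambda>k. (- 1) ^ k * x ^ (3 * k * k + 6 * k + 1) / (1 - x ^ (6 * k + 4))) has_sum eval_fps F2 x) UNIV" for x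
    unfolding F2_def by (rule geometric_pairs; simp add: norm_power algebra_simps)+
  show thesis
  proof (rule that)
    show "(yterm x has_sum eval_fps F1 x + eval_fps F2 x) UNIV" if "norm x \<le> 1 / 2" for x
      unfolding yterm_def[abs_def] by (intro has_sum_add 1 2 that)
    have "expands F1 (eval_fps F1)" "expands F2 (eval_fps F2)" using 1 2 by (simp_all add: expands_def)
    then show "expands (dilate3 Phi * Y_fps) (\<lambda>x. eval_fps F1 x + eval_fps F2 x)"
      unfolding F by (rule expands_add)
  qed
qed

text \<open>Summing \<open>rank_tail_num (3 * i + a)\<close> over \<open>i\<close> is geometric with
  ratio q^(3(k+1)), which creates the denominators of \<open>sterm\<close> at n = k+1. The index
  shift flips the sign.\<close>

lemma diff_num_expands:
  obtains s where "\<And>q. norm q \<le> 1 / 2 \<Longrightarrow> (sterm q has_sum s q) UNIV" "expands diff_num (\<lambda>q. 1 + 6 * s q)"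
proof -
  define F1 where "F1 = monomial_sum (\<lambda>(i :: nat, k). (- 1) ^ k) (\<lambda>(i, k). (Suc k * Suc k + Suc k) + (3 * Suc k) * i)"
  define F2 where "F2 = monomial_sum (\<lambda>(i :: nat, k). (- 1) ^ k) (\<lambda>(i, k). (Suc k * Suc k + 2 * Suc k) + (3 * Suc k) * i)"
  have e: "Suc k * Suc k + (3 * i + a) * Suc k = (Suc k * Suc k + a * Suc k) + (3 * Suc k) * i" for i k a
    by (simp add: algebra_simps)
  have f: "fsum (\<lambda>i. rank_tail_num (3 * i + a)) =
      monomial_sum (\<lambda>(i, k). (- 1) ^ k) (\<lambda>(i, k). (Suc k * Suc k + a * Suc k) + (3 * Suc k) * i)" for a
    unfolding rank_tail_num_monomial e
  proof (rule fsum_monomial_sum)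
    show "finite {k. Suc k * Suc k + a * Suc k + 3 * Suc k * i = n}" for i n
      by (rule nat_fibre_finite) simp
    have "i \<le> 3 * Suc k * i" for i k :: nat by simp
    from trans_le_add2[OF this] show "i \<le> Suc k * Suc k + a * Suc k + 3 * Suc k * i" for i k .
  qed
  have F: "diff_num = 1 - 6 * (F1 - F2)"
    using f[of 1] f[of 2] by (simp add: diff_num_def fsum_diff F1_def F2_def)
  have le: "i + k \<le> Suc k * Suc k + b + 3 * Suc k * i" for i k b :: nat
    by (rule order_trans[of _ "i + Suc k"]) (simp_all add: algebra_simps)
  have 1: "0 < fps_conv_radius F1" "norm x \<le> 1 / 2 \<Longrightarrow>
      ((\<lambda>k. (- 1) ^ k * x ^ (Suc k * Suc k + Suc k) / (1 - x ^ (3 * Suc k))) has_sum eval_fps F1 x) UNIV" for x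
    unfolding F1_def by (rule geometric_pairs; (rule le)?; simp add: norm_power)+
  have 2: "0 < fps_conv_radius F2" "norm x \<le> 1 / 2 \<Longrightarrow>
      ((\<lambda>k. (- 1) ^ k * x ^ (Suc k * Suc k + 2 * Suc k) / (1 - x ^ (3 * Suc k))) has_sum eval_fps F2 x) UNIV" for x
    unfolding F2_def by (rule geometric_pairs; (rule le)?; simp add: norm_power)+
  show thesis
  proof (rule that)
    show "(sterm q has_sum - (eval_fps F1 q - eval_fps F2 q)) UNIV" if "norm q \<le> 1 / 2" for q
    proof (rule has_sum_Suc_shift)
      have "sterm q (Suc k) = - ((- 1) ^ k * q ^ (Suc k * Suc k + Suc k) / (1 - q ^ (3 * Suc k))
         - (- 1) ^ k * q ^ (Suc k * Suc k + 2 * Suc k) / (1 - q ^ (3 * Suc k)))" for k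
        unfolding sterm_def power_Suc[of "- 1 :: complex"] by (simp only: right_diff_distrib diff_divide_distrib) simp
      then show "((\<lambda>k. sterm q (Suc k)) has_sum - (eval_fps F1 q - eval_fps F2 q)) UNIV"
        using has_sum_uminusI[OF has_sum_diff[OF 1(2)[OF that] 2(2)[OF that]]] by simp
    qed (simp add: sterm_def)
    have "expands F1 (eval_fps F1)" "expands F2 (eval_fps F2)" using 1 2 by (simp_all add: expands_def)
    then have "expands diff_num (\<lambda>q. 1 - 6 * (eval_fps F1 q - eval_fps F2 q))"
      unfolding F by (intro expands_intros)
    then show "expands diff_num (\<lambda>q. 1 + 6 * - (eval_fps F1 q - eval_fps F2 q))"
      by (simp only: mult_minus_right diff_conv_add_uminus)
  qed
qed

section \<open>The three residue classes and their signs\<close>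

definition R0 where "R0 = P_fps\<^sup>2 * inverse eu2_fps"
definition R1 where "R1 = P_fps * J_fps * inverse eu2_fps"
definition R2 where "R2 = fps_const (1 / 2) * (J_fps\<^sup>2 * inverse eu2_fps) + 6 * (fps_X * Y_fps)"

text \<open>Both sides are multiplied by \<open>Phi\<close> and compared as functions near 0;
  \<open>Phi\<close> is then cancelled among formal power series.\<close>

theorem diff_gf_dissection: "diff_gf = dilate3 R0 + fps_X * dilate3 R1 - fps_X\<^sup>2 * dilate3 R2"
proof -
  obtain ysum where ys: "\<And>x. norm x \<le> 1 / 2 \<Longrightarrow> (yterm x has_sum ysum x) UNIV"
    and Yx: "expands (dilate3 Phi * Y_fps) ysum" using Phi_Y_expands by blast
  obtain s where s: "\<And>q. norm q \<le> 1 / 2 \<Longrightarrow> (sterm q has_sum s q) UNIV"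
    and Sx: "expands diff_num (\<lambda>q. 1 + 6 * s q)" using diff_num_expands by blast
  have Phi0: "fps_nth Phi 0 \<noteq> 0"
    using Phi_overpartition_gf by (metis fps_mult_nth_0 fps_one_nth mult_zero_left zero_neq_one)
  then have D0: "fps_nth (dilate3 Phi) 0 \<noteq> 0" by (simp add: dilate3_nth)
  have "expands (inverse (dilate3 Phi) * (dilate3 Phi * Y_fps)) (\<lambda>x. 1 / phi (x ^ 3) * ysum x)"
    by (intro expands_intros Yx Phi_expands D0)
  moreover have "inverse (dilate3 Phi) * (dilate3 Phi * Y_fps) = Y_fps"
    using inverse_mult_eq_1[OF D0] by (simp add: mult.assoc[symmetric])
  ultimately have Y: "expands Y_fps (\<lambda>x. 1 / thA x * ysum x)" by (simp add: thA_def)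
  have e0: "fps_nth eu2_fps 0 \<noteq> 0" by (simp add: eu2_nth_0)
  have "expands (Phi * (dilate3 R0 + fps_X * dilate3 R1 - fps_X\<^sup>2 * dilate3 R2))
    (\<lambda>q. phi q * ((thP (q ^ 3))\<^sup>2 * (1 / eu ((q ^ 3)\<^sup>2)) + q * (thP (q ^ 3) * thJ (q ^ 3) * (1 / eu ((q ^ 3)\<^sup>2)))
      - q\<^sup>2 * (1 / 2 * ((thJ (q ^ 3))\<^sup>2 * (1 / eu ((q ^ 3)\<^sup>2))) + 6 * (q ^ 3 * (1 / thA (q ^ 3) * ysum (q ^ 3))))))"
    unfolding R0_def R1_def R2_def
    by (intro expands_intros expands_dilate3 Phi_expands P_expands J_expands eu2_expands e0 Y)
  moreover have "eventually (\<lambda>q. phi q * ((thP (q ^ 3))\<^sup>2 * (1 / eu ((q ^ 3)\<^sup>2)) + q * (thP (q ^ 3) * thJ (q ^ 3) * (1 / eu ((q ^ 3)\<^sup>2)))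
      - q\<^sup>2 * (1 / 2 * ((thJ (q ^ 3))\<^sup>2 * (1 / eu ((q ^ 3)\<^sup>2))) + 6 * (q ^ 3 * (1 / thA (q ^ 3) * ysum (q ^ 3))))) = 1 + 6 * s q) (at 0)"
    using eventually_small
  proof eventually_elim
    case (elim q)
    have "norm q ^ 3 \<le> norm q ^ 1" using elim by (intro power_decreasing) auto
    then have "norm (q ^ 3) \<le> 1 / 2" using elim by (simp add: norm_power)
    from phi_dissected_quotient[OF _ _ s ys[OF this]] elim
    have "phi q * ((thP (q ^ 3))\<^sup>2 / eu ((q ^ 3)\<^sup>2) + q * (thP (q ^ 3) * thJ (q ^ 3) / eu ((q ^ 3)\<^sup>2)) +
      q\<^sup>2 * (- ((thJ (q ^ 3))\<^sup>2 / (2 * eu ((q ^ 3)\<^sup>2))) - 6 * q ^ 3 * ysum (q ^ 3) / thA (q ^ 3))) = 1 + 6 * s q"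
      by simp
    then show ?case by (simp add: algebra_simps)
  qed
  ultimately have "Phi * (dilate3 R0 + fps_X * dilate3 R1 - fps_X\<^sup>2 * dilate3 R2) = Phi * diff_gf"
    unfolding Phi_diff_gf using Sx by (intro expands_unique)
  moreover have "Phi \<noteq> 0" using Phi0 by auto
  ultimately show ?thesis by simp
qed

lemma diff_gf_nth_residues:
  "fps_nth diff_gf (3 * n) = fps_nth R0 n" "fps_nth diff_gf (3 * n + 1) = fps_nth R1 n"
  "fps_nth diff_gf (3 * n + 2) = - fps_nth R2 n"
proof -
  have m: "\<not> 3 dvd 3 * n - 1 \<or> n = 0" "\<not> 3 dvd 3 * n - 2 \<or> n = 0" "\<not> 3 dvd 3 * n + 1" "\<not> 3 dvd 3 * n + 2"
    by presburger+
  show "fps_nth diff_gf (3 * n) = fps_nth R0 n" "fps_nth diff_gf (3 * n + 1) = fps_nth R1 n"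
    "fps_nth diff_gf (3 * n + 2) = - fps_nth R2 n"
    unfolding diff_gf_dissection using m by (auto simp: dilate3_nth fps_X_power_mult_nth)
qed

lemma R0_pos: "0 < Re (fps_nth R0 n)" and R1_pos: "0 < Re (fps_nth R1 n)" and R2_pos: "0 < Re (fps_nth R2 n)"
proof -
  have P: "nonneg_fps P_fps" and J: "nonneg_fps J_fps" by (simp_all add: P_fps_def J_fps_def theta_fps_nonneg)
  note E = eu2_inverse_nonneg
  have ge: "1 \<le> Re (fps_nth (F * G) (i + j))" if "nonneg_fps F" "nonneg_fps G" "1 \<le> Re (fps_nth F i)" "1 \<le> Re (fps_nth G j)" for F G i j
    using nth_mult_ge[OF that(1,2), of i j] mult_mono[OF that(3,4)] that(3,4) by simp
  have PP: "nonneg_fps (P_fps * P_fps)" and PJ: "nonneg_fps (P_fps * J_fps)" and JJ: "nonneg_fps (J_fps * J_fps)"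
    by (intro nonneg_fps_mult P J)+
  have PPc: "1 \<le> Re (fps_nth (P_fps * P_fps) 0)" "1 \<le> Re (fps_nth (P_fps * P_fps) 1)"
    using ge[OF P P, of 0 0] ge[OF P P, of 0 1] P_J_coeffs by simp_all
  have PJc: "1 \<le> Re (fps_nth (P_fps * J_fps) 0)" "1 \<le> Re (fps_nth (P_fps * J_fps) 1)"
    using ge[OF P J, of 0 0] ge[OF P J, of 1 0] P_J_coeffs by simp_all
  have JJc: "1 \<le> Re (fps_nth (J_fps * J_fps) 0)" "1 \<le> Re (fps_nth (J_fps * J_fps) 3)"
    using ge[OF J J, of 0 0] ge[OF J J, of 0 3] P_J_coeffs by simp_all
  obtain k where k: "n = 0 + 2 * k \<or> n = 1 + 2 * k" by (metis add.commute add_0 oddE evenE)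
  have "1 \<le> Re (fps_nth (P_fps * P_fps * inverse eu2_fps) n)"
    using ge[OF PP E PPc(1) eu2_inverse_nth_ge, of k] ge[OF PP E PPc(2) eu2_inverse_nth_ge, of k] k by auto
  then show "0 < Re (fps_nth R0 n)" by (simp add: R0_def power2_eq_square)
  have "1 \<le> Re (fps_nth (P_fps * J_fps * inverse eu2_fps) n)"
    using ge[OF PJ E PJc(1) eu2_inverse_nth_ge, of k] ge[OF PJ E PJc(2) eu2_inverse_nth_ge, of k] k by auto
  then show "0 < Re (fps_nth R1 n)" by (simp add: R1_def)
  have X: "nonneg_fps fps_X" by (simp add: nonneg_fps_def fps_X_def)
  have r2: "Re (fps_nth R2 n) = Re (fps_nth (J_fps * J_fps * inverse eu2_fps) n) / 2 + 6 * Re (fps_nth (fps_X * Y_fps) n)"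
    by (simp add: R2_def power2_eq_square numeral_fps_const)
  have nn: "0 \<le> Re (fps_nth (J_fps * J_fps * inverse eu2_fps) n)" "0 \<le> Re (fps_nth (fps_X * Y_fps) n)"
    using nonneg_fps_Re[OF nonneg_fps_mult[OF JJ E]] nonneg_fps_Re[OF nonneg_fps_mult[OF X Y_nonneg]] by auto
  show "0 < Re (fps_nth R2 n)"
  \<comment> \<open>J^2 has no term of degree 1 and 1/E has even degrees only, so here positivity
    must come from the constant term of \<open>Y_fps\<close>. Even degrees use the constant term of
    J^2, odd degrees from 3 on its coefficient of degree 3.\<close>
  proof (cases "n = 1")
    case True
    then have "1 \<le> Re (fps_nth (fps_X * Y_fps) n)" using Y_nth_0 by simp
    then show ?thesis using nn unfolding r2 by simp
  next
    case False
    have "1 \<le> Re (fps_nth (J_fps * J_fps * inverse eu2_fps) n)"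
    proof (cases "even n")
      case True
      then obtain k where "n = 0 + 2 * k" by auto
      then show ?thesis using ge[OF JJ E JJc(1) eu2_inverse_nth_ge, of k] by simp
    next
      case odd: False
      then obtain k where "n = 3 + 2 * k" using False
        by (metis One_nat_def Suc_1 add.commute add_Suc_right mult_0_right nat_arith.rule0 numeral_3_eq_3 oddE old.nat.exhaust mult_Suc_right plus_1_eq_Suc)
      then show ?thesis using ge[OF JJ E JJc(2) eu2_inverse_nth_ge, of k] by simp
    qed
    then show ?thesis using nn unfolding r2 by simp
  qed
qed

theorem theorem4:
  fixes n :: nat
  assumes "n \<ge> 1"
  shows "(n mod 3 = 0 \<or> n mod 3 = 1 \<longrightarrow> Nbar 0 3 n > Nbar 1 3 n) \<and>
         (n mod 3 = 2 \<longrightarrow> Nbar 0 3 n < Nbar 1 3 n)"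
proof -
  have d: "Re (fps_nth diff_gf n) = real (Nbar 0 3 n) - real (Nbar 1 3 n)"
    by (simp add: diff_gf_nth[OF assms])
  define m where "m = n div 3"
  have n: "n mod 3 = 0 \<Longrightarrow> n = 3 * m" "n mod 3 = 1 \<Longrightarrow> n = 3 * m + 1" "n mod 3 = 2 \<Longrightarrow> n = 3 * m + 2"
    unfolding m_def by presburger+
  have "0 < Re (fps_nth diff_gf n)" if "n mod 3 = 0"
    using R0_pos[of m] diff_gf_nth_residues(1)[of m] n(1)[OF that] by simp
  moreover have "0 < Re (fps_nth diff_gf n)" if "n mod 3 = 1"
    using R1_pos[of m] diff_gf_nth_residues(2)[of m] n(2)[OF that] by simp
  moreover have "Re (fps_nth diff_gf n) < 0" if "n mod 3 = 2"
    using R2_pos[of m] diff_gf_nth_residues(3)[of m] n(3)[OF that] by simp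
  ultimately show ?thesis unfolding d by auto
qed

end
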